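(* For every integer $n\ge 6$, $ex_{\mathcal{P}}(n,\Theta_6^2)\le \frac{18}{7}(n-2)$. Moreover, $ex_{\mathcal{P}}(n,\Theta_6^2)\ge \frac{18}{7}n-\frac{48}{7}$ for infinitely many $n$.
   Context: All graphs are finite and simple. $\Theta_6^2$ denotes the graph obtained from a $6$-cycle $v_1v_2v_3v_4v_5v_6$ by adding the chord $v_1v_3$ (joining two vertices at distance $2$ on the cycle). For a graph $H$, the planar Turán number $ex_{\mathcal{P}}(n,H)$ is the maximum number of edges in a planar graph on $n$ vertices that does not contain $H$ as a subgraph. *)

theory Defs
  imports "HOL-Analysis.Analysis"
begin

type_synonym 'a ugraph = "'a set \<times> 'a set set"

abbreviation vertices :: "'a ugraph \<Rightarrow> 'a set" where
  "vertices \<equiv> fst"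

abbreviation edges :: "'a ugraph \<Rightarrow> 'a set set" where
  "edges \<equiv> snd"

definition simple_graph :: "'a ugraph \<Rightarrow> bool" where
  "simple_graph G \<longleftrightarrow>
     finite (vertices G) \<and> (\<forall>e\<in>edges G. e \<subseteq> vertices G \<and> card e = 2)"

text \<open>Subgraphs are not required to be induced.\<close>

definition contains_subgraph :: "'a ugraph \<Rightarrow> 'b ugraph \<Rightarrow> bool" where
  "contains_subgraph G H \<longleftrightarrow>
     (\<exists>f. inj_on f (vertices H) \<and> f ` vertices H \<subseteq> vertices G \<and>
          (\<forall>e\<in>edges H. f ` e \<in> edges G))"

text \<open>The plane is represented by \<^typ>\<open>complex\<close>, as in the library's Jordan curve theorem.
  Vertices are drawn as distinct points and each edge as an arc (an injective path) joining its
  two ends; an arc meets no other vertex, and two arcs meet only in the points of common ends.\<close>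

definition plane_drawing ::
    "'a ugraph \<Rightarrow> ('a \<Rightarrow> complex) \<Rightarrow> ('a set \<Rightarrow> real \<Rightarrow> complex) \<Rightarrow> bool" where
  "plane_drawing G p \<gamma> \<longleftrightarrow>
     inj_on p (vertices G) \<and>
     (\<forall>e\<in>edges G. arc (\<gamma> e) \<and> {pathstart (\<gamma> e), pathfinish (\<gamma> e)} = p ` e \<and>
        path_image (\<gamma> e) \<inter> p ` vertices G = p ` e) \<and>
     (\<forall>e\<in>edges G. \<forall>e'\<in>edges G. e \<noteq> e' \<longrightarrow>
        path_image (\<gamma> e) \<inter> path_image (\<gamma> e') = p ` (e \<inter> e'))"

definition planar :: "'a ugraph \<Rightarrow> bool" where
  "planar G \<longleftrightarrow> (\<exists>p \<gamma>. plane_drawing G p \<gamma>)"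

text \<open>Since all graphs are finite, it is no restriction to take vertices in \<^typ>\<open>nat\<close>.\<close>

definition planar_free_sizes :: "nat \<Rightarrow> 'b ugraph \<Rightarrow> nat set" where
  "planar_free_sizes n H =
     {card (edges G) | G :: nat ugraph.
        simple_graph G \<and> card (vertices G) = n \<and> planar G \<and> \<not> contains_subgraph G H}"

text \<open>\<^const>\<open>Max\<close> is unspecified on empty and on infinite sets; the lemmas below show that
  neither case occurs when \<open>H\<close> has an edge.\<close>

definition ex_planar :: "nat \<Rightarrow> 'b ugraph \<Rightarrow> nat" where
  "ex_planar n H = Max (planar_free_sizes n H)"

definition Theta_6_2 :: "nat ugraph" where
  "Theta_6_2 = ({1..6}, {{1,2}, {2,3}, {3,4}, {4,5}, {5,6}, {6,1}} \<union> {{1,3}})"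

lemma finite_planar_free_sizes: "finite (planar_free_sizes n H)"
proof (rule finite_subset)
  show "planar_free_sizes n H \<subseteq> {..2 ^ n}"
  proof
    fix m assume "m \<in> planar_free_sizes n H"
    then obtain G :: "nat ugraph" where G: "m = card (edges G)" "simple_graph G"
      "card (vertices G) = n"
      by (auto simp: planar_free_sizes_def)
    have "finite (vertices G)" "edges G \<subseteq> Pow (vertices G)"
      using G(2) by (auto simp: simple_graph_def)
    then have "card (edges G) \<le> card (Pow (vertices G))"
      by (intro card_mono) auto
    then show "m \<in> {..2 ^ n}"
      using G \<open>finite (vertices G)\<close> by (simp add: card_Pow)
  qed
qed simp

lemma planar_free_sizes_nonempty:
  assumes "edges H \<noteq> {}"
  shows "planar_free_sizes n H \<noteq> {}"
proof -
  let ?G = "({..<n}, {}) :: nat ugraph"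
  have "plane_drawing ?G of_nat \<gamma>" for \<gamma>
    by (auto simp: plane_drawing_def inj_on_def)
  then have "planar ?G"
    unfolding planar_def by blast
  moreover have "simple_graph ?G" "\<not> contains_subgraph ?G H"
    using assms by (auto simp: simple_graph_def contains_subgraph_def)
  ultimately have "card (edges ?G) \<in> planar_free_sizes n H"
    unfolding planar_free_sizes_def by force
  then show ?thesis by blast
qed

end

theory Submission imports Defs begin

text \<open>
  Upper bound, by induction on the number of vertices. A graph that splits along at most one
  vertex is handled by adding the bounds of its two parts. Otherwise its drawing is built up from a
  cycle by adding ears, so that every face is bounded by a cycle and Euler's formula holds.
  Discharging then gives \<open>18 f \<le> 11 e\<close>: every edge offers 11, every face asks for 18, and only
  edges of triangular faces can be overdrawn. In the absence of \<open>\<Theta>\<^sub>6\<^sup>2\<close>, triangular faces form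
  few and small edge-connected clusters, and no cluster is overdrawn as a whole.

  Lower bound. Triangulate a large triangle and take two copies of it glued along the boundary.
  Put a copy of \<open>K\<^sub>5\<close> minus an edge into every small triangle, its outer vertices being the midpoints
  of the sides, so that neighbouring copies share one vertex. At each of the three corners, where
  the front and the back copy would share two vertices, use a single \<open>K\<^sub>4\<close> with one more vertex joined
  to two of its vertices instead. Any
  triangle and any 5-cycle lies within one gadget, and \<open>\<Theta>\<^sub>6\<^sup>2\<close> does not fit into one.
\<close>

section \<open>Faces bounded by cycles\<close>

text \<open>The inequality \<open>18 f \<le> 11 e\<close> is the bound in disguise: Euler's formula
  \<open>f = e + 2 - n\<close> turns it into \<open>7 e \<le> 18 (n - 2)\<close>. For two to five
  vertices that bound is false (five vertices can carry nine edges), so the induction allows an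
  excess of 9 there; gluing at a cut vertex gains exactly 18, which pays for the excess of both
  parts. Connectedness of the dual graph is carried along with the faces because it shows that a
  configuration closing up on at most five vertices would be the whole graph. The tight cluster
  consists of the five inner triangles of \<open>K\<^sub>5\<close> minus an edge, surrounded by
  faces of length at least six; this dictates the gadget of the lower bound. A gadget has 9 edges
  and, if each outer vertex lies in two gadgets, 3/2 + 2 vertices, whence the ratio 18/7. In a
  single large triangle the boundary vertices lie in one gadget only; the second copy supplies the
  missing partner. Against this count the six corner gadgets lose 30 edges and 9 vertices, and 7 *
  30 - 18 * 9 = 48.\<close>

lemma Jordan_two_arcs:
  fixes c1 c2 :: "real \<Rightarrow> complex"
  assumes "arc c1" "pathstart c1 = a" "pathfinish c1 = b"
    and "arc c2" "pathstart c2 = a" "pathfinish c2 = b"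
    and "path_image c1 \<inter> path_image c2 = {a, b}"
  defines "J \<equiv> path_image c1 \<union> path_image c2"
  shows "inside J \<noteq> {}" "open (inside J)" "connected (inside J)" "outside J \<noteq> {}"
    "open (outside J)" "connected (outside J)" "\<not> bounded (outside J)" "bounded (inside J)"
    "inside J \<inter> outside J = {}" "inside J \<union> outside J = - J"
    "frontier (inside J) = J" "frontier (outside J) = J"
proof -
  let ?c = "c1 +++ reversepath c2"
  have "simple_path ?c"
    using assms by (intro simple_path_join_loop) (auto simp: arc_reversepath)
  moreover have "pathfinish ?c = pathstart ?c" "path_image ?c = J"
    using assms by (auto simp: path_image_join)
  ultimately show "inside J \<noteq> {}" "open (inside J)" "connected (inside J)" "outside J \<noteq> {}"
    "open (outside J)" "connected (outside J)" "\<not> bounded (outside J)" "bounded (inside J)"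
    "inside J \<inter> outside J = {}" "inside J \<union> outside J = - J"
    "frontier (inside J) = J" "frontier (outside J) = J"
    using Jordan_inside_outside[of ?c] by auto
qed

text \<open>Connectedness puts \<open>F\<close> on one side. If it did not fill that side, the side,
  being connected, would meet the frontier of \<open>F\<close>, but the frontier lies on
  \<open>J\<close>.\<close>

lemma connected_eq_side:
  fixes F :: "complex set"
  assumes "connected F" "F \<noteq> {}" "open F" "F \<inter> J = {}" "frontier F \<subseteq> J"
    and "open I" "open U" "connected I" "connected U" "I \<union> U = - J" "I \<inter> U = {}"
  shows "F = I \<or> F = U"
proof -
  have side: "F = A" if "F \<subseteq> A" "connected A" "A \<inter> J = {}" for A
  proof (rule ccontr)
    assume "F \<noteq> A"
    then have "A - F \<noteq> {}" using that by auto
    moreover have "A \<inter> F \<noteq> {}" using that assms(2) by auto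
    ultimately have "A \<inter> frontier F \<noteq> {}"
      using connected_Int_frontier[OF that(2)] by auto
    then show False using assms(5) that(3) by auto
  qed
  have "F \<subseteq> I \<or> F \<subseteq> U"
    using connectedD[OF assms(1) assms(6,7)] assms(4,10,11) by blast
  then show ?thesis
    using side[of I] side[of U] assms by auto
qed

text \<open>Otherwise both insides formed with the help of \<open>c\<close> avoid \<open>c1\<close>
  and \<open>c2\<close>, which makes them disjoint from the inside of \<open>c1\<close> and
  \<open>c2\<close>. A point of that inside and a point far away then both lie outside both loops
  through \<open>c\<close>. These loops meet exactly in \<open>c\<close>, which is connected, so
  Janiszewski's theorem joins the two points off all three arcs, although the loop of
  \<open>c1\<close> and \<open>c2\<close> separates them.\<close>

lemma theta_outside:
  fixes c1 c2 c :: "real \<Rightarrow> complex"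
  assumes c1: "arc c1" "pathstart c1 = a" "pathfinish c1 = b"
    and c2: "arc c2" "pathstart c2 = a" "pathfinish c2 = b"
    and c: "arc c" "pathstart c = a" "pathfinish c = b"
    and c12: "path_image c1 \<inter> path_image c2 = {a, b}"
    and c1c: "path_image c1 \<inter> path_image c = {a, b}"
    and c2c: "path_image c2 \<inter> path_image c = {a, b}"
    and out: "path_image c \<inter> outside (path_image c1 \<union> path_image c2) \<noteq> {}"
  shows "path_image c2 \<inter> inside (path_image c1 \<union> path_image c) \<noteq> {} \<or>
    path_image c1 \<inter> inside (path_image c2 \<union> path_image c) \<noteq> {}"
proof (rule ccontr)
  let ?P1 = "path_image c1" and ?P2 = "path_image c2" and ?P = "path_image c"
  assume neg: "\<not> ?thesis"
  note J12 = Jordan_two_arcs[OF c1 c2 c12]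
  note J1 = Jordan_two_arcs[OF c1 c c1c]
  note J2 = Jordan_two_arcs[OF c2 c c2c]
  have ab: "a \<noteq> b" using c1 arc_distinct_ends by metis
  have cmp: "compact ?P1" "compact ?P2" "compact ?P"
    using c1 c2 c by (auto simp: compact_arc_image)
  have conP: "connected ?P" using c by (simp add: connected_arc_image)
  define U where "U = outside (?P1 \<union> ?P) \<inter> outside (?P2 \<union> ?P)"
  have o1: "outside (?P1 \<union> ?P) \<subseteq> - (?P1 \<union> ?P)" and o2: "outside (?P2 \<union> ?P) \<subseteq> - (?P2 \<union> ?P)"
    using J1(10) J2(10) by blast+
  have U_conn: "connected_component (- (?P1 \<union> ?P2 \<union> ?P)) x y" if "x \<in> U" "y \<in> U" for x y
  proof -
    have "connected_component (- ((?P1 \<union> ?P) \<union> (?P2 \<union> ?P))) x y"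
    proof (rule Janiszewski)
      show "compact (?P1 \<union> ?P)" "closed (?P2 \<union> ?P)"
        using cmp by (auto simp: compact_imp_closed closed_Un)
      have "?P1 \<inter> ?P2 \<subseteq> ?P" using c1c c12 by auto
      then have "(?P1 \<union> ?P) \<inter> (?P2 \<union> ?P) = ?P" by auto
      then show "connected ((?P1 \<union> ?P) \<inter> (?P2 \<union> ?P))" using conP by simp
      show "connected_component (- (?P1 \<union> ?P)) x y"
        unfolding connected_component_def
        using that J1(6) o1 by (intro exI[of _ "outside (?P1 \<union> ?P)"]) (simp add: U_def)
      show "connected_component (- (?P2 \<union> ?P)) x y"
        unfolding connected_component_def
        using that J2(6) o2 by (intro exI[of _ "outside (?P2 \<union> ?P)"]) (simp add: U_def)
    qed
    then show ?thesis by (simp add: Un_ac)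
  qed
  have Pout: "?P \<inter> inside (?P1 \<union> ?P2) = {}"
  proof (rule ccontr)
    assume i: "?P \<inter> inside (?P1 \<union> ?P2) \<noteq> {}"
    have con: "connected (?P - {a, b})"
      using connected_simple_path_endless[of c] c arc_imp_simple_path by auto
    have "?P - {a, b} \<subseteq> inside (?P1 \<union> ?P2) \<union> outside (?P1 \<union> ?P2)"
      using J12(10) c1c c2c by auto
    moreover have "(inside (?P1 \<union> ?P2) \<union> outside (?P1 \<union> ?P2)) \<inter> {a, b} = {}"
      using J12(10) c12 by blast
    then have "inside (?P1 \<union> ?P2) \<inter> (?P - {a, b}) \<noteq> {}"
      "outside (?P1 \<union> ?P2) \<inter> (?P - {a, b}) \<noteq> {}"
      using i out by blast+
    ultimately show False
      using connectedD[OF con J12(2,5)] J12(9) by blast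
  qed
  \<comment> \<open>An inside that met the inside of \<open>c1\<close> and \<open>c2\<close> would
    lie in it, being connected and off these arcs. Its frontier, and \<open>c\<close> with it, would
    stay in the closure, against \<open>out\<close>.\<close>
  have sub: "inside (?P1 \<union> ?P2) \<inter> inside (?P1 \<union> ?P) = {}"
    "inside (?P1 \<union> ?P2) \<inter> inside (?P2 \<union> ?P) = {}"
  proof -
    have half: "inside (?P1 \<union> ?P2) \<inter> inside (Q \<union> ?P) = {}"
      if Q: "frontier (inside (Q \<union> ?P)) = Q \<union> ?P" "open (inside (Q \<union> ?P))"
        "connected (inside (Q \<union> ?P))" "(?P1 \<union> ?P2) \<inter> inside (Q \<union> ?P) = {}"
        "Q \<subseteq> ?P1 \<union> ?P2" for Q :: "complex set"
    proof (rule ccontr)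
      assume ne: "\<not> ?thesis"
      have "inside (Q \<union> ?P) \<subseteq> inside (?P1 \<union> ?P2) \<union> outside (?P1 \<union> ?P2)"
        using Q(4) J12(10) by auto
      then have ss: "inside (Q \<union> ?P) \<subseteq> inside (?P1 \<union> ?P2)"
        using connectedD[OF Q(3) J12(2,5)] ne J12(9) by blast
      have "?P \<subseteq> closure (inside (?P1 \<union> ?P2))"
        using Q(1) closure_mono[OF ss] by (auto simp: frontier_def)
      then have "?P \<subseteq> inside (?P1 \<union> ?P2) \<union> (?P1 \<union> ?P2)"
        using J12(11) closure_Un_frontier by metis
      then show False
        using out J12(9,10) by blast
    qed
    show "inside (?P1 \<union> ?P2) \<inter> inside (?P1 \<union> ?P) = {}"
    proof (rule half[OF J1(11,2,3)])
      show "(?P1 \<union> ?P2) \<inter> inside (?P1 \<union> ?P) = {}"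
        using neg J1(10) by blast
    qed simp
    show "inside (?P1 \<union> ?P2) \<inter> inside (?P2 \<union> ?P) = {}"
    proof (rule half[OF J2(11,2,3)])
      show "(?P1 \<union> ?P2) \<inter> inside (?P2 \<union> ?P) = {}"
        using neg J2(10) by blast
    qed simp
  qed
  obtain x where x: "x \<in> inside (?P1 \<union> ?P2)" using J12(1) by auto
  have "x \<notin> ?P1 \<union> ?P2 \<union> ?P" using x Pout J12(10) by blast
  then have xU: "x \<in> U"
    unfolding U_def using x sub J1(10) J2(10) by blast
  have "bounded (?P1 \<union> ?P2 \<union> ?P \<union> inside (?P1 \<union> ?P) \<union> inside (?P2 \<union> ?P) \<union> inside (?P1 \<union> ?P2))"
    using cmp J1(8) J2(8) J12(8) by (simp add: compact_imp_bounded)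
  then obtain y where y: "y \<notin> ?P1 \<union> ?P2 \<union> ?P \<union> inside (?P1 \<union> ?P) \<union> inside (?P2 \<union> ?P) \<union> inside (?P1 \<union> ?P2)"
    by (metis UNIV_I not_bounded_UNIV subsetI bounded_subset)
  then have yU: "y \<in> U" unfolding U_def using J1(10) J2(10) by blast
  obtain T where T: "connected T" "T \<subseteq> - (?P1 \<union> ?P2 \<union> ?P)" "x \<in> T" "y \<in> T"
    using U_conn[OF xU yU] by (auto simp: connected_component_def)
  have "T \<subseteq> inside (?P1 \<union> ?P2) \<union> outside (?P1 \<union> ?P2)" using T(2) J12(10) by blast
  moreover have "y \<in> outside (?P1 \<union> ?P2)" using y J12(10) by blast
  ultimately show False
    using connectedD[OF T(1) J12(2,5)] T x J12(9) by blast
qed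

text \<open>The outside case of the next lemma as pure set algebra: \<open>R\<close> is the arc
  enclosed by \<open>Q\<close> and \<open>P\<close>; \<open>Iq\<close> and \<open>Oq\<close> are the
  sides of \<open>Q \<union> P\<close>, while \<open>Ir\<close> and \<open>I\<close> are the insides
  of \<open>R \<union> P\<close> and \<open>Q \<union> R\<close>.\<close>

lemma theta_set_algebra:
  assumes "Iq \<inter> Oq = {}" "Iq \<union> Oq = - (Q \<union> P)" "Ir \<inter> (R \<union> P) = {}"
    "I \<inter> Ir = {}" "I \<union> Ir \<union> (R - {a, b}) = Iq"
    "Q \<inter> R = {a, b}" "Q \<inter> P = {a, b}" "R \<inter> P = {a, b}"
  shows "- (Q \<union> R) - I - P = Oq \<union> Ir \<and> Oq \<inter> Ir = {}"
proof -
  have Ir: "Ir \<subseteq> Iq" "I \<subseteq> Iq" "R - {a, b} \<subseteq> Iq" using assms(5) by auto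
  have Oq: "Oq = - (Q \<union> P) - Iq" "Iq \<inter> (Q \<union> P) = {}" using assms(1,2) by auto
  have ab: "{a, b} \<subseteq> Q" using assms(6) by auto
  have eq: "Iq = I \<union> Ir \<union> (R - {a, b})" using assms(5) by simp
  have "x \<in> - (Q \<union> R) - I - P \<longleftrightarrow> x \<in> Oq \<union> Ir" for x
  proof (cases "x \<in> Iq")
    case True
    then show ?thesis using eq Oq ab assms(3,4) by auto
  next
    case False
    then show ?thesis using Oq(1) Ir ab by auto
  qed
  then show ?thesis using Ir(1) assms(1) by auto
qed

text \<open>By the Jordan curve theorem \<open>F\<close> is one of the two sides of the loop. For
  the inside the library's theta-curve lemma applies directly. The outside is reduced to it by
  choosing the arc that lies within the loop of the other one and \<open>c\<close>; the new faces
  are the outside of that larger loop and the inside of the smaller one.\<close>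

lemma split_face_by_arc:
  fixes c1 c2 c :: "real \<Rightarrow> complex"
  assumes c1: "arc c1" "pathstart c1 = a" "pathfinish c1 = b"
    and c2: "arc c2" "pathstart c2 = a" "pathfinish c2 = b"
    and c: "arc c" "pathstart c = a" "pathfinish c = b"
    and c12: "path_image c1 \<inter> path_image c2 = {a, b}"
    and F: "open F" "connected F" "F \<noteq> {}" "F \<inter> (path_image c1 \<union> path_image c2) = {}"
      "frontier F = path_image c1 \<union> path_image c2"
    and cF: "path_image c - {a, b} \<subseteq> F"
  obtains F1 F2 where "open F1" "connected F1" "F1 \<noteq> {}" "open F2" "connected F2" "F2 \<noteq> {}"
    "F1 \<inter> F2 = {}" "F1 \<union> F2 = F - path_image c"
    "frontier F1 = path_image c1 \<union> path_image c" "frontier F2 = path_image c2 \<union> path_image c"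
proof -
  let ?P1 = "path_image c1" and ?P2 = "path_image c2" and ?P = "path_image c"
  have abP: "a \<in> ?P" "b \<in> ?P" "a \<in> ?P1" "b \<in> ?P1" "a \<in> ?P2" "b \<in> ?P2"
    using c c1 c2 by (metis pathstart_in_path_image pathfinish_in_path_image)+
  have c1c: "?P1 \<inter> ?P = {a, b}" and c2c: "?P2 \<inter> ?P = {a, b}"
    using cF F(4) abP by auto
  note J12 = Jordan_two_arcs[OF c1 c2 c12]
  note J1 = Jordan_two_arcs[OF c1 c c1c]
  note J2 = Jordan_two_arcs[OF c2 c c2c]
  have ab: "a \<noteq> b" using c1 arc_distinct_ends by metis
  have nP: "?P - {a, b} \<noteq> {}"
    using c ab by (metis arc_imp_simple_path simple_path_image_uncountable finite.emptyI
        finite_insert finite_Diff2 uncountable_infinite)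
  have sp: "simple_path c1" "simple_path c2" "simple_path c"
    using c1 c2 c arc_imp_simple_path by auto
  have "F = inside (?P1 \<union> ?P2) \<or> F = outside (?P1 \<union> ?P2)"
    using F J12 by (intro connected_eq_side[where J = "?P1 \<union> ?P2"]) auto
  then show ?thesis
  proof
    assume Fi: "F = inside (?P1 \<union> ?P2)"
    then have "?P \<inter> inside (?P1 \<union> ?P2) \<noteq> {}" using cF nP by auto
    from split_inside_simple_closed_curve[OF sp(1) c1(2,3) sp(2) c2(2,3) sp(3) c(2,3) ab c12 c1c c2c this]
    have s: "inside (?P1 \<union> ?P) \<inter> inside (?P2 \<union> ?P) = {}"
      "inside (?P1 \<union> ?P) \<union> inside (?P2 \<union> ?P) \<union> (?P - {a, b}) = F"
      using Fi by auto
    show ?thesis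
    proof (rule that[of "inside (?P1 \<union> ?P)" "inside (?P2 \<union> ?P)"])
      have "?P \<inter> inside (?P1 \<union> ?P) = {}" "?P \<inter> inside (?P2 \<union> ?P) = {}"
        using J1(10) J2(10) by blast+
      moreover have "a \<notin> F" "b \<notin> F" using F(4) abP by auto
      ultimately show "inside (?P1 \<union> ?P) \<union> inside (?P2 \<union> ?P) = F - ?P"
        using s(2) by blast
    qed (use J1 J2 s in auto)
  next
    assume Fo: "F = outside (?P1 \<union> ?P2)"
    \<comment> \<open>Here \<open>q\<close> is the enclosing arc and \<open>r\<close> the enclosed
      one, so that both distributions of the roles share the argument.\<close>
    have key: "F - ?P = outside (Q \<union> ?P) \<union> inside (R \<union> ?P) \<and> outside (Q \<union> ?P) \<inter> inside (R \<union> ?P) = {}"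
      if Q: "R \<inter> inside (Q \<union> ?P) \<noteq> {}" "Q = path_image q" "R = path_image r" "simple_path q"
        "pathstart q = a" "pathfinish q = b" "simple_path r"
        "pathstart r = a" "pathfinish r = b" "?P1 \<union> ?P2 = Q \<union> R" "Q \<inter> R = {a, b}"
        "Q \<inter> ?P = {a, b}" "R \<inter> ?P = {a, b}"
        "inside (Q \<union> ?P) \<inter> outside (Q \<union> ?P) = {}"
        "inside (Q \<union> ?P) \<union> outside (Q \<union> ?P) = - (Q \<union> ?P)"
        "inside (R \<union> ?P) \<inter> (R \<union> ?P) = {}"
      for Q R q r
    proof -
      have "?P \<inter> R = {a, b}" using Q by auto
      with Q split_inside_simple_closed_curve[OF Q(4,5,6) sp(3) c(2,3) Q(7,8,9) ab]
      have s: "inside (Q \<union> R) \<inter> inside (?P \<union> R) = {}"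
        "inside (Q \<union> R) \<union> inside (?P \<union> R) \<union> (R - {a, b}) = inside (Q \<union> ?P)"
        by metis+
      have PR: "?P \<union> R = R \<union> ?P" by auto
      have Feq: "F = - (Q \<union> R) - inside (Q \<union> R)"
      proof -
        have "outside (?P1 \<union> ?P2) = - (?P1 \<union> ?P2) - inside (?P1 \<union> ?P2)"
          using J12(9,10) by blast
        then show ?thesis unfolding Fo Q(10) .
      qed
      have a: "a \<in> ?P" "b \<in> ?P" using abP by auto
      show ?thesis
        unfolding Feq using theta_set_algebra[OF Q(14-16) s[unfolded PR] Q(11-13)] .
    qed
    have "?P \<inter> outside (?P1 \<union> ?P2) \<noteq> {}" using cF nP Fo by auto
    have J1d: "inside (?P1 \<union> ?P) \<inter> (?P1 \<union> ?P) = {}" and J2d: "inside (?P2 \<union> ?P) \<inter> (?P2 \<union> ?P) = {}"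
      and c21: "?P2 \<inter> ?P1 = {a, b}"
      using J1(10) J2(10) c12 by blast+
    from theta_outside[OF c1 c2 c c12 c1c c2c \<open>?P \<inter> outside (?P1 \<union> ?P2) \<noteq> {}\<close>] show ?thesis
    proof
      assume "?P2 \<inter> inside (?P1 \<union> ?P) \<noteq> {}"
      from key[OF this refl refl sp(1) c1(2,3) sp(2) c2(2,3) refl c12 c1c c2c J1(9,10) J2d]
      have "F - ?P = outside (?P1 \<union> ?P) \<union> inside (?P2 \<union> ?P)"
        "outside (?P1 \<union> ?P) \<inter> inside (?P2 \<union> ?P) = {}" by blast+
      then show ?thesis
        using J1 J2 by (intro that[of "outside (?P1 \<union> ?P)" "inside (?P2 \<union> ?P)"]) auto
    next
      assume "?P1 \<inter> inside (?P2 \<union> ?P) \<noteq> {}"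
      from key[OF this refl refl sp(2) c2(2,3) sp(1) c1(2,3) Un_commute c21 c2c c1c J2(9,10) J1d] c12
      have "F - ?P = outside (?P2 \<union> ?P) \<union> inside (?P1 \<union> ?P)"
        "outside (?P2 \<union> ?P) \<inter> inside (?P1 \<union> ?P) = {}" by blast+
      then show ?thesis
        using J1 J2 by (intro that[of "inside (?P1 \<union> ?P)" "outside (?P2 \<union> ?P)"]) auto
    qed
  qed
qed

section \<open>Paths and cycles as sets of edges\<close>

fun pedges :: "'a list \<Rightarrow> 'a set set" where
  "pedges (x # y # xs) = insert {x, y} (pedges (y # xs))"
| "pedges _ = {}"

lemma finite_pedges [simp]: "finite (pedges xs)"
  by (induction xs rule: pedges.induct) auto

lemma Union_pedges_subset: "\<Union>(pedges xs) \<subseteq> set xs"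
  by (induction xs rule: pedges.induct) auto

lemma Union_pedges: "2 \<le> length xs \<Longrightarrow> \<Union>(pedges xs) = set xs"
proof (induction xs rule: pedges.induct)
  case (1 x y xs)
  then show ?case by (cases xs) auto
qed auto

lemma pedges_append: "pedges (xs @ v # ys) = pedges (xs @ [v]) \<union> pedges (v # ys)"
proof (induction xs)
  case (Cons x xs)
  then show ?case by (cases xs) auto
qed auto

lemma pedges_snoc2: "pedges (xs @ [x, y]) = insert {x, y} (pedges (xs @ [x]))"
  using pedges_append[of xs x "[y]"] by auto

lemma pedges_rev [simp]: "pedges (rev xs) = pedges xs"
proof (induction xs rule: pedges.induct)
  case (1 x y xs)
  then show ?case
    using pedges_snoc2[of "rev xs" y x] by (auto simp: insert_commute)
qed auto

lemma card_pedges: "distinct xs \<Longrightarrow> card (pedges xs) = length xs - 1"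
proof (induction xs rule: pedges.induct)
  case (1 x y xs)
  have "{x, y} \<notin> pedges (y # xs)"
    using 1(2) Union_pedges_subset[of "y # xs"] by auto
  then show ?case using 1 by auto
qed auto

text \<open>A cycle is kept as a bare edge set, so that start and direction are forgotten and a
  boundary can be cut or re-read at any edge.\<close>

definition is_cycle :: "'a set set \<Rightarrow> bool" where
  "is_cycle C \<longleftrightarrow> (\<exists>x xs. distinct (x # xs) \<and> 2 \<le> length xs \<and> C = pedges (x # xs @ [x]))"

lemma Union_cycle: "xs \<noteq> [] \<Longrightarrow> \<Union>(pedges (x # xs @ [x])) = set (x # xs)"
  by (subst Union_pedges) auto

lemma card_cycle: "distinct (x # xs) \<Longrightarrow> 2 \<le> length xs \<Longrightarrow> card (pedges (x # xs @ [x])) = Suc (length xs)"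
proof -
  assume d: "distinct (x # xs)" "2 \<le> length xs"
  define y ys where "y = last xs" and "ys = butlast xs"
  have xs: "xs = ys @ [y]" using d unfolding y_def ys_def by (cases xs rule: rev_cases) auto
  have ys: "ys \<noteq> []" using d xs by auto
  have eq: "pedges (x # xs @ [x]) = insert {x, y} (pedges (x # xs))"
    using pedges_snoc2[of "x # ys" y x] xs by (auto simp: insert_commute)
  obtain z zs where zs: "ys = z # zs" using ys by (cases ys) auto
  have "{x, y} \<notin> pedges (x # xs)"
  proof
    assume "{x, y} \<in> pedges (x # xs)"
    then have "{x, y} = {x, z} \<or> {x, y} \<in> pedges xs" using xs zs by auto
    then show False
      using d xs zs Union_pedges_subset[of xs] by (auto simp: doubleton_eq_iff)
  qed
  then show ?thesis using eq card_pedges[OF d(1)] by simp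
qed

text \<open>The list is rotated so as to start at \<open>u\<close> and is then cut at
  \<open>v\<close>. One of the segments is non-empty because a cycle has at least three
  vertices.\<close>

lemma cycle_split:
  assumes "is_cycle C" "u \<in> \<Union>C" "v \<in> \<Union>C" "u \<noteq> v"
  obtains as bs where "distinct (u # as @ v # bs)" "as \<noteq> [] \<or> bs \<noteq> []"
    "C = pedges (u # as @ [v]) \<union> pedges (v # bs @ [u])"
proof -
  obtain x xs where x: "distinct (x # xs)" "2 \<le> length xs" "C = pedges (x # xs @ [x])"
    using assms(1) by (auto simp: is_cycle_def)
  have "xs \<noteq> []" using x(2) by auto
  then have U: "\<Union>C = set (x # xs)" using x(3) Union_cycle[of xs x] by simp
  obtain ys where ys: "distinct (u # ys)" "length ys = length xs" "set (u # ys) = set (x # xs)"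
    "C = pedges (u # ys @ [u])"
  proof -
    have "u \<in> set (x # xs)" using assms(2) U by simp
    then obtain l r where lr: "x # xs = l @ u # r" by (meson split_list)
    show ?thesis
    proof (cases l)
      case Nil
      then show ?thesis using that[of xs] lr x by auto
    next
      case (Cons h l')
      then have h: "h = x" "xs = l' @ u # r" using lr by auto
      have "C = pedges (x # l' @ [u]) \<union> pedges (u # r @ [x])"
        using x(3) pedges_append[of "x # l'" u "r @ [x]"] h by auto
      also have "\<dots> = pedges (u # (r @ x # l') @ [u])"
        using pedges_append[of "u # r" x "l' @ [u]"] by auto
      finally show ?thesis using that[of "r @ x # l'"] h x by auto
    qed
  qed
  have "v \<in> set ys" using assms U ys by auto
  then obtain as bs where ab: "ys = as @ v # bs" by (meson split_list)
  have "C = pedges (u # as @ [v]) \<union> pedges (v # bs @ [u])"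
    using ys(4) ab pedges_append[of "u # as" v "bs @ [u]"] by auto
  moreover have "as \<noteq> [] \<or> bs \<noteq> []" using x(2) ys(2) ab by auto
  ultimately show ?thesis using that[of as bs] ys ab by auto
qed

lemma is_cycle_join:
  assumes "distinct (u # as @ v # bs)" "as \<noteq> [] \<or> bs \<noteq> []"
  shows "is_cycle (pedges (u # as @ [v]) \<union> pedges (v # bs @ [u]))"
  unfolding is_cycle_def
proof (intro exI conjI)
  show "distinct (u # (as @ v # bs))" using assms by auto
  show "2 \<le> length (as @ v # bs)" using assms by (cases as; cases bs) auto
  show "pedges (u # as @ [v]) \<union> pedges (v # bs @ [u]) = pedges (u # (as @ v # bs) @ [u])"
    using pedges_append[of "u # as" v "bs @ [u]"] by auto
qed

lemma cycle_card_Union: "is_cycle C \<Longrightarrow> card (\<Union>C) = card C \<and> 3 \<le> card C"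
  unfolding is_cycle_def
proof (elim exE conjE)
  fix x xs assume d: "distinct (x # xs)" "2 \<le> length xs" "C = pedges (x # xs @ [x])"
  have "xs \<noteq> []" using d(2) by auto
  then have "\<Union>C = set (x # xs)" using d(3) Union_cycle[of xs x] by simp
  then show ?thesis
    using card_cycle[OF d(1,2)] distinct_card[OF d(1)] d(2,3) by simp
qed

section \<open>Faces of a drawing under the addition of ears\<close>

locale drawn_graph =
  fixes G :: "'a ugraph" and p \<gamma>
  assumes simple: "simple_graph G" and drawing: "plane_drawing G p \<gamma>"
begin

definition img :: "'a set set \<Rightarrow> complex set" where "img A = (\<Union>e\<in>A. path_image (\<gamma> e))"

lemma finE: "finite (edges G)"
  using simple by (auto simp: simple_graph_def intro: finite_subset[of _ "Pow (vertices G)"])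

lemma img_Un: "img (A \<union> B) = img A \<union> img B" by (auto simp: img_def)

lemma arc_edge: "e \<in> edges G \<Longrightarrow> arc (\<gamma> e)"
  using drawing by (auto simp: plane_drawing_def)

lemma ends_edge: "e \<in> edges G \<Longrightarrow> {pathstart (\<gamma> e), pathfinish (\<gamma> e)} = p ` e"
  using drawing by (auto simp: plane_drawing_def)

lemma inj_p: "inj_on p (vertices G)" using drawing by (auto simp: plane_drawing_def)

lemma edge_vertices: "e \<in> edges G \<Longrightarrow> e \<subseteq> vertices G"
  using simple by (auto simp: simple_graph_def)

lemma edge_Int_vertices: "e \<in> edges G \<Longrightarrow> path_image (\<gamma> e) \<inter> p ` vertices G = p ` e"
  using drawing unfolding plane_drawing_def by blast

lemma edge_Int_edge:
  "e \<in> edges G \<Longrightarrow> f \<in> edges G \<Longrightarrow> e \<noteq> f \<Longrightarrow> path_image (\<gamma> e) \<inter> path_image (\<gamma> f) = p ` (e \<inter> f)"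
  using drawing unfolding plane_drawing_def by blast

lemma img_Int_vertices:
  assumes "A \<subseteq> edges G"
  shows "img A \<inter> p ` vertices G = p ` (\<Union>A)"
proof -
  have "path_image (\<gamma> e) \<inter> p ` vertices G = p ` e" if "e \<in> A" for e
    using that assms by (intro edge_Int_vertices) auto
  then show ?thesis unfolding img_def by blast
qed

lemma img_Int:
  assumes "A \<subseteq> edges G" "B \<subseteq> edges G" "A \<inter> B = {}"
  shows "img A \<inter> img B = p ` (\<Union>A \<inter> \<Union>B)"
proof
  show "img A \<inter> img B \<subseteq> p ` (\<Union>A \<inter> \<Union>B)"
  proof
    fix z assume "z \<in> img A \<inter> img B"
    then obtain e f where ef: "e \<in> A" "f \<in> B" "z \<in> path_image (\<gamma> e) \<inter> path_image (\<gamma> f)"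
      by (auto simp: img_def)
    then have "e \<noteq> f" "e \<in> edges G" "f \<in> edges G" using assms by auto
    then have "z \<in> p ` (e \<inter> f)" using edge_Int_edge ef(3) by auto
    then show "z \<in> p ` (\<Union>A \<inter> \<Union>B)" using ef by auto
  qed
  show "p ` (\<Union>A \<inter> \<Union>B) \<subseteq> img A \<inter> img B"
    using img_Int_vertices[OF assms(1)] img_Int_vertices[OF assms(2)] by blast
qed

lemma closed_img: "A \<subseteq> edges G \<Longrightarrow> closed (img A)"
  unfolding img_def
  by (intro closed_UN) (auto intro: finite_subset[OF _ finE] closed_arc_image arc_edge)

lemma arc_of_edge:
  assumes "{x, y} \<in> edges G"
  obtains g where "arc g" "pathstart g = p x" "pathfinish g = p y" "path_image g = path_image (\<gamma> {x, y})"
proof -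
  have e: "arc (\<gamma> {x, y})" "{pathstart (\<gamma> {x, y}), pathfinish (\<gamma> {x, y})} = {p x, p y}"
    using arc_edge[OF assms] ends_edge[OF assms] by auto
  show ?thesis
  proof (cases "pathstart (\<gamma> {x, y}) = p x")
    case True
    then show ?thesis using that[of "\<gamma> {x, y}"] e by (auto simp: doubleton_eq_iff)
  next
    case False
    then show ?thesis using that[of "reversepath (\<gamma> {x, y})"] e
      by (auto simp: doubleton_eq_iff arc_reversepath)
  qed
qed

lemma arc_of_path:
  assumes "distinct xs" "2 \<le> length xs" "pedges xs \<subseteq> edges G"
  shows "\<exists>g. arc g \<and> pathstart g = p (hd xs) \<and> pathfinish g = p (last xs) \<and> path_image g = img (pedges xs)"
  using assms
proof (induction xs rule: pedges.induct)
  case (1 x y xs)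
  obtain g where g: "arc g" "pathstart g = p x" "pathfinish g = p y" "path_image g = path_image (\<gamma> {x, y})"
    using arc_of_edge[of x y] 1 by auto
  show ?case
  proof (cases xs)
    case Nil
    then show ?thesis using g by (auto simp: img_def)
  next
    case (Cons z zs)
    obtain h where h: "arc h" "pathstart h = p y" "pathfinish h = p (last (y # xs))"
      "path_image h = img (pedges (y # xs))"
      using 1 Cons by auto
    have U: "\<Union>(pedges (y # xs)) = set (y # xs)" using Union_pedges[of "y # xs"] Cons by auto
    have "{x, y} \<notin> pedges (y # xs)"
      using 1(2) Union_pedges_subset[of "y # xs"] by auto
    then have "img {{x, y}} \<inter> img (pedges (y # xs)) = p ` (\<Union>{{x, y}} \<inter> \<Union>(pedges (y # xs)))"
      using 1 by (intro img_Int) auto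
    also have "\<dots> = {p y}" using U 1(2) by auto
    finally have "path_image g \<inter> path_image h \<subseteq> {pathstart h}"
      using g h by (auto simp: img_def)
    then have "arc (g +++ h)" using g h by (intro arc_join) auto
    moreover have "path_image (g +++ h) = img (pedges (x # y # xs))"
      using g h by (auto simp: path_image_join img_def)
    ultimately show ?thesis using g h by (intro exI[of _ "g +++ h"]) auto
  qed
qed auto

text \<open>The invariant of the ear construction for the part \<open>E\<close> drawn so far. Faces
  are pairs of a region and its boundary, because two regions may have the same boundary cycle. The
  last clause says that the dual graph is connected.\<close>

definition good :: "'a set set \<Rightarrow> (complex set \<times> 'a set set) set \<Rightarrow> bool" where
  "good E FF \<longleftrightarrow> E \<subseteq> edges G \<and> finite FF \<and> inj_on fst FF \<and> fst ` FF = components (- img E) \<and>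
    (\<forall>(F, C)\<in>FF. is_cycle C \<and> C \<subseteq> E \<and> frontier F = img C) \<and>
    (\<forall>e\<in>E. card {f\<in>FF. e \<in> snd f} = 2) \<and> card FF + card (\<Union>E) = card E + 2 \<and>
    (\<forall>S. S \<subset> FF \<and> S \<noteq> {} \<longrightarrow> (\<exists>f\<in>S. \<exists>g\<in>FF - S. snd f \<inter> snd g \<noteq> {}))"

lemma arcs_of_cycle:
  assumes "distinct (u # as @ v # bs)" "as \<noteq> [] \<or> bs \<noteq> []"
    "pedges (u # as @ [v]) \<union> pedges (v # bs @ [u]) \<subseteq> edges G"
  obtains c1 c2 where "arc c1" "pathstart c1 = p u" "pathfinish c1 = p v"
    "arc c2" "pathstart c2 = p u" "pathfinish c2 = p v"
    "path_image c1 = img (pedges (u # as @ [v]))" "path_image c2 = img (pedges (v # bs @ [u]))"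
    "path_image c1 \<inter> path_image c2 = {p u, p v}"
    "pedges (u # as @ [v]) \<inter> pedges (v # bs @ [u]) = {}"
proof -
  obtain c1 where c1: "arc c1" "pathstart c1 = p u" "pathfinish c1 = p v"
    "path_image c1 = img (pedges (u # as @ [v]))"
    using arc_of_path[of "u # as @ [v]"] assms by auto
  obtain c2 where c2: "arc c2" "pathstart c2 = p v" "pathfinish c2 = p u"
    "path_image c2 = img (pedges (v # bs @ [u]))"
    using arc_of_path[of "v # bs @ [u]"] assms by auto
  have U: "\<Union>(pedges (u # as @ [v])) = set (u # as @ [v])" "\<Union>(pedges (v # bs @ [u])) = set (v # bs @ [u])"
    by (rule Union_pedges, simp)+
  \<comment> \<open>A common edge could only join \<open>u\<close> and \<open>v\<close>, and it lies
    in both segments only if both have no inner vertex.\<close>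
  have disj: "pedges (u # as @ [v]) \<inter> pedges (v # bs @ [u]) = {}"
  proof (rule ccontr)
    assume "\<not> ?thesis"
    then obtain e where e: "e \<in> pedges (u # as @ [v])" "e \<in> pedges (v # bs @ [u])" by auto
    then have "e \<subseteq> {u, v}" using U assms(1) by auto
    moreover have "card e = 2" using e assms(3) simple by (auto simp: simple_graph_def)
    ultimately have uv: "e = {u, v}" using assms(1)
      by (metis card_2_iff card_seteq finite.emptyI finite.insertI le_refl distinct.simps(2) in_set_conv_decomp)
    have "as = []"
    proof (rule ccontr)
      assume "as \<noteq> []"
      then obtain z zs where "as = z # zs" by (cases as) auto
      then show False using e(1) uv assms(1) Union_pedges_subset[of "z # zs @ [v]"]
        by (auto simp: doubleton_eq_iff)
    qed
    moreover have "bs = []"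
    proof (rule ccontr)
      assume "bs \<noteq> []"
      then obtain z zs where "bs = z # zs" by (cases bs) auto
      then show False using e(2) uv assms(1) Union_pedges_subset[of "z # zs @ [u]"]
        by (auto simp: doubleton_eq_iff)
    qed
    ultimately show False using assms(2) by auto
  qed
  have "path_image c1 \<inter> path_image c2 = p ` (set (u # as @ [v]) \<inter> set (v # bs @ [u]))"
    using img_Int[OF _ _ disj] assms(3) c1 c2 U by auto
  also have "set (u # as @ [v]) \<inter> set (v # bs @ [u]) = {u, v}" using assms(1) by auto
  finally show ?thesis using that[of c1 "reversepath c2"] c1 c2 disj by (auto simp: arc_reversepath)
qed

text \<open>The base of the construction: the two faces are the sides of a Jordan curve and share
  all of its edges.\<close>

lemma good_cycle:
  assumes "is_cycle C" "C \<subseteq> edges G"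
  shows "\<exists>FF. good C FF"
proof -
  obtain x xs where x: "distinct (x # xs)" "2 \<le> length xs" "C = pedges (x # xs @ [x])"
    using assms(1) by (auto simp: is_cycle_def)
  have "xs \<noteq> []" using x(2) by auto
  then have "\<Union>C = set (x # xs)" using x(3) Union_cycle[of xs x] by simp
  moreover have "last xs \<in> set xs" using \<open>xs \<noteq> []\<close> by simp
  ultimately have "x \<in> \<Union>C" "last xs \<in> \<Union>C" "x \<noteq> last xs" using x(1) by auto
  then obtain u v as bs where s: "distinct (u # as @ v # bs)" "as \<noteq> [] \<or> bs \<noteq> []"
    "C = pedges (u # as @ [v]) \<union> pedges (v # bs @ [u])"
    using cycle_split[OF assms(1)] by metis
  obtain c1 c2 where c: "arc c1" "pathstart c1 = p u" "pathfinish c1 = p v"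
    "arc c2" "pathstart c2 = p u" "pathfinish c2 = p v"
    "path_image c1 = img (pedges (u # as @ [v]))" "path_image c2 = img (pedges (v # bs @ [u]))"
    "path_image c1 \<inter> path_image c2 = {p u, p v}"
    using arcs_of_cycle[OF s(1,2)] s(3) assms(2) by metis
  have J: "path_image c1 \<union> path_image c2 = img C" using c(7,8) s(3) by (simp add: img_Un)
  note J' = Jordan_two_arcs[OF c(1-6,9), unfolded J]
  let ?I = "inside (img C)" and ?O = "outside (img C)"
  let ?FF = "{(?I, C), (?O, C)}"
  have ne: "?I \<noteq> ?O" using J' by auto
  have "good C ?FF"
    unfolding good_def
  proof (intro conjI)
    have "components (- img C) = {?I, ?O}"
    proof (rule components_open_unique)
      show "pairwise disjnt {?I, ?O}" using J'(9) by (simp add: pairwise_insert disjnt_def Int_commute)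
    qed (use J' in auto)
    then show "fst ` ?FF = components (- img C)" by auto
    show "\<forall>e\<in>C. card {f \<in> ?FF. e \<in> snd f} = 2"
    proof
      fix e assume "e \<in> C"
      then have "{f \<in> ?FF. e \<in> snd f} = ?FF" by auto
      then show "card {f \<in> ?FF. e \<in> snd f} = 2" using ne by simp
    qed
    have "card ?FF = 2" using ne by simp
    then show "card ?FF + card (\<Union>C) = card C + 2"
      using cycle_card_Union[OF assms(1)] by simp
    have "C \<noteq> {}" using cycle_card_Union[OF assms(1)] by auto
    show "\<forall>S. S \<subset> ?FF \<and> S \<noteq> {} \<longrightarrow> (\<exists>f\<in>S. \<exists>g\<in>?FF - S. snd f \<inter> snd g \<noteq> {})"
    proof (intro allI impI)
      fix S assume S: "S \<subset> ?FF \<and> S \<noteq> {}"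
      then obtain f where f: "f \<in> S" by auto
      from S obtain g where "g \<in> ?FF" "g \<notin> S" by (metis psubset_imp_ex_mem Diff_iff)
      with f have fg: "f \<in> S" "g \<in> ?FF - S" by auto
      have "f \<in> ?FF" "g \<in> ?FF" using S fg by (meson psubsetD Diff_iff)+
      then have "snd f \<inter> snd g = C" by auto
      with \<open>C \<noteq> {}\<close> fg show "\<exists>f\<in>S. \<exists>g\<in>?FF - S. snd f \<inter> snd g \<noteq> {}" by metis
    qed
  qed (use assms J' ne in \<open>auto simp: inj_on_def\<close>)
  then show ?thesis by blast
qed


lemma arc_endpoints_in_closure:
  assumes "arc c"
  shows "{pathstart c, pathfinish c} \<subseteq> closure (path_image c - {pathstart c, pathfinish c})"
proof -
  have "c ` closure {0<..<1} \<subseteq> closure (c ` {0<..<1})"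
    using assms arc_imp_path[of c]
    by (intro image_closure_subset closure_subset) (auto simp: path_def)
  moreover have "path_image c - {pathstart c, pathfinish c} = c ` {0<..<1}"
    using assms arc_imp_simple_path simple_path_endless by blast
  ultimately show ?thesis by (auto simp: pathstart_def pathfinish_def)
qed

text \<open>The open ear is connected and avoids \<open>img E\<close>, so it lies in one face. Its
  ends lie on the boundary cycle of that face and cut it into two arcs, hence
  \<open>split_face_by_arc\<close> replaces the face by two. All other faces stay.\<close>

lemma good_ear:
  assumes good: "good E FF"
    and ear: "distinct (u # is @ [v])" "pedges (u # is @ [v]) \<subseteq> edges G" "pedges (u # is @ [v]) \<inter> E = {}"
      "u \<in> \<Union>E" "v \<in> \<Union>E" "set is \<inter> \<Union>E = {}"
  shows "\<exists>FF'. good (E \<union> pedges (u # is @ [v])) FF'"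
proof -
  define P where "P = pedges (u # is @ [v])"
  note ear = ear[folded P_def]
  have EG: "E \<subseteq> edges G" and finFF: "finite FF" and injFF: "inj_on fst FF"
    and comps: "fst ` FF = components (- img E)"
    and faces: "\<And>F C. (F, C) \<in> FF \<Longrightarrow> is_cycle C \<and> C \<subseteq> E \<and> frontier F = img C"
    and two: "\<And>e. e \<in> E \<Longrightarrow> card {f\<in>FF. e \<in> snd f} = 2"
    and euler: "card FF + card (\<Union>E) = card E + 2"
    and dual: "\<And>S. S \<subset> FF \<Longrightarrow> S \<noteq> {} \<Longrightarrow> \<exists>f\<in>S. \<exists>g\<in>FF - S. snd f \<inter> snd g \<noteq> {}"
    using good by (auto simp: good_def)
  have uv: "u \<noteq> v" using ear by auto
  have UP: "\<Union>P = set (u # is @ [v])" unfolding P_def by (rule Union_pedges) simp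
  obtain c where c: "arc c" "pathstart c = p u" "pathfinish c = p v" "path_image c = img P"
    using arc_of_path[of "u # is @ [v]"] ear by (auto simp: P_def)
  have PE: "img P \<inter> img E = {p u, p v}"
  proof -
    have "\<Union>P \<inter> \<Union>E = {u, v}" using UP ear by auto
    then show ?thesis using img_Int[OF ear(2) EG ear(3)] by simp
  qed
  define L where "L = img P - {p u, p v}"
  have L: "connected L" "L \<subseteq> - img E" "{p u, p v} \<subseteq> closure L" "L \<noteq> {}"
  proof -
    show "connected L"
      using connected_simple_path_endless[of c] c arc_imp_simple_path by (auto simp: L_def)
    show "L \<subseteq> - img E" using PE by (auto simp: L_def)
    show "{p u, p v} \<subseteq> closure L"
      using arc_endpoints_in_closure[OF c(1)] c by (simp add: L_def)
    then show "L \<noteq> {}" by auto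
  qed
  have open_compl: "open (- img E)" using closed_img[OF EG] by auto
  obtain F where F: "F \<in> components (- img E)" "L \<subseteq> F"
  proof -
    obtain z where z: "z \<in> L" using L by auto
    let ?F = "connected_component_set (- img E) z"
    have "?F \<in> components (- img E)" using z L by (auto simp: components_def)
    moreover have "L \<subseteq> ?F" using L z by (intro connected_component_maximal) auto
    ultimately show ?thesis using that by blast
  qed
  obtain C where FC: "(F, C) \<in> FF" using F comps by (metis (no_types, lifting) imageE prod.collapse)
  have C: "is_cycle C" "C \<subseteq> E" "frontier F = img C" using faces[OF FC] by auto
  have F': "open F" "connected F" "F \<noteq> {}" "F \<subseteq> - img E"
    using open_components[OF open_compl F(1)] in_components_connected[OF F(1)]
      in_components_nonempty[OF F(1)] in_components_subset[OF F(1)] by auto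
  \<comment> \<open>The ends are limits of points of the ear, hence in the closure of
    \<open>F\<close> but not in \<open>F\<close>. So they lie on the frontier \<open>img C\<close>,
    whose only vertices are those of \<open>C\<close>.\<close>
  have uvC: "u \<in> \<Union>C \<and> v \<in> \<Union>C"
  proof -
    have "{p u, p v} \<subseteq> closure F" using L(3) closure_mono[OF F(2)] by auto
    moreover have "{p u, p v} \<inter> F = {}" using F'(4) PE by auto
    ultimately have sub: "{p u, p v} \<subseteq> img C"
      using C(3) F'(1) by (auto simp: frontier_def interior_open)
    have V: "u \<in> vertices G" "v \<in> vertices G" using ear(4,5) EG edge_vertices by blast+
    then have "{p u, p v} \<subseteq> p ` \<Union>C"
      using sub img_Int_vertices[of C] C(2) EG by auto
    moreover have "\<Union>C \<subseteq> vertices G" using C(2) EG edge_vertices by blast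
    ultimately show ?thesis using V inj_onD[OF inj_p] by (metis (no_types, lifting) image_iff insert_subset subset_iff)
  qed
  obtain as bs where s: "distinct (u # as @ v # bs)" "as \<noteq> [] \<or> bs \<noteq> []"
    "C = pedges (u # as @ [v]) \<union> pedges (v # bs @ [u])"
    using cycle_split[OF C(1) conjunct1[OF uvC] conjunct2[OF uvC] uv] by metis
  define C1 C2 where "C1 = pedges (u # as @ [v])" and "C2 = pedges (v # bs @ [u])"
  have CC: "C = C1 \<union> C2" using s by (simp add: C1_def C2_def)
  obtain c1 c2 where c12: "arc c1" "pathstart c1 = p u" "pathfinish c1 = p v"
    "arc c2" "pathstart c2 = p u" "pathfinish c2 = p v"
    "path_image c1 = img C1" "path_image c2 = img C2"
    "path_image c1 \<inter> path_image c2 = {p u, p v}" "C1 \<inter> C2 = {}"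
  proof -
    have "pedges (u # as @ [v]) \<union> pedges (v # bs @ [u]) \<subseteq> edges G" using s(3) C(2) EG by auto
    from arcs_of_cycle[OF s(1,2) this, folded C1_def C2_def] show ?thesis using that by metis
  qed
  have "img C \<subseteq> img E" using C(2) by (auto simp: img_def)
  then have "F \<inter> (path_image c1 \<union> path_image c2) = {}"
    using F'(4) CC c12(7,8) by (auto simp: img_Un)
  moreover have "frontier F = path_image c1 \<union> path_image c2"
    using C(3) CC c12 by (simp add: img_Un)
  moreover have "path_image c - {p u, p v} \<subseteq> F" using F(2) c by (simp add: L_def)
  ultimately obtain F1 F2 where F12: "open F1" "connected F1" "F1 \<noteq> {}" "open F2" "connected F2" "F2 \<noteq> {}"
    "F1 \<inter> F2 = {}" "F1 \<union> F2 = F - img P"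
    "frontier F1 = img C1 \<union> img P" "frontier F2 = img C2 \<union> img P"
    using split_face_by_arc[OF c12(1-6) c(1-3) c12(9) F'(1-3)] c(4) c12(7,8) by metis
  define D1 D2 where "D1 = C1 \<union> P" and "D2 = C2 \<union> P"
  have rP: "P = pedges (v # rev is @ [u])"
    using pedges_rev[of "u # is @ [v]"] by (simp add: P_def)
  have UE: "set (u # as @ v # bs) \<subseteq> \<Union>E"
  proof -
    have "\<Union>C1 = set (u # as @ [v])" "\<Union>C2 = set (v # bs @ [u])"
      unfolding C1_def C2_def by (rule Union_pedges, simp)+
    moreover have "\<Union>C1 \<subseteq> \<Union>E" "\<Union>C2 \<subseteq> \<Union>E" using CC C(2) by (auto intro!: Union_mono)
    ultimately show ?thesis by auto
  qed
  have D1: "is_cycle D1"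
    unfolding D1_def rP C1_def
  proof (rule is_cycle_join)
    show "distinct (u # as @ v # rev is)" using s(1) ear UE by auto
    show "as \<noteq> [] \<or> rev is \<noteq> []"
    proof (rule ccontr)
      assume "\<not> ?thesis"
      then have "{u, v} \<in> C1" "{u, v} \<in> P" by (auto simp: C1_def P_def)
      then show False using CC C(2) ear(3) by auto
    qed
  qed
  have rC2: "C2 = pedges (u # rev bs @ [v])"
    using pedges_rev[of "v # bs @ [u]"] by (simp add: C2_def)
  have D2: "is_cycle D2"
    unfolding D2_def rP rC2
  proof (rule is_cycle_join)
    show "distinct (u # rev bs @ v # rev is)" using s(1) ear UE by auto
    show "rev bs \<noteq> [] \<or> rev is \<noteq> []"
    proof (rule ccontr)
      assume "\<not> ?thesis"
      then have "{u, v} \<in> C2" "{u, v} \<in> P" by (auto simp: C2_def P_def insert_commute)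
      then show False using CC C(2) ear(3) by auto
    qed
  qed
  have Pne: "P \<noteq> {}" using UP by auto
  have notE: "\<not> D1 \<subseteq> E" "\<not> D2 \<subseteq> E" using Pne ear(3) by (auto simp: D1_def D2_def)
  define a b where "a = (F1, D1)" and "b = (F2, D2)"
  define FF' where "FF' = (FF - {(F, C)}) \<union> {a, b}"
  have ab: "a \<noteq> b" "a \<notin> FF" "b \<notin> FF"
    using F12(3,6,7) notE faces[of F1 D1] faces[of F2 D2] by (auto simp: a_def b_def)
  have comps': "components (- img (E \<union> P)) = (components (- img E) - {F}) \<union> {F1, F2}"
  proof (rule components_open_unique)
    have sub: "F1 \<subseteq> F" "F2 \<subseteq> F" using F12(8) by auto
    have dj: "X \<inter> Y = {}" if "X \<in> components (- img E)" "Y \<in> components (- img E)" "X \<noteq> Y" for X Y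
      using that components_nonoverlap by blast
    show "pairwise disjnt ((components (- img E) - {F}) \<union> {F1, F2})"
      unfolding pairwise_def disjnt_def
    proof (intro ballI impI)
      fix X Y assume XY: "X \<in> (components (- img E) - {F}) \<union> {F1, F2}"
        "Y \<in> (components (- img E) - {F}) \<union> {F1, F2}" "X \<noteq> Y"
      have o: "Z \<inter> F = {}" if "Z \<in> components (- img E) - {F}" for Z
        using dj that F(1) by auto
      show "X \<inter> Y = {}" using XY dj[of X Y] o[of X] o[of Y] sub F12(7) by blast
    qed
    let ?U = "\<Union>(components (- img E) - {F})"
    have "F \<union> ?U = \<Union>(components (- img E))" using F(1) by blast
    then have FU: "F \<union> ?U = - img E" using Union_components[of "- img E"] by metis
    have "img P \<inter> X = {}" if "X \<in> components (- img E) - {F}" for X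
    proof -
      have "X \<inter> F = {}" "X \<subseteq> - img E" using dj that F(1) in_components_subset[of X] by blast+
      moreover have "img P \<subseteq> F \<union> img E" using F(2) PE by (auto simp: L_def)
      ultimately show ?thesis by auto
    qed
    then have "?U \<inter> img P = {}" by auto
    then have "(F - img P) \<union> ?U = - img (E \<union> P)" using FU by (auto simp: img_Un)
    then show "\<Union>((components (- img E) - {F}) \<union> {F1, F2}) = - img (E \<union> P)"
      using F12(8) by auto
    show "\<And>X. X \<in> components (- img E) - {F} \<union> {F1, F2} \<Longrightarrow> open X \<and> connected X \<and> X \<noteq> {}"
      using F12 open_components[OF open_compl] in_components_connected in_components_nonempty by blast
  qed
  have "good (E \<union> P) FF'"
    unfolding good_def
  proof (intro conjI)
    show "E \<union> P \<subseteq> edges G" using EG ear by auto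
    show "finite FF'" using finFF by (simp add: FF'_def)
    have fst_rest: "fst ` (FF - {(F, C)}) = components (- img E) - {F}"
      using inj_on_image_set_diff[OF injFF, of FF "{(F, C)}"] FC comps by auto
    then show "fst ` FF' = components (- img (E \<union> P))"
      unfolding comps' by (auto simp: FF'_def a_def b_def)
    have F12': "F1 \<notin> components (- img E)" "F2 \<notin> components (- img E)"
    proof -
      have "X \<notin> components (- img E)" if "X \<noteq> {}" "X \<subseteq> F - img P" for X
      proof
        assume "X \<in> components (- img E)"
        then have "X = F" using components_nonoverlap[of X "- img E" F] that F(1) by auto
        then show False using that(2) L F(2) by (auto simp: L_def)
      qed
      then show "F1 \<notin> components (- img E)" "F2 \<notin> components (- img E)"
        using F12 by blast+
    qed
    have "inj_on fst (FF - {(F, C)})" using injFF inj_on_subset by blast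
    moreover have "F1 \<noteq> F2" using F12 by auto
    moreover have "F1 \<notin> fst ` (FF - {(F, C)})" "F2 \<notin> fst ` (FF - {(F, C)})"
      using F12' fst_rest by auto
    moreover have "FF' = insert a (insert b (FF - {(F, C)}))" by (auto simp: FF'_def)
    ultimately show "inj_on fst FF'"
      by (simp only: inj_on_insert) (auto simp: a_def b_def)
    show "\<forall>(X, D)\<in>FF'. is_cycle D \<and> D \<subseteq> E \<union> P \<and> frontier X = img D"
    proof (safe, goal_cases)
      case (1 X D)
      then show ?case using faces[of X D] D1 D2 by (auto simp: FF'_def a_def b_def)
    next
      case (2 X D e)
      then show ?case using faces[of X D] CC C(2) by (auto simp: FF'_def a_def b_def D1_def D2_def)
    next
      case (3 X D z)
      then show ?case using faces[of X D] F12(9,10) by (auto simp: FF'_def a_def b_def D1_def D2_def img_Un)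
    next
      case (4 X D z)
      then show ?case using faces[of X D] F12(9,10) by (auto simp: FF'_def a_def b_def D1_def D2_def img_Un)
    qed
    have mem: "x \<in> FF' \<longleftrightarrow> x \<in> FF \<and> x \<noteq> (F, C) \<or> x = a \<or> x = b" for x
      unfolding FF'_def by blast
    have sub: "snd f \<subseteq> E" if "f \<in> FF" for f
      using faces[of "fst f" "snd f"] that by simp
    have sab: "snd a = C1 \<union> P" "snd b = C2 \<union> P" by (simp_all add: a_def b_def D1_def D2_def)
    show "\<forall>e\<in>E \<union> P. card {f \<in> FF'. e \<in> snd f} = 2"
    proof
      fix e assume e: "e \<in> E \<union> P"
      show "card {f \<in> FF'. e \<in> snd f} = 2"
      proof (cases "e \<in> P")
        case True
        then have "e \<notin> E" using ear by auto
        then have "f \<in> FF' \<and> e \<in> snd f \<longleftrightarrow> f = a \<or> f = b" for f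
          using True sub[of f] sab mem[of f] by blast
        then have "{f \<in> FF'. e \<in> snd f} = {a, b}" by auto
        then show ?thesis using ab by simp
      next
        case False
        then have eE: "e \<in> E" using e by auto
        let ?old = "{f \<in> FF. e \<in> snd f}"
        show ?thesis
        proof (cases "e \<in> C")
          case False
          then have "f \<in> FF' \<and> e \<in> snd f \<longleftrightarrow> f \<in> FF \<and> e \<in> snd f" for f
            using \<open>e \<notin> P\<close> CC sab mem[of f] by auto
          then show ?thesis using two[OF eE] by simp
        next
          case True
          have FCo: "(F, C) \<in> ?old" using True FC by simp
          \<comment> \<open>An edge of \<open>C\<close> loses the face \<open>F\<close> and regains
            exactly one of the two new faces.\<close>
          have rm: "card (insert x (?old - {(F, C)})) = 2" if "x \<notin> FF" for x
          proof -
            have "card (?old - {(F, C)}) = 1" using two[OF eE] FCo by simp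
            moreover have "x \<notin> ?old - {(F, C)}" "finite (?old - {(F, C)})" using that finFF by auto
            ultimately show ?thesis by simp
          qed
          let ?x = "if e \<in> C1 then a else b"
          have "f \<in> FF' \<and> e \<in> snd f \<longleftrightarrow> f \<in> insert ?x (?old - {(F, C)})" for f
            using True \<open>e \<notin> P\<close> CC c12(10) sab mem[of f] ab by (cases "f = a"; cases "f = b") auto
          then have "{f \<in> FF'. e \<in> snd f} = insert ?x (?old - {(F, C)})" by blast
          then show ?thesis using rm[of ?x] ab by simp
        qed
      qed
    qed
    have "card FF' = card FF + 1"
      using ab finFF FC card_gt_0_iff[of FF] by (auto simp: FF'_def card_Diff_singleton)
    moreover have "card (\<Union>(E \<union> P)) = card (\<Union>E) + length is"
    proof -
      have "\<Union>(E \<union> P) = \<Union>E \<union> set is" using UP ear by auto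
      moreover have "finite (\<Union>E)"
        using EG edge_vertices simple by (auto simp: simple_graph_def intro!: finite_subset[of "\<Union>E" "vertices G"])
      ultimately show ?thesis
        using ear distinct_card[of "is"] by (subst card_Un_disjoint[symmetric] | simp add: card_Un_disjoint Int_commute)+
    qed
    moreover have "card (E \<union> P) = card E + length is + 1"
      using card_pedges[OF ear(1)] ear(3) finite_subset[OF EG finE]
      by (simp add: card_Un_disjoint Int_commute P_def)
    \<comment> \<open>The ear brings one more edge than it has inner vertices, and one more
      face.\<close>
    ultimately show "card FF' + card (\<Union>(E \<union> P)) = card (E \<union> P) + 2" using euler by simp
    show "\<forall>S. S \<subset> FF' \<and> S \<noteq> {} \<longrightarrow> (\<exists>f\<in>S. \<exists>g\<in>FF' - S. snd f \<inter> snd g \<noteq> {})"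
    proof (intro allI impI)
      fix S assume S: "S \<subset> FF' \<and> S \<noteq> {}"
      have abP: "snd a \<inter> snd b \<noteq> {}" using Pne by (auto simp: a_def b_def D1_def D2_def)
      have abF: "a \<in> FF'" "b \<in> FF'" by (auto simp: FF'_def)
      show "\<exists>f\<in>S. \<exists>g\<in>FF' - S. snd f \<inter> snd g \<noteq> {}"
      proof (cases "a \<in> S \<longleftrightarrow> b \<in> S")
        case False
        then show ?thesis using abP abF by (metis Diff_iff Int_commute)
      next
        case True
        \<comment> \<open>\<open>S0\<close> is \<open>S\<close> pulled back to the old faces: as
          both new faces are on the same side, they are merged into \<open>(F, C)\<close>, and the
          old dual graph provides a crossing edge.\<close>
        define S0 where "S0 = (S - {a, b}) \<union> (if a \<in> S then {(F, C)} else {})"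
        have nFC: "(F, C) \<notin> FF'" using FC ab by (auto simp: FF'_def)
        have "S0 \<subseteq> FF" using S FC by (auto simp: S0_def FF'_def)
        moreover have "S0 \<noteq> FF"
        proof
          assume eq: "S0 = FF"
          then have "a \<in> S" using FC S nFC by (auto simp: S0_def split: if_splits)
          moreover have "FF - {(F, C)} \<subseteq> S" using eq by (auto simp: S0_def split: if_splits)
          ultimately have "FF' \<subseteq> S" using True by (auto simp: FF'_def)
          then show False using S by auto
        qed
        moreover have "S0 \<noteq> {}" using S True by (auto simp: S0_def)
        ultimately obtain f g e where fg: "f \<in> S0" "g \<in> FF - S0" "e \<in> snd f" "e \<in> snd g"
          using dual[of S0] by blast
        have lift: "\<exists>f'\<in>FF'. e \<in> snd f' \<and> (f' = f \<or> f = (F, C) \<and> f' \<in> {a, b})"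
          if "f \<in> FF" "e \<in> snd f" for f
          using that CC unfolding FF'_def by (cases "f = (F, C)") (auto simp: a_def b_def D1_def D2_def)
        obtain f' where f': "f' \<in> FF'" "e \<in> snd f'" "f' = f \<or> f = (F, C) \<and> f' \<in> {a, b}"
          using lift fg \<open>S0 \<subseteq> FF\<close> by blast
        obtain g' where g': "g' \<in> FF'" "e \<in> snd g'" "g' = g \<or> g = (F, C) \<and> g' \<in> {a, b}"
          using lift fg by blast
        have "f' \<in> S" using f' fg(1) True S nFC by (auto simp: S0_def split: if_splits)
        moreover have "g' \<notin> S" using g' fg(2) True ab by (auto simp: S0_def split: if_splits)
        ultimately show ?thesis using f' g' by blast
      qed
    qed
  qed
  then show ?thesis unfolding P_def by blast
qed

end

section \<open>Separability and the existence of ears\<close>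

text \<open>Covers disconnectedness and cut vertices alike. Each part has at least two vertices and
  fewer than the whole, so that an induction on the number of vertices, started at two, applies to
  both.\<close>

definition separable :: "'a ugraph \<Rightarrow> bool" where
  "separable G \<longleftrightarrow> (\<exists>V1 V2. vertices G = V1 \<union> V2 \<and> card (V1 \<inter> V2) \<le> 1 \<and>
     2 \<le> card V1 \<and> 2 \<le> card V2 \<and> V1 \<noteq> vertices G \<and> V2 \<noteq> vertices G \<and>
     (\<forall>e\<in>edges G. e \<subseteq> V1 \<or> e \<subseteq> V2))"

lemma rtrancl_distinct_path:
  assumes "(a, b) \<in> R\<^sup>*"
  shows "\<exists>xs. distinct xs \<and> xs \<noteq> [] \<and> hd xs = a \<and> last xs = b \<and> set xs \<subseteq> R\<^sup>* `` {a} \<and>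
    pedges xs \<subseteq> {{c, d} |c d. (c, d) \<in> R}"
  using assms
proof (induction rule: rtrancl_induct)
  case base
  show ?case by (intro exI[of _ "[a]"]) auto
next
  case (step b c)
  then obtain xs where xs: "distinct xs" "xs \<noteq> []" "hd xs = a" "last xs = b" "set xs \<subseteq> R\<^sup>* `` {a}"
    "pedges xs \<subseteq> {{c, d} |c d. (c, d) \<in> R}" by blast
  have c: "c \<in> R\<^sup>* `` {a}" using step by auto
  show ?case
  proof (cases "c \<in> set xs")
    case True
    then obtain l r where lr: "xs = l @ c # r" by (meson split_list)
    have "hd (l @ [c]) = a" using xs(3) lr by (cases l) auto
    moreover have "pedges (l @ [c]) \<subseteq> pedges xs" using pedges_append[of l c r] lr by auto
    ultimately show ?thesis using xs lr c by (intro exI[of _ "l @ [c]"]) auto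
  next
    case False
    have "xs = butlast xs @ [b]" using xs by (metis append_butlast_last_id)
    then have "pedges (xs @ [c]) = insert {b, c} (pedges xs)"
      using pedges_snoc2[of "butlast xs" b c] by (metis append_Cons append_Nil append_assoc)
    then show ?thesis using xs False c step(2) by (intro exI[of _ "xs @ [c]"]) auto
  qed
qed

lemma endpoints_not_edge:
  assumes "distinct (u # is @ [v])" "is \<noteq> []"
  shows "{u, v} \<notin> pedges (u # is @ [v])"
proof
  assume e: "{u, v} \<in> pedges (u # is @ [v])"
  obtain z zs where "is = z # zs" using assms(2) by (cases "is") auto
  then show False using e assms(1) Union_pedges_subset[of "z # zs @ [v]"]
    by (auto simp: doubleton_eq_iff)
qed

text \<open>Take a component \<open>D\<close> of what is left after the removal of \<open>W\<close>.
  If it is attached to two vertices of \<open>W\<close>, a path through \<open>D\<close> joins them.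
  Otherwise \<open>D\<close> with its only attachment vertex splits off.\<close>

lemma ear_exists:
  assumes G: "simple_graph G" "\<not> separable G"
    and W: "W \<subseteq> vertices G" "2 \<le> card W" "W \<noteq> vertices G"
  obtains u "is" v where "u \<in> W" "v \<in> W" "distinct (u # is @ [v])" "is \<noteq> []" "set is \<inter> W = {}"
    "pedges (u # is @ [v]) \<subseteq> edges G"
proof -
  have fin: "finite (vertices G)" using G by (simp add: simple_graph_def)
  obtain x where x: "x \<in> vertices G" "x \<notin> W" using W by auto
  define R where "R = {(a, b). {a, b} \<in> edges G \<and> a \<notin> W \<and> b \<notin> W}"
  define D where "D = R\<^sup>* `` {x}"
  have sub: "{a, b} \<in> edges G \<Longrightarrow> a \<in> vertices G \<and> b \<in> vertices G" for a b
    using G by (auto simp: simple_graph_def)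
  have D: "D \<subseteq> vertices G - W"
  proof
    fix y assume "y \<in> D"
    then have "(x, y) \<in> R\<^sup>*" by (simp add: D_def)
    then show "y \<in> vertices G - W"
      by (induction rule: rtrancl_induct) (use x sub in \<open>auto simp: R_def\<close>)
  qed
  have xD: "x \<in> D" by (simp add: D_def)
  have step: "b \<in> D" if "a \<in> D" "{a, b} \<in> edges G" "b \<notin> W" for a b
  proof -
    have "(a, b) \<in> R" using that D by (auto simp: R_def)
    then show ?thesis using that(1) by (auto simp: D_def intro: rtrancl_into_rtrancl)
  qed
  define N where "N = {w \<in> W. \<exists>d\<in>D. {w, d} \<in> edges G}"
  have "\<exists>w w'. w \<in> N \<and> w' \<in> N \<and> w \<noteq> w'"
  proof (rule ccontr)
    assume neg: "\<not> ?thesis"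
    \<comment> \<open>If nothing is attached, any vertex of \<open>W\<close> can serve as the common
      vertex of the two parts.\<close>
    obtain w0 where w0: "w0 \<in> W" "N \<subseteq> {w0}"
    proof (cases "N = {}")
      case True
      have "W \<noteq> {}" using W(2) by auto
      then show ?thesis using that True by blast
    next
      case False
      then obtain w where w: "w \<in> N" by auto
      then show ?thesis using that[of w] neg by (auto simp: N_def)
    qed
    let ?V1 = "insert w0 D" and ?V2 = "vertices G - D"
    have finD: "finite D" using D fin finite_subset by blast
    have "separable G"
      unfolding separable_def
    proof (intro exI conjI)
      show "vertices G = ?V1 \<union> ?V2" using D w0 W by auto
      have "?V1 \<inter> ?V2 = {w0}" using D w0 W by auto
      then show "card (?V1 \<inter> ?V2) \<le> 1" by simp
      have "card {w0, x} \<le> card ?V1" using finD xD by (intro card_mono) auto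
      moreover have "w0 \<noteq> x" using x w0 by auto
      ultimately show "2 \<le> card ?V1" by simp
      have "card W \<le> card ?V2" using fin D W by (intro card_mono) auto
      then show "2 \<le> card ?V2" using W by simp
      have "\<not> W \<subseteq> {w0}" using W(2) by (metis card_mono finite.emptyI finite_insert card.empty card_insert_if empty_iff not_less_eq_eq numeral_2_eq_2)
      then show "?V1 \<noteq> vertices G" using D W(1) by auto
      show "?V2 \<noteq> vertices G" using xD x by auto
      show "\<forall>e\<in>edges G. e \<subseteq> ?V1 \<or> e \<subseteq> ?V2"
      proof
        fix e assume e: "e \<in> edges G"
        then obtain a b where ab: "e = {a, b}" "a \<noteq> b" "{a, b} \<subseteq> vertices G"
          using G by (metis simple_graph_def card_2_iff)
        have key: "d \<in> ?V1" if "c \<in> D" "{c, d} \<in> edges G" for c d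
        proof (cases "d \<in> W")
          case True
          then have "d \<in> N" using that by (auto simp: N_def insert_commute)
          then show ?thesis using w0 by auto
        next
          case False
          then show ?thesis using step that by auto
        qed
        show "e \<subseteq> ?V1 \<or> e \<subseteq> ?V2"
          using key[of a b] key[of b a] e ab by (auto simp: insert_commute)
      qed
    qed
    then show False using G by simp
  qed
  then obtain w w' d d' where w: "w \<in> W" "w' \<in> W" "w \<noteq> w'" "d \<in> D" "d' \<in> D" "{w, d} \<in> edges G" "{w', d'} \<in> edges G"
    by (auto simp: N_def)
  have "sym R" by (auto simp: sym_def R_def insert_commute)
  then have "sym (R\<^sup>*)" by (rule sym_rtrancl)
  moreover have "(x, d) \<in> R\<^sup>*" "(x, d') \<in> R\<^sup>*" using w by (auto simp: D_def)
  ultimately have "(d, d') \<in> R\<^sup>*" by (meson symD rtrancl_trans)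
  from rtrancl_distinct_path[OF this] obtain xs where xs: "distinct xs" "xs \<noteq> []" "hd xs = d" "last xs = d'"
    "set xs \<subseteq> R\<^sup>* `` {d}" "pedges xs \<subseteq> {{c, d} |c d. (c, d) \<in> R}" by blast
  have "set xs \<subseteq> D" using xs(5) w(4) by (auto simp: D_def)
  then have xsW: "set xs \<inter> W = {}" using D by auto
  obtain ys where ys: "xs = d # ys" using xs by (cases xs) auto
  obtain zs where zs: "xs = zs @ [d']" using xs by (metis append_butlast_last_id)
  have "pedges (w # xs @ [w']) = insert {w, d} (pedges (xs @ [w']))" using ys by simp
  also have "pedges (xs @ [w']) = insert {d', w'} (pedges xs)" using zs pedges_snoc2[of zs d' w'] by simp
  finally have "pedges (w # xs @ [w']) \<subseteq> edges G"
    using w xs(6) by (auto simp: R_def insert_commute)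
  moreover have "distinct (w # xs @ [w'])" using xs(1) xsW w by auto
  ultimately show ?thesis using that[of w w' xs] w xs(2) xsW by blast
qed

text \<open>An isolated \<open>v\<close> together with any other vertex would be a part that meets
  the rest only in that vertex.\<close>

lemma nonseparable_no_isolated:
  assumes G: "simple_graph G" "\<not> separable G" "3 \<le> card (vertices G)" and v: "v \<in> vertices G"
  shows "v \<in> \<Union>(edges G)"
proof (rule ccontr)
  assume neg: "\<not> ?thesis"
  have fin: "finite (vertices G)" using G by (simp add: simple_graph_def)
  have c: "card (vertices G - {v}) \<ge> 2" using G(3) v fin by simp
  then obtain w where w: "w \<in> vertices G" "w \<noteq> v"
    by (metis Diff_iff all_not_in_conv card.empty not_numeral_le_zero singletonI)
  have "separable G"
    unfolding separable_def
  proof (intro exI conjI)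
    let ?V1 = "{v, w}" and ?V2 = "vertices G - {v}"
    show "vertices G = ?V1 \<union> ?V2" using v w by auto
    have "?V1 \<inter> ?V2 = {w}" using w by auto
    then show "card (?V1 \<inter> ?V2) \<le> 1" by simp
    show "2 \<le> card ?V1" using w by simp
    show "2 \<le> card ?V2" using c .
    show "?V1 \<noteq> vertices G"
    proof
      assume "?V1 = vertices G"
      moreover have "card ?V1 \<le> 2" using w by simp
      ultimately show False using G(3) by simp
    qed
    show "?V2 \<noteq> vertices G" using v by auto
    show "\<forall>e\<in>edges G. e \<subseteq> ?V1 \<or> e \<subseteq> ?V2"
      using neg G by (auto simp: simple_graph_def)
  qed
  then show False using G by simp
qed

context drawn_graph
begin

text \<open>An edge closed by an ear is a cycle, so good sets exist; take a maximal one. If it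
  covers all vertices, a missing edge is an ear without inner vertices; if not,
  \<open>ear_exists\<close> yields an ear. Either contradicts maximality.\<close>

lemma good_all_edges:
  assumes ns: "\<not> separable G" and c: "3 \<le> card (vertices G)"
  obtains FF where "good (edges G) FF" "\<Union>(edges G) = vertices G"
proof -
  have UE: "\<Union>(edges G) = vertices G"
    using nonseparable_no_isolated[OF simple ns c] edge_vertices by blast
  have fin: "finite (vertices G)" using simple by (simp add: simple_graph_def)
  have "vertices G \<noteq> {}" using c by auto
  then obtain e where e: "e \<in> edges G" using UE by auto
  have e2: "card e = 2" "e \<subseteq> vertices G" using e simple by (auto simp: simple_graph_def)
  have "e \<noteq> vertices G" using e2 c by auto
  have "2 \<le> card e" using e2 by simp
  from ear_exists[OF simple ns e2(2) this \<open>e \<noteq> vertices G\<close>] obtain u "is" v where ear: "u \<in> e" "v \<in> e"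
    "distinct (u # is @ [v])" "is \<noteq> []" "pedges (u # is @ [v]) \<subseteq> edges G" .
  have "u \<noteq> v" using ear by auto
  then have "e = {v, u}" using e2(1) ear by (auto simp: card_2_iff)
  then have C: "pedges (u # is @ [v]) \<union> pedges (v # [] @ [u]) \<subseteq> edges G" using e ear by auto
  have "is_cycle (pedges (u # is @ [v]) \<union> pedges (v # [] @ [u]))"
    using ear by (intro is_cycle_join) auto
  from good_cycle[OF this C] obtain E0 where E0: "E0 \<in> {E. \<exists>FF. good E FF}" by blast
  have finS: "finite {E. \<exists>FF. good E FF}"
    by (rule finite_subset[of _ "Pow (edges G)"]) (auto simp: good_def finE)
  obtain E where E: "E \<in> {E. \<exists>FF. good E FF}" "\<And>E'. E' \<in> {E. \<exists>FF. good E FF} \<Longrightarrow> E \<subseteq> E' \<Longrightarrow> E' = E"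
    using finite_has_maximal[OF finS] E0 by (metis empty_iff)
  then obtain FF where FF: "good E FF" by auto
  have EG: "E \<subseteq> edges G" using FF by (simp add: good_def)
  have "E = edges G"
  proof (rule ccontr)
    assume ne: "E \<noteq> edges G"
    have no_ear: False if "distinct (u # is @ [v])" "pedges (u # is @ [v]) \<subseteq> edges G"
      "pedges (u # is @ [v]) \<inter> E = {}" "u \<in> \<Union>E" "v \<in> \<Union>E" "set is \<inter> \<Union>E = {}" for u "is" v
    proof -
      have "\<exists>FF'. good (E \<union> pedges (u # is @ [v])) FF'" using good_ear[OF FF that] .
      then have "E \<union> pedges (u # is @ [v]) = E" using E(2)[of "E \<union> pedges (u # is @ [v])"] by blast
      then have "pedges (u # is @ [v]) = {}" using that(3) by blast
      then show False using Union_pedges[of "u # is @ [v]"] by simp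
    qed
    show False
    proof (cases "\<Union>E = vertices G")
      case True
      obtain f where f: "f \<in> edges G" "f \<notin> E" using ne EG by auto
      then obtain u v where uv: "f = {u, v}" "u \<noteq> v" using simple by (metis simple_graph_def card_2_iff)
      then have "u \<in> vertices G" "v \<in> vertices G" using f edge_vertices by auto
      then show False using no_ear[of u "[]" v] uv f True by auto
    next
      case False
      have sub: "\<Union>E \<subseteq> vertices G" using EG edge_vertices by blast
      \<comment> \<open>The empty set is not good: the complement of the empty drawing has a
        component, whose boundary would have to be a cycle without edges.\<close>
      have "E \<noteq> {}"
      proof
        assume "E = {}"
        then have "E \<subseteq> E0" by simp
        then have "E0 = {}" using E(2)[OF E0] \<open>E = {}\<close> by simp
        with E0 obtain FF0 where g0: "good {} FF0" by auto
        then have "fst ` FF0 = components (- img {})" by (simp add: good_def)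
        moreover have "- img {} \<noteq> {}" by (simp add: img_def)
        then have "components (- img {}) \<noteq> {}" by (simp only: components_eq_empty simp_thms)
        ultimately have "FF0 \<noteq> {}" by (metis image_empty)
        then obtain F C where "(F, C) \<in> FF0" by auto
        moreover have "\<forall>(F, C)\<in>FF0. is_cycle C \<and> C \<subseteq> {} \<and> frontier F = img C"
          using g0 unfolding good_def by (elim conjE)
        ultimately have "is_cycle C" "C = {}" by (metis (no_types, lifting) case_prodD subset_empty)+
        then show False using cycle_card_Union[of C] by simp
      qed
      then obtain f where f: "f \<in> E" by auto
      have "card f = 2" using f EG simple by (auto simp: simple_graph_def)
      moreover have "card f \<le> card (\<Union>E)"
        using f finite_subset[OF sub fin] by (intro card_mono) auto
      ultimately have "2 \<le> card (\<Union>E)" by simp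
      from ear_exists[OF simple ns sub this False] obtain u "is" v where uv: "u \<in> \<Union>E" "v \<in> \<Union>E"
        "distinct (u # is @ [v])" "is \<noteq> []" "set is \<inter> \<Union>E = {}" "pedges (u # is @ [v]) \<subseteq> edges G" .
      have "pedges (u # is @ [v]) \<inter> E = {}"
      proof (rule ccontr)
        assume "\<not> ?thesis"
        then obtain g where g: "g \<in> pedges (u # is @ [v])" "g \<in> E" by auto
        have "g \<subseteq> set (u # is @ [v])" using g(1) Union_pedges_subset[of "u # is @ [v]"] by blast
        moreover have "g \<subseteq> \<Union>E" using g(2) by blast
        ultimately have "g \<subseteq> {u, v}" using uv(5) by auto
        moreover have "card g = 2" using g EG simple by (auto simp: simple_graph_def)
        ultimately have "g = {u, v}"
          by (intro card_subset_eq) (use uv(3) in auto)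
        then show False using g endpoints_not_edge[OF uv(3,4)] by simp
      qed
      then show False using no_ear uv by metis
    qed
  qed
  then show ?thesis using that FF UE by simp
qed

end

section \<open>Face systems: the combinatorial content of a drawing\<close>

text \<open>All that discharging knows of planarity, apart from the exclusion of
  \<open>K\<^sub>5\<close>. The regions themselves are forgotten, so the type of faces is left
  open.\<close>

definition face_system :: "'a ugraph \<Rightarrow> 'f set \<Rightarrow> ('f \<Rightarrow> 'a set set) \<Rightarrow> bool" where
  "face_system G FF bd \<longleftrightarrow> finite FF \<and> (\<forall>f\<in>FF. is_cycle (bd f) \<and> bd f \<subseteq> edges G) \<and>
    (\<forall>e\<in>edges G. card {f\<in>FF. e \<in> bd f} = 2) \<and> card FF + card (vertices G) = card (edges G) + 2 \<and>
    (\<forall>S. S \<subset> FF \<and> S \<noteq> {} \<longrightarrow> (\<exists>f\<in>S. \<exists>g\<in>FF - S. bd f \<inter> bd g \<noteq> {}))"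

lemma planar_face_system:
  assumes "simple_graph G" "planar G" "\<not> separable G" "3 \<le> card (vertices G)"
  obtains FF :: "(complex set \<times> 'a set set) set" where "face_system (G :: 'a ugraph) FF snd"
    "\<Union>(edges G) = vertices G"
proof -
  obtain p \<gamma> where "plane_drawing G p \<gamma>" using assms by (auto simp: planar_def)
  then interpret drawn_graph G p \<gamma> using assms by unfold_locales
  obtain FF where "good (edges G) FF" "\<Union>(edges G) = vertices G"
    using good_all_edges assms by blast
  moreover from this have "face_system G FF snd"
    unfolding good_def face_system_def by (auto simp: split_def)
  ultimately show ?thesis using that by blast
qed

text \<open>Of the two segments between \<open>a\<close> and \<open>b\<close> one must be the edge
  itself, because a segment with inner vertices does not contain it.\<close>

lemma cycle_at_edge:
  assumes "is_cycle C" "{a, b} \<in> C" "a \<noteq> b"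
  obtains xs where "distinct (a # b # xs)" "C = pedges (a # b # xs @ [a])" "card C = length xs + 2" "xs \<noteq> []"
proof -
  have "a \<in> \<Union>C" "b \<in> \<Union>C" using assms(2) by blast+
  from cycle_split[OF assms(1) this assms(3)] obtain as bs where s: "distinct (a # as @ b # bs)"
    "as \<noteq> [] \<or> bs \<noteq> []" "C = pedges (a # as @ [b]) \<union> pedges (b # bs @ [a])" .
  have "as = [] \<or> bs = []"
  proof (rule ccontr)
    assume ne: "\<not> ?thesis"
    have "{a, b} \<notin> pedges (a # as @ [b])" using s ne by (intro endpoints_not_edge) auto
    moreover have "{b, a} \<notin> pedges (b # bs @ [a])" using s ne by (intro endpoints_not_edge) auto
    ultimately show False using assms(2) s(3) by (auto simp: insert_commute)
  qed
  then have "\<exists>xs. distinct (a # b # xs) \<and> xs \<noteq> [] \<and> C = pedges (a # b # xs @ [a])"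
  proof
    assume "as = []"
    then show ?thesis using s by (intro exI[of _ bs]) auto
  next
    assume b: "bs = []"
    have "pedges (a # as @ [b]) = pedges (b # rev as @ [a])"
      using pedges_rev[of "a # as @ [b]"] by simp
    then show ?thesis using s b by (intro exI[of _ "rev as"]) (auto simp: insert_commute)
  qed
  then obtain xs where xs: "distinct (a # b # xs)" "xs \<noteq> []" "C = pedges (a # b # xs @ [a])" by blast
  have "card C = Suc (length (b # xs))"
    using card_cycle[of a "b # xs"] xs by (cases xs) auto
  then show ?thesis using that xs by auto
qed

section \<open>Discharging\<close>

text \<open>\<open>theta\<close> reads \<open>\<Theta>\<^sub>6\<^sup>2\<close> as a 5-cycle
  \<open>a b c d e\<close> with a further vertex \<open>w\<close> joined to \<open>a\<close> and
  \<open>b\<close>: the 6-cycle is \<open>a w b c d e\<close> and \<open>{a, b}\<close> its chord.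
  \<open>noK5\<close> is a separate hypothesis; the induction on the number of vertices supplies it
  through the bound for five vertices.\<close>

locale theta_free_faces =
  fixes G :: "'a ugraph" and FF :: "'f set" and bd :: "'f \<Rightarrow> 'a set set"
  assumes simple: "simple_graph G" and fs: "face_system G FF bd"
    and UE: "\<Union>(edges G) = vertices G" and n6: "6 \<le> card (vertices G)"
    and theta: "\<And>a b c d e w. distinct [a, b, c, d, e, w] \<Longrightarrow> {a, b} \<in> edges G \<Longrightarrow> {b, c} \<in> edges G \<Longrightarrow>
      {c, d} \<in> edges G \<Longrightarrow> {d, e} \<in> edges G \<Longrightarrow> {e, a} \<in> edges G \<Longrightarrow> {w, a} \<in> edges G \<Longrightarrow>
      {w, b} \<in> edges G \<Longrightarrow> False"
    and noK5: "\<And>a b c d e. distinct [a, b, c, d, e] \<Longrightarrow> {a, b} \<in> edges G \<Longrightarrow> {a, c} \<in> edges G \<Longrightarrow>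
      {a, d} \<in> edges G \<Longrightarrow> {a, e} \<in> edges G \<Longrightarrow> {b, c} \<in> edges G \<Longrightarrow> {b, d} \<in> edges G \<Longrightarrow>
      {b, e} \<in> edges G \<Longrightarrow> {c, d} \<in> edges G \<Longrightarrow> {c, e} \<in> edges G \<Longrightarrow> {d, e} \<in> edges G \<Longrightarrow> False"
begin

abbreviation adj :: "'a \<Rightarrow> 'a \<Rightarrow> bool" where "adj x y \<equiv> {x, y} \<in> edges G"

lemma finFF: "finite FF" using fs by (simp add: face_system_def)

lemma cyc: "f \<in> FF \<Longrightarrow> is_cycle (bd f)" using fs by (simp add: face_system_def)

lemma bdE: "f \<in> FF \<Longrightarrow> e \<in> bd f \<Longrightarrow> e \<in> edges G" using fs by (auto simp: face_system_def)

lemma two_faces: "e \<in> edges G \<Longrightarrow> card {f\<in>FF. e \<in> bd f} = 2" using fs by (simp add: face_system_def)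

lemma adj_neq: "adj x y \<Longrightarrow> x \<noteq> y"
  using simple by (auto simp: simple_graph_def)

lemma at_most_two:
  assumes "f \<in> FF" "g \<in> FF" "h \<in> FF" "e \<in> bd f" "e \<in> bd g" "e \<in> bd h" "f \<noteq> g"
  shows "h = f \<or> h = g"
proof -
  have "{f, g} = {f\<in>FF. e \<in> bd f}"
    using two_faces[OF bdE[OF assms(1,4)]] assms finFF
    by (intro card_subset_eq) auto
  then show ?thesis using assms by auto
qed

lemma other_face:
  assumes "f \<in> FF" "e \<in> bd f"
  obtains g where "g \<in> FF" "g \<noteq> f" "e \<in> bd g"
proof -
  have c: "card {g\<in>FF. e \<in> bd g} = 2" using two_faces[OF bdE[OF assms]] .
  then obtain x y where "{g\<in>FF. e \<in> bd g} = {x, y}" "x \<noteq> y" by (auto simp: card_2_iff)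
  then have "x \<in> FF \<and> e \<in> bd x" "y \<in> FF \<and> e \<in> bd y" by auto
  then show ?thesis using that[of x] that[of y] \<open>x \<noteq> y\<close> by (cases "x = f") auto
qed

text \<open>The dual graph is connected, so a set of faces that contains both faces at each of its
  edges is the set of all faces. Then all vertices lie in \<open>S\<close>, although there are at
  least six. This disposes of every configuration that closes up on five vertices or fewer.\<close>

lemma small_closed:
  assumes K: "K \<subseteq> FF" "K \<noteq> {}" and cl: "\<And>f e. f \<in> K \<Longrightarrow> e \<in> bd f \<Longrightarrow> \<exists>g\<in>K. g \<noteq> f \<and> e \<in> bd g"
    and S: "\<And>f. f \<in> K \<Longrightarrow> \<Union>(bd f) \<subseteq> S" "finite S" "card S \<le> 5"
  shows False
proof -
  have "K = FF"
  proof (rule ccontr)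
    assume "K \<noteq> FF"
    then have "K \<subset> FF" using K by auto
    have "\<forall>S. S \<subset> FF \<and> S \<noteq> {} \<longrightarrow> (\<exists>f\<in>S. \<exists>g\<in>FF - S. bd f \<inter> bd g \<noteq> {})"
      using fs unfolding face_system_def by (elim conjE)
    with K(2) \<open>K \<subset> FF\<close> obtain f g where fg: "f \<in> K" "g \<in> FF - K" "bd f \<inter> bd g \<noteq> {}" by meson
    then obtain e where e: "e \<in> bd f" "e \<in> bd g" by auto
    obtain f' where f': "f' \<in> K" "f' \<noteq> f" "e \<in> bd f'" using cl[OF fg(1) e(1)] by auto
    have "g = f \<or> g = f'" using at_most_two[of f f' g e] fg e f' K(1) by auto
    then show False using fg f' by auto
  qed
  have "vertices G \<subseteq> S"
  proof
    fix v assume "v \<in> vertices G"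
    then obtain e where e: "e \<in> edges G" "v \<in> e" using UE by auto
    have "card {f\<in>FF. e \<in> bd f} \<noteq> 0" using two_faces[OF e(1)] by simp
    then obtain f where "f \<in> FF" "e \<in> bd f" by (metis (mono_tags, lifting) card.empty empty_Collect_eq)
    then show "v \<in> S" using S(1)[of f] \<open>K = FF\<close> e by auto
  qed
  then have "card (vertices G) \<le> card S" using S(2) by (intro card_mono)
  then show False using n6 S(3) by simp
qed

section \<open>Triangular and other short faces\<close>

definition T :: "'f \<Rightarrow> 'a \<Rightarrow> 'a \<Rightarrow> 'a \<Rightarrow> bool" where
  "T f a b c \<longleftrightarrow> f \<in> FF \<and> distinct [a, b, c] \<and> bd f = {{a, b}, {b, c}, {c, a}}"

lemma T_rot: "T f a b c \<Longrightarrow> T f b c a"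
  by (auto simp: T_def)

lemma T_swap: "T f a b c \<Longrightarrow> T f b a c"
  by (auto simp: T_def insert_commute)

lemma T_perms:
  assumes "T f a b c"
  shows "T f b c a" "T f c a b" "T f b a c" "T f a c b" "T f c b a"
  using assms T_rot T_swap by blast+

lemma T_FF: "T f a b c \<Longrightarrow> f \<in> FF" by (simp add: T_def)

lemma T_edges:
  assumes "T f a b c"
  shows "{a, b} \<in> bd f" "{b, c} \<in> bd f" "{a, c} \<in> bd f"
    "{b, a} \<in> bd f" "{c, b} \<in> bd f" "{c, a} \<in> bd f"
  using assms by (auto simp: T_def insert_commute)

lemma T_adj:
  assumes "T f a b c"
  shows "adj a b" "adj b c" "adj a c" "adj b a" "adj c b" "adj c a"
  using T_edges[OF assms] bdE T_FF[OF assms] by blast+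

lemma T_mem: "T f a b c \<Longrightarrow> {u, v} \<in> bd f \<longleftrightarrow>
  u = a \<and> v = b \<or> u = b \<and> v = a \<or> u = b \<and> v = c \<or> u = c \<and> v = b \<or> u = c \<and> v = a \<or> u = a \<and> v = c"
  by (auto simp: T_def doubleton_eq_iff)

definition Tri :: "'f set" where "Tri = {f\<in>FF. card (bd f) = 3}"

lemma T_Tri: "T f a b c \<Longrightarrow> f \<in> Tri"
  by (auto simp: T_def Tri_def card_insert_if doubleton_eq_iff)

lemma third_vertex:
  assumes "f \<in> Tri" "{a, b} \<in> bd f"
  obtains c where "T f a b c"
proof -
  have f: "f \<in> FF" "card (bd f) = 3" using assms by (auto simp: Tri_def)
  have "a \<noteq> b" using adj_neq bdE f assms by blast
  from cycle_at_edge[OF cyc[OF f(1)] assms(2) this] obtain xs where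
    xs: "distinct (a # b # xs)" "bd f = pedges (a # b # xs @ [a])" "card (bd f) = length xs + 2" .
  then obtain c where "xs = [c]" using f(2) by (auto simp: length_Suc_conv numeral_3_eq_3)
  then show ?thesis using that[of c] xs f by (auto simp: T_def)
qed

lemma Tri_T:
  assumes "f \<in> Tri"
  obtains a b c where "T f a b c"
proof -
  have f: "f \<in> FF" "card (bd f) = 3" using assms by (auto simp: Tri_def)
  then obtain e where e: "e \<in> bd f" by (metis card.empty equals0I zero_neq_numeral)
  then obtain a b where "e = {a, b}"
    using bdE[OF f(1)] simple by (metis card_2_iff simple_graph_def)
  then show ?thesis using third_vertex[OF assms] e that by blast
qed

lemma four_face:
  assumes "f \<in> FF" "card (bd f) = 4" "{a, b} \<in> bd f"
  obtains p q where "distinct [a, b, p, q]" "bd f = {{a, b}, {b, p}, {p, q}, {q, a}}"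
proof -
  have "a \<noteq> b" using adj_neq bdE assms by blast
  from cycle_at_edge[OF cyc[OF assms(1)] assms(3) this] obtain xs where
    xs: "distinct (a # b # xs)" "bd f = pedges (a # b # xs @ [a])" "card (bd f) = length xs + 2" .
  have "length xs = Suc (Suc 0)" using xs(3) assms(2) by simp
  then obtain p q where "xs = [p, q]" by (auto simp: length_Suc_conv)
  then show ?thesis using that[of p q] xs by auto
qed

lemma five_face:
  assumes "f \<in> FF" "card (bd f) = 5" "{a, b} \<in> bd f"
  obtains p q r where "distinct [a, b, p, q, r]" "bd f = {{a, b}, {b, p}, {p, q}, {q, r}, {r, a}}"
proof -
  have "a \<noteq> b" using adj_neq bdE assms by blast
  from cycle_at_edge[OF cyc[OF assms(1)] assms(3) this] obtain xs where
    xs: "distinct (a # b # xs)" "bd f = pedges (a # b # xs @ [a])" "card (bd f) = length xs + 2" .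
  have "length xs = Suc (Suc (Suc 0))" using xs(3) assms(2) by simp
  then obtain p q r where "xs = [p, q, r]" by (auto simp: length_Suc_conv)
  then show ?thesis using that[of p q r] xs by auto
qed

section \<open>Charges and clusters of triangles\<close>

definition tedge :: "'a set \<Rightarrow> bool" where "tedge e \<longleftrightarrow> (\<exists>f\<in>Tri. e \<in> bd f)"

text \<open>Only these edges bring a triangle a positive overdraft; on all others \<open>sc\<close>
  is at most -1/2.\<close>

definition rich :: "'a set \<Rightarrow> bool" where
  "rich e \<longleftrightarrow> (\<exists>f\<in>Tri. \<exists>g\<in>Tri. f \<noteq> g \<and> e \<in> bd f \<and> e \<in> bd g)"

definition tdeg :: "'f \<Rightarrow> nat" where "tdeg f = card {e\<in>bd f. tedge e}"

text \<open>What a face asks of an edge; over a face this adds up to at least 18. The overdraft of an edge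
  is booked as \<open>sc\<close> to its triangle, which leaves 5 of the 11 units to the other face; between two
  triangles the overdraft \<open>12 - 11\<close> is divided equally.\<close>

definition wt :: "'f \<Rightarrow> 'a set \<Rightarrow> real" where
  "wt f e = (let k = card (bd f) in if k = 3 then 6
     else if k = 4 then (if tdeg f = 2 then (if tedge e then 7 / 2 else 11 / 2) else 9 / 2)
     else if k = 5 then 18 / 5 else 3)"

definition sc :: "'f \<Rightarrow> 'a set \<Rightarrow> real" where
  "sc f e = (if rich e then 1 / 2 else (\<Sum>g\<in>{g\<in>FF - {f}. e \<in> bd g}. wt g e) - 5)"

definition Sc :: "'f \<Rightarrow> real" where "Sc f = (\<Sum>e\<in>bd f. sc f e)"

lemma others_single:
  assumes "f \<in> FF" "e \<in> bd f" "g \<in> FF" "e \<in> bd g" "g \<noteq> f"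
  shows "{g\<in>FF - {f}. e \<in> bd g} = {g}"
  using assms at_most_two[of f g _ e] by blast

lemma rich_other:
  assumes "rich e" "f \<in> Tri" "e \<in> bd f"
  obtains g where "g \<in> Tri" "g \<noteq> f" "e \<in> bd g"
  using assms unfolding rich_def by blast

lemma sc_nonrich:
  assumes "f \<in> Tri" "e \<in> bd f" "\<not> rich e" "g \<in> FF" "e \<in> bd g" "g \<noteq> f"
  shows "sc f e = wt g e - 5"
  using assms others_single[of f e g] by (simp add: sc_def Tri_def)

lemma wt_tedge_le: "tedge e \<Longrightarrow> card (bd g) \<noteq> 3 \<Longrightarrow> wt g e \<le> 9 / 2"
  by (auto simp: wt_def Let_def)

lemma nonrich_other:
  assumes "f \<in> Tri" "e \<in> bd f" "\<not> rich e" "g \<in> FF" "e \<in> bd g" "g \<noteq> f"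
  shows "card (bd g) \<noteq> 3"
  using assms by (auto simp: rich_def Tri_def)

text \<open>The worst neighbour is a 4-face asking 9/2 of the 5 units that are left.\<close>

lemma sc_le_half:
  assumes "f \<in> Tri" "e \<in> bd f" "\<not> rich e"
  shows "sc f e \<le> - 1 / 2"
proof -
  have "f \<in> FF" using assms by (simp add: Tri_def)
  then obtain g where g: "g \<in> FF" "g \<noteq> f" "e \<in> bd g" using other_face assms by blast
  have "tedge e" using assms by (auto simp: tedge_def)
  then show ?thesis
    using sc_nonrich[OF assms g(1,3,2)] wt_tedge_le[OF _ nonrich_other[OF assms g(1,3,2)]] by fastforce
qed

text \<open>Without 4-faces that ask 9/2, the other face asks 7/2, 18/5 or 3. The largest of these
  is 18/5, and 18/5 - 5 = -7/5.\<close>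

lemma sc_le_75:
  assumes "f \<in> Tri" "e \<in> bd f" "\<not> rich e"
    and "\<And>g. g \<in> FF \<Longrightarrow> e \<in> bd g \<Longrightarrow> g \<noteq> f \<Longrightarrow> card (bd g) = 4 \<Longrightarrow> tdeg g = 2"
  shows "sc f e \<le> - 7 / 5"
proof -
  have "f \<in> FF" using assms by (simp add: Tri_def)
  then obtain g where g: "g \<in> FF" "g \<noteq> f" "e \<in> bd g" using other_face assms by blast
  have "tedge e" using assms by (auto simp: tedge_def)
  then have "wt g e \<le> 18 / 5"
    using nonrich_other[OF assms(1-3) g(1,3,2)] assms(4)[OF g(1,3,2)] by (auto simp: wt_def Let_def)
  then show ?thesis using sc_nonrich[OF assms(1-3) g(1,3,2)] by simp
qed

lemma sc_le_2:
  assumes "f \<in> Tri" "e \<in> bd f" "g \<in> FF" "e \<in> bd g" "g \<noteq> f" "6 \<le> card (bd g)"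
  shows "sc f e \<le> - 2" "\<not> rich e"
proof -
  show nr: "\<not> rich e"
  proof
    assume "rich e"
    then obtain h where h: "h \<in> Tri" "h \<noteq> f" "e \<in> bd h" using rich_other assms by metis
    then have "h = g" using at_most_two[of f g h e] assms by (auto simp: Tri_def)
    then show False using h assms(6) by (simp add: Tri_def)
  qed
  show "sc f e \<le> - 2"
    using sc_nonrich[OF assms(1,2) nr assms(3-5)] assms(6) by (simp add: wt_def Let_def)
qed

lemma sc_rich: "rich e \<Longrightarrow> sc f e = 1 / 2" by (simp add: sc_def)

lemma Sc_T:
  assumes "T f a b c"
  shows "Sc f = sc f {a, b} + sc f {b, c} + sc f {a, c}"
proof -
  have "{a, b} \<noteq> {b, c}" "{a, b} \<noteq> {c, a}" "{b, c} \<noteq> {c, a}"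
    using assms by (auto simp: T_def doubleton_eq_iff)
  then show ?thesis using assms by (simp add: T_def Sc_def insert_commute)
qed

definition closed_tri :: "'f set \<Rightarrow> bool" where
  "closed_tri K \<longleftrightarrow> K \<subseteq> Tri \<and> (\<forall>f\<in>K. \<forall>g\<in>Tri. bd f \<inter> bd g \<noteq> {} \<longrightarrow> g \<in> K)"

text \<open>A single edge-connected cluster that is not overdrawn: closed sets are unions of
  clusters, and \<open>K\<close> lies in every closed set that it meets.\<close>

definition block :: "'f set \<Rightarrow> bool" where
  "block K \<longleftrightarrow> closed_tri K \<and> (\<forall>U. closed_tri U \<and> U \<inter> K \<noteq> {} \<longrightarrow> K \<subseteq> U) \<and> sum Sc K \<le> 0"

lemma finTri: "finite Tri" using finFF by (simp add: Tri_def)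

text \<open>A block that meets a closed set lies in it, and its removal leaves a closed set. So
  blocks can be split off until no triangle of positive charge remains.\<close>

lemma sum_Sc_closed:
  assumes blk: "\<And>f. f \<in> Tri \<Longrightarrow> 0 < Sc f \<Longrightarrow> \<exists>K. f \<in> K \<and> block K"
  shows "closed_tri U \<Longrightarrow> sum Sc U \<le> 0"
proof (induction "card U" arbitrary: U rule: less_induct)
  case less
  have fin: "finite U" using less.prems finTri finite_subset by (auto simp: closed_tri_def)
  show ?case
  proof (cases "\<exists>f\<in>U. 0 < Sc f")
    case False
    then show ?thesis by (intro sum_nonpos) (auto simp: not_less)
  next
    case True
    then obtain f where f: "f \<in> U" "0 < Sc f" by auto
    then have "f \<in> Tri" using less.prems by (auto simp: closed_tri_def)
    then obtain K where K: "f \<in> K" "block K" using blk f by blast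
    then have KU: "K \<subseteq> U" using less.prems f by (auto simp: block_def)
    have clK: "closed_tri K" using K by (simp add: block_def)
    have "closed_tri (U - K)"
      unfolding closed_tri_def
    proof (intro conjI ballI impI)
      show "U - K \<subseteq> Tri" using less.prems by (auto simp: closed_tri_def)
      fix a b assume ab: "a \<in> U - K" "b \<in> Tri" "bd a \<inter> bd b \<noteq> {}"
      then have "b \<in> U" using less.prems by (auto simp: closed_tri_def)
      moreover have "b \<notin> K"
      proof
        assume "b \<in> K"
        moreover have "a \<in> Tri" using ab less.prems by (auto simp: closed_tri_def)
        ultimately have "a \<in> K" using clK ab by (auto simp: closed_tri_def Int_commute)
        then show False using ab by auto
      qed
      ultimately show "b \<in> U - K" by auto
    qed
    moreover have "card (U - K) < card U"
      using K(1) f fin by (intro psubset_card_mono) auto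
    ultimately have "sum Sc (U - K) \<le> 0" using less.hyps by blast
    moreover have "sum Sc U = sum Sc (U - K) + sum Sc K" using KU fin by (simp add: sum.subset_diff)
    moreover have "sum Sc K \<le> 0" using K by (simp add: block_def)
    ultimately show ?thesis by simp
  qed
qed

text \<open>The weights are made for this: 3 * 6, 4 * 9/2, 2 * 7/2 + 2 * 11/2, 5 * 18/5, and at
  least 6 * 3. In a 4-face with two triangle edges the relief of these is paid by the other two,
  each of which gives half of its 11 units.\<close>

lemma sum_wt_face:
  assumes "f \<in> FF"
  shows "18 \<le> (\<Sum>e\<in>bd f. wt f e)"
proof -
  have fin: "finite (bd f)" and k3: "3 \<le> card (bd f)"
    using cycle_card_Union[OF cyc[OF assms]] by (auto intro: card_ge_0_finite)
  consider "card (bd f) = 3" | "card (bd f) = 4" "tdeg f = 2" | "card (bd f) = 4" "tdeg f \<noteq> 2"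
    | "card (bd f) = 5" | "card (bd f) \<ge> 6" using k3 by linarith
  then show ?thesis
  proof cases
    case 2
    let ?A = "{e\<in>bd f. tedge e}" and ?B = "{e\<in>bd f. \<not> tedge e}"
    have "bd f = ?A \<union> ?B" by auto
    then have "card ?A + card ?B = 4" using 2(1) card_Un_disjoint[of ?A ?B] fin by auto
    then have AB: "card ?A = 2" "card ?B = 2" using 2(2) by (auto simp: tdeg_def)
    have "(\<Sum>e\<in>bd f. wt f e) = (\<Sum>e\<in>?A. wt f e) + (\<Sum>e\<in>?B. wt f e)"
      using fin by (subst sum.union_disjoint[symmetric]) (auto intro: sum.cong)
    also have "(\<Sum>e\<in>?A. wt f e) = (\<Sum>e\<in>?A. 7 / 2)" using 2 by (intro sum.cong) (auto simp: wt_def)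
    also have "(\<Sum>e\<in>?B. wt f e) = (\<Sum>e\<in>?B. 11 / 2)" using 2 by (intro sum.cong) (auto simp: wt_def)
    finally show ?thesis using AB by simp
  qed (auto simp: wt_def)
qed

text \<open>Between two triangles 6 + 6 = 11 + 1/2 + 1/2; with one triangle the definition of
  \<open>sc\<close> makes it an equality; without triangles each side asks at most 11/2.\<close>

lemma sum_wt_edge:
  assumes "e \<in> edges G"
  shows "(\<Sum>f\<in>{f\<in>FF. e \<in> bd f}. wt f e) \<le> 11 + (\<Sum>f\<in>{f\<in>Tri. e \<in> bd f}. sc f e)"
proof -
  obtain f g where fg: "{f\<in>FF. e \<in> bd f} = {f, g}" "f \<noteq> g"
    using two_faces[OF assms] by (auto simp: card_2_iff)
  then have m: "f \<in> FF" "g \<in> FF" "e \<in> bd f" "e \<in> bd g" by auto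
  have tri: "{f\<in>Tri. e \<in> bd f} = {h\<in>{f, g}. h \<in> Tri}"
    unfolding fg(1)[symmetric] by (auto simp: Tri_def)
  have w6: "wt h e = 6" if "h \<in> Tri" for h using that by (simp add: wt_def Tri_def)
  have one: ?thesis if h: "h \<in> Tri" "k \<notin> Tri" "{h, k} = {f, g}" for h k
  proof -
    have hk: "h \<in> FF" "k \<in> FF" "e \<in> bd h" "e \<in> bd k" "h \<noteq> k"
      using h m fg(2) by (auto simp: doubleton_eq_iff)
    have "\<not> rich e"
    proof
      assume "rich e"
      then obtain l where "l \<in> Tri" "l \<noteq> h" "e \<in> bd l" using rich_other h(1) hk(3) by metis
      then show False using at_most_two[of h k l e] hk h(2) by (auto simp: Tri_def)
    qed
    then have "sc h e = wt k e - 5" using sc_nonrich h hk by metis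
    moreover have "{x\<in>{h, k}. x \<in> Tri} = {h}" using h by auto
    ultimately show ?thesis
      unfolding tri fg(1) h(3)[symmetric] using hk(5) w6[OF h(1)] by simp
  qed
  show ?thesis
  proof (cases "f \<in> Tri"; cases "g \<in> Tri")
    assume fT: "f \<in> Tri" "g \<in> Tri"
    then have "rich e" using m fg(2) by (auto simp: rich_def)
    moreover have "{x\<in>{f, g}. x \<in> Tri} = {f, g}" using fT by auto
    ultimately show ?thesis unfolding tri fg(1) using fg(2) w6 fT
      by (simp add: sc_rich)
  next
    assume nT: "f \<notin> Tri" "g \<notin> Tri"
    have "wt h e \<le> 11 / 2" if "h \<in> FF" "h \<notin> Tri" for h
      using that by (auto simp: wt_def Tri_def Let_def)
    then have "wt f e \<le> 11 / 2" "wt g e \<le> 11 / 2" using nT m by auto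
    moreover have "{f\<in>Tri. e \<in> bd f} = {}" unfolding tri using nT by auto
    ultimately show ?thesis unfolding \<open>{f\<in>Tri. e \<in> bd f} = {}\<close> fg(1) using fg(2) by simp
  next
    assume "f \<in> Tri" "g \<notin> Tri"
    then show ?thesis using one[of f g] by simp
  next
    assume "f \<notin> Tri" "g \<in> Tri"
    then show ?thesis using one[of g f] by (simp add: insert_commute)
  qed
qed

lemma finE: "finite (edges G)"
  using simple by (auto simp: simple_graph_def intro: finite_subset[of _ "Pow (vertices G)"])

text \<open>Double counting of \<open>wt\<close> over all incidences of faces and edges, and of
  \<open>sc\<close> over those with triangles.\<close>

lemma discharging:
  assumes blk: "\<And>f. f \<in> Tri \<Longrightarrow> 0 < Sc f \<Longrightarrow> \<exists>K. f \<in> K \<and> block K"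
  shows "18 * real (card FF) \<le> 11 * real (card (edges G))"
proof -
  have swap: "(\<Sum>f\<in>A. \<Sum>e\<in>bd f. h f e) = (\<Sum>e\<in>edges G. \<Sum>f\<in>{f\<in>A. e \<in> bd f}. h f e)"
    if A: "A \<subseteq> FF" for A and h :: "'f \<Rightarrow> 'a set \<Rightarrow> real"
  proof -
    have "bd f = {e\<in>edges G. e \<in> bd f}" if "f \<in> A" for f using bdE A that by blast
    then have "(\<Sum>f\<in>A. \<Sum>e\<in>bd f. h f e) = (\<Sum>f\<in>A. \<Sum>e\<in>{e\<in>edges G. e \<in> bd f}. h f e)"
      by (intro sum.cong) auto
    also have "\<dots> = (\<Sum>e\<in>edges G. \<Sum>f\<in>{f\<in>A. e \<in> bd f}. h f e)"
      using finE finFF A finite_subset by (intro sum.swap_restrict) auto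
    finally show ?thesis .
  qed
  have "18 * real (card FF) = (\<Sum>f\<in>FF. 18)" by simp
  also have "\<dots> \<le> (\<Sum>f\<in>FF. \<Sum>e\<in>bd f. wt f e)" by (intro sum_mono sum_wt_face)
  also have "\<dots> = (\<Sum>e\<in>edges G. \<Sum>f\<in>{f\<in>FF. e \<in> bd f}. wt f e)" by (rule swap) simp
  also have "\<dots> \<le> (\<Sum>e\<in>edges G. 11 + (\<Sum>f\<in>{f\<in>Tri. e \<in> bd f}. sc f e))"
    by (intro sum_mono sum_wt_edge)
  also have "\<dots> = 11 * real (card (edges G)) + (\<Sum>e\<in>edges G. \<Sum>f\<in>{f\<in>Tri. e \<in> bd f}. sc f e)"
    by (simp add: sum.distrib)
  also have "(\<Sum>e\<in>edges G. \<Sum>f\<in>{f\<in>Tri. e \<in> bd f}. sc f e) = (\<Sum>f\<in>Tri. Sc f)"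
    unfolding Sc_def by (rule swap[symmetric]) (auto simp: Tri_def)
  also have "(\<Sum>f\<in>Tri. Sc f) \<le> 0"
    using sum_Sc_closed[OF blk, of Tri] by (simp add: closed_tri_def)
  finally show ?thesis by simp
qed

end

section \<open>Hubs: three triangles around a vertex\<close>

context theta_free_faces
begin

text \<open>A \<open>K\<^sub>4\<close> drawn with \<open>b\<close> in the middle: the three
  triangles at \<open>b\<close> are faces, and \<open>a\<close>, \<open>c\<close>, \<open>x\<close>
  are the outer vertices.\<close>

definition hub :: "'a \<Rightarrow> 'a \<Rightarrow> 'a \<Rightarrow> 'a \<Rightarrow> 'f \<Rightarrow> 'f \<Rightarrow> 'f \<Rightarrow> bool" where
  "hub b a c x f1 f2 f3 \<longleftrightarrow> T f1 a b c \<and> T f2 a b x \<and> T f3 c b x \<and> distinct [a, b, c, x]"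

lemma hub_swap1: "hub b a c x f1 f2 f3 \<Longrightarrow> hub b c a x f1 f3 f2"
  unfolding hub_def using T_perms[of f1 a b c] by auto

lemma hub_swap2: "hub b a c x f1 f2 f3 \<Longrightarrow> hub b a x c f2 f1 f3"
  unfolding hub_def using T_perms[of f3 c b x] by auto

lemma hub_distinct:
  assumes "hub b a c x f1 f2 f3"
  shows "f1 \<noteq> f2" "f1 \<noteq> f3" "f2 \<noteq> f3"
  using assms T_mem[of f1 a b c b c] T_mem[of f2 a b x b c] T_mem[of f1 a b c a b] T_mem[of f3 c b x a b]
    T_mem[of f2 a b x a b]
  unfolding hub_def by auto

text \<open>Each inner edge already has its two faces among \<open>f1\<close>, \<open>f2\<close>,
  \<open>f3\<close>.\<close>

lemma hub_used:
  assumes h: "hub b a c x f1 f2 f3" and g: "g \<in> FF"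
  shows "{a, b} \<in> bd g \<Longrightarrow> g = f1 \<or> g = f2" "{b, c} \<in> bd g \<Longrightarrow> g = f1 \<or> g = f3"
    "{b, x} \<in> bd g \<Longrightarrow> g = f2 \<or> g = f3"
  using at_most_two[of f1 f2 g "{a, b}"] at_most_two[of f1 f3 g "{b, c}"] at_most_two[of f2 f3 g "{b, x}"]
    hub_distinct[OF h] h g T_edges T_FF
  unfolding hub_def by metis+

lemma hub_adj:
  assumes "hub b a c x f1 f2 f3"
  shows "adj a b" "adj b c" "adj a c" "adj a x" "adj b x" "adj c x"
    "adj b a" "adj c b" "adj c a" "adj x a" "adj x b" "adj x c"
  using assms T_adj unfolding hub_def by metis+

lemma hub_tri: "hub b a c x f1 f2 f3 \<Longrightarrow> f1 \<in> Tri \<and> f2 \<in> Tri \<and> f3 \<in> Tri"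
  unfolding hub_def using T_Tri by blast

lemma hub_edges:
  assumes "hub b a c x f1 f2 f3"
  shows "bd f1 = {{a, b}, {b, c}, {a, c}}" "bd f2 = {{a, b}, {b, x}, {a, x}}" "bd f3 = {{b, c}, {b, x}, {c, x}}"
  using assms by (auto simp: hub_def T_def insert_commute)

lemma T_card: "T f a b c \<Longrightarrow> card (bd f) = 3"
  using T_Tri by (auto simp: Tri_def)

lemma hub_no_inner:
  assumes h: "hub b a c x f1 f2 f3" and g: "g \<in> FF" "g \<noteq> f1" "g \<noteq> f2" "g \<noteq> f3"
  shows "{a, b} \<notin> bd g" "{b, c} \<notin> bd g" "{b, x} \<notin> bd g" "{b, a} \<notin> bd g" "{c, b} \<notin> bd g" "{x, b} \<notin> bd g"
  using hub_used[OF h g(1)] g by (auto simp: insert_commute)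

lemma hub_card:
  assumes "hub b a c x f1 f2 f3" "card (bd g) \<noteq> 3"
  shows "g \<noteq> f1" "g \<noteq> f2" "g \<noteq> f3"
  using assms T_card unfolding hub_def by metis+

text \<open>\<open>small_closed\<close> for an explicit list of edges: that every edge has both of
  its faces in \<open>K\<close> becomes a finite check by simplification.\<close>

lemma small_closed_edges:
  assumes "K \<subseteq> FF" "K \<noteq> {}" and EE: "\<And>f. f \<in> K \<Longrightarrow> bd f \<subseteq> EE"
    and two: "\<forall>e\<in>EE. \<exists>g\<in>K. \<exists>g'\<in>K. g \<noteq> g' \<and> e \<in> bd g \<and> e \<in> bd g'"
    and S: "\<Union>EE \<subseteq> S" "finite S" "card S \<le> 5"
  shows False
proof (rule small_closed[OF assms(1,2)])
  show "\<exists>g\<in>K. g \<noteq> f \<and> e \<in> bd g" if "f \<in> K" "e \<in> bd f" for f e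
  proof -
    have "e \<in> EE" using EE that by blast
    then show ?thesis using two by metis
  qed
  show "\<Union>(bd f) \<subseteq> S" if "f \<in> K" for f using EE[OF that] S(1) by blast
qed (use S in auto)

text \<open>If the 4-face \<open>a x p q\<close> misses \<open>c\<close>, then the 5-cycle
  \<open>a b x p q\<close> with \<open>c\<close> joined to \<open>a\<close> and \<open>b\<close> is
  forbidden. So the face passes through \<open>c\<close> and uses two sides of the outer
  triangle.\<close>

lemma hub_four:
  assumes h: "hub b a c x f1 f2 f3" and g: "g \<in> FF" "card (bd g) = 4" "{a, x} \<in> bd g"
  obtains q where "q \<notin> {a, b, c, x}" "bd g = {{a, x}, {x, c}, {c, q}, {q, a}}"
  | q where "q \<notin> {a, b, c, x}" "bd g = {{a, x}, {a, c}, {c, q}, {q, x}}"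
proof -
  obtain p q where pq: "distinct [a, x, p, q]" "bd g = {{a, x}, {x, p}, {p, q}, {q, a}}"
    using four_face[OF g] .
  have gn: "g \<noteq> f1" "g \<noteq> f2" "g \<noteq> f3" using hub_card[OF h] g(2) by auto
  note no = hub_no_inner[OF h g(1) gn]
  have bpq: "b \<noteq> p" "b \<noteq> q" using no pq by auto
  have E: "adj x p" "adj p q" "adj q a" using bdE[OF g(1)] pq by auto
  have d: "distinct [a, b, c, x]" using h by (simp add: hub_def)
  have "c = p \<or> c = q"
  proof (rule ccontr)
    assume "\<not> ?thesis"
    then have "distinct [a, b, x, p, q, c]" using d pq bpq by auto
    from theta[OF this] show False using E hub_adj[OF h] by blast
  qed
  then show ?thesis
  proof
    assume "c = p"
    then show ?thesis using that(1)[of q] pq d bpq by auto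
  next
    assume "c = q"
    then show ?thesis using that(2)[of p] pq d bpq by (auto simp: insert_commute)
  qed
qed

text \<open>A triangle \<open>q a w\<close> with a new apex gives the 5-cycle
  \<open>a q c b x\<close> with \<open>w\<close> joined to \<open>a\<close> and \<open>q\<close>.
  The apexes \<open>b\<close> and \<open>x\<close> would need a third face at an edge, and
  \<open>c\<close> is excluded by \<open>noT\<close>.\<close>

lemma hub_no_tedge:
  assumes h: "hub b a c x f1 f2 f3" and g: "g \<in> FF" "card (bd g) = 4"
      "bd g = {{a, x}, {x, c}, {c, q}, {q, a}}" and q: "q \<notin> {a, b, c, x}"
    and noT: "\<And>h. \<not> T h a q c"
  shows "\<not> tedge {q, a}"
proof
  assume "tedge {q, a}"
  then obtain k where k: "k \<in> Tri" "{q, a} \<in> bd k" by (auto simp: tedge_def)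
  then obtain w where w: "T k q a w" using third_vertex by blast
  have d: "distinct [a, b, c, x]" using h by (simp add: hub_def)
  have E: "adj q a" "adj c q" using bdE[OF g(1)] g(3) by auto
  have kn: "k \<noteq> f1" "k \<noteq> f2" "k \<noteq> f3"
    using k h q T_mem[of f1 a b c q a] T_mem[of f2 a b x q a] T_mem[of f3 c b x q a] unfolding hub_def by auto
  have kF: "k \<in> FF" using w T_FF by auto
  note no = hub_no_inner[OF h kF kn]
  have "w \<noteq> c" using noT[of k] w T_perms[OF w] by auto
  moreover have "w \<noteq> b" using no T_edges[OF w] by auto
  moreover have "w \<noteq> x"
  proof
    assume "w = x"
    then have "{a, x} \<in> bd k" using T_edges[OF w] by auto
    moreover have "{a, x} \<in> bd f2" "f2 \<in> FF" using hub_edges[OF h] hub_tri[OF h] by (auto simp: Tri_def)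
    moreover have "g \<noteq> f2" "k \<noteq> g" using hub_card[OF h] g(2) k by (auto simp: Tri_def)
    ultimately show False using at_most_two[of f2 g k "{a, x}"] g kF kn by auto
  qed
  ultimately have "distinct [a, q, c, b, x, w]" using d q w by (auto simp: T_def)
  from theta[OF this] show False using E hub_adj[OF h] T_adj[OF w] by (simp add: insert_commute)
qed

text \<open>The four triangles would close up on four vertices.\<close>

lemma hub_outer_K4:
  assumes h: "hub b a c x f1 f2 f3" and k: "k \<in> FF" "k \<noteq> f1"
    and bd: "bd k = {{a, c}, {c, x}, {a, x}}"
  shows False
proof -
  note d = hub_distinct[OF h] and tr = hub_tri[OF h] and bds = hub_edges[OF h]
  have dd: "distinct [a, b, c, x]" using h by (simp add: hub_def)
  have "{a, b} \<notin> bd k" "{b, x} \<notin> bd k" using dd by (auto simp: bd doubleton_eq_iff)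
  then have kn: "k \<noteq> f2" "k \<noteq> f3" using bds by auto
  show False
  proof (rule small_closed_edges[of "{f1, f2, f3, k}"
        "{{a, b}, {b, c}, {b, x}, {a, c}, {a, x}, {c, x}}" "{a, b, c, x}"])
    show "{f1, f2, f3, k} \<subseteq> FF" using tr k by (auto simp: Tri_def)
    show "bd f \<subseteq> {{a, b}, {b, c}, {b, x}, {a, c}, {a, x}, {c, x}}" if "f \<in> {f1, f2, f3, k}" for f
      using that by (elim insertE emptyE) (simp_all add: bds bd)
    show "\<forall>e\<in>{{a, b}, {b, c}, {b, x}, {a, c}, {a, x}, {c, x}}. \<exists>g\<in>{f1, f2, f3, k}. \<exists>g'\<in>{f1, f2, f3, k}.
        g \<noteq> g' \<and> e \<in> bd g \<and> e \<in> bd g'"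
      using d kn k(2) by (simp add: bds bd)
    show "card {a, b, c, x} \<le> 5" by (simp add: card_insert_if)
  qed auto
qed

text \<open>Four triangles and a 4-face would close up on the five vertices \<open>a\<close>,
  \<open>b\<close>, \<open>c\<close>, \<open>x\<close>, \<open>z\<close>.\<close>

lemma hub_closed5:
  assumes h: "hub b a c x f1 f2 f3" and k: "T k a c z" "k \<noteq> f1" "z \<noteq> x"
    and g: "g \<in> FF" "bd g = {{a, x}, {c, x}, {c, z}, {a, z}}"
  shows False
proof -
  note d = hub_distinct[OF h] and tr = hub_tri[OF h] and bds = hub_edges[OF h]
  have dd: "distinct [a, b, c, x]" "distinct [a, c, z]" using h k by (auto simp: hub_def T_def)
  have bk: "bd k = {{a, c}, {c, z}, {a, z}}" using k by (auto simp: T_def insert_commute)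
  have "{a, c} \<notin> bd f2" "{a, c} \<notin> bd f3" using dd by (auto simp: bds doubleton_eq_iff)
  then have kn: "k \<noteq> f2" "k \<noteq> f3" using bk by auto
  have zb: "z \<noteq> b" using hub_used(1)[OF h T_FF[OF k(1)]] bk k(2) kn by auto
  have "{a, b} \<notin> bd g" "{b, c} \<notin> bd g" "{a, c} \<notin> bd g"
    using dd zb k(3) by (auto simp: g(2) doubleton_eq_iff)
  then have gn: "g \<noteq> f1" "g \<noteq> f2" "g \<noteq> f3" "g \<noteq> k" using bds bk by auto
  show False
  proof (rule small_closed_edges[of "{f1, f2, f3, k, g}"
        "{{a, b}, {b, c}, {b, x}, {a, c}, {a, x}, {c, x}, {a, z}, {c, z}}" "{a, b, c, x, z}"])
    show "{f1, f2, f3, k, g} \<subseteq> FF" using tr T_FF[OF k(1)] g by (auto simp: Tri_def)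
    show "bd f \<subseteq> {{a, b}, {b, c}, {b, x}, {a, c}, {a, x}, {c, x}, {a, z}, {c, z}}" if "f \<in> {f1, f2, f3, k, g}" for f
      using that by (elim insertE emptyE) (simp_all add: bds bk g(2))
    show "\<forall>e\<in>{{a, b}, {b, c}, {b, x}, {a, c}, {a, x}, {c, x}, {a, z}, {c, z}}.
        \<exists>g'\<in>{f1, f2, f3, k, g}. \<exists>g''\<in>{f1, f2, f3, k, g}. g' \<noteq> g'' \<and> e \<in> bd g' \<and> e \<in> bd g''"
      using d kn gn k(2) by (simp add: bds bk g(2))
    show "card {a, b, c, x, z} \<le> 5" by (simp add: card_insert_if)
  qed auto
qed

text \<open>The two edges shared with the hub border triangles, the two edges at \<open>q\<close> do
  not. Hence such a face asks only 7/2 of the hub's edges.\<close>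

lemma hub_four_tdeg_aux:
  assumes h: "hub b a c x f1 f2 f3" and g: "g \<in> FF" "card (bd g) = 4"
      "bd g = {{a, x}, {x, c}, {c, q}, {q, a}}" and q: "q \<notin> {a, b, c, x}"
  shows "tdeg g = 2"
proof -
  have noT: "\<not> T k a q c" for k
  proof
    assume k: "T k a q c"
    have "{a, q} \<notin> bd f1" using h q T_mem unfolding hub_def by auto
    then have "k \<noteq> f1" using T_edges[OF k] by auto
    moreover have "bd g = {{a, x}, {c, x}, {c, q}, {a, q}}" using g(3) by (auto simp: insert_commute)
    ultimately show False using hub_closed5[OF h T_perms(4)[OF k]] g(1) q by auto
  qed
  have g': "bd g = {{c, x}, {x, a}, {a, q}, {q, c}}" using g(3) by (auto simp: insert_commute)
  have "\<not> tedge {q, a}" using hub_no_tedge[OF h g q] noT by blast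
  moreover have "\<not> tedge {q, c}"
    using hub_no_tedge[OF hub_swap1[OF h] g(1,2) g'] q noT T_perms by blast
  moreover have "tedge {a, x}" "tedge {x, c}"
    using hub_tri[OF h] hub_edges[OF h] by (auto simp: tedge_def insert_commute)
  ultimately have "{e\<in>bd g. tedge e} = {{a, x}, {x, c}}" using g(3) by (auto simp: insert_commute)
  moreover have "{a, x} \<noteq> {x, c}" using h by (auto simp: hub_def doubleton_eq_iff)
  ultimately show ?thesis by (simp add: tdeg_def)
qed

lemma hub_four_tdeg:
  assumes h: "hub b a c x f1 f2 f3" and g: "g \<in> FF" "{a, x} \<in> bd g" "card (bd g) = 4"
  shows "tdeg g = 2"
proof (rule hub_four[OF h g(1,3,2)])
  fix q assume "q \<notin> {a, b, c, x}" "bd g = {{a, x}, {x, c}, {c, q}, {q, a}}"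
  then show ?thesis using hub_four_tdeg_aux[OF h] g by blast
next
  fix q assume q: "q \<notin> {a, b, c, x}" "bd g = {{a, x}, {a, c}, {c, q}, {q, x}}"
  have h': "hub b x c a f3 f2 f1" using hub_swap1 hub_swap2 h by blast
  have "bd g = {{x, a}, {a, c}, {c, q}, {q, x}}" "q \<notin> {x, b, c, a}" using q by (auto simp: insert_commute)
  then show ?thesis using hub_four_tdeg_aux[OF h'] g by blast
qed

lemma hub_sc:
  assumes h: "hub b a c x f1 f2 f3" and nr: "\<not> rich {a, x}"
  shows "sc f2 {a, x} \<le> - 7 / 5"
  using h T_Tri T_edges hub_four_tdeg[OF h] nr unfolding hub_def by (intro sc_le_75) blast+

lemma hub_inner_rich:
  assumes h: "hub b a c x f1 f2 f3"
  shows "rich {a, b}" "rich {b, c}" "rich {b, x}"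
  using h hub_distinct[OF h] T_Tri T_edges unfolding hub_def rich_def by meson+

lemma hub_Sc:
  assumes h: "hub b a c x f1 f2 f3"
  shows "Sc f1 = 1 + sc f1 {a, c}" "Sc f2 = 1 + sc f2 {a, x}" "Sc f3 = 1 + sc f3 {c, x}"
  using h hub_inner_rich[OF h] Sc_T[of f1 a b c] Sc_T[of f2 a b x] Sc_T[of f3 c b x]
  unfolding hub_def by (auto simp: sc_rich insert_commute)

lemma closed_triD: "closed_tri U \<Longrightarrow> f \<in> U \<Longrightarrow> g \<in> Tri \<Longrightarrow> e \<in> bd f \<Longrightarrow> e \<in> bd g \<Longrightarrow> g \<in> U"
  unfolding closed_tri_def by blast

lemma hub_connected:
  assumes h: "hub b a c x f1 f2 f3" and U: "closed_tri U"
  shows "f1 \<in> U \<longleftrightarrow> f2 \<in> U" "f1 \<in> U \<longleftrightarrow> f3 \<in> U"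
  using hub_tri[OF h] hub_edges[OF h] closed_triD[OF U] by (metis insertI1 insertI2)+

lemma nonrich_unique:
  assumes "\<not> rich e" "f \<in> Tri" "g \<in> Tri" "e \<in> bd f" "e \<in> bd g"
  shows "g = f"
  using assms unfolding rich_def by blast

lemma closed_triI:
  assumes "K \<subseteq> Tri" "\<And>f e g. f \<in> K \<Longrightarrow> e \<in> bd f \<Longrightarrow> g \<in> Tri \<Longrightarrow> e \<in> bd g \<Longrightarrow> g \<in> K"
  shows "closed_tri K"
  using assms unfolding closed_tri_def by blast

text \<open>Each triangle has two rich inner edges and one outer edge that is not rich, so its
  charge is at most 1 - 7/5.\<close>

lemma hub0_block:
  assumes h: "hub b a c x f1 f2 f3" and nr: "\<not> rich {a, c}" "\<not> rich {a, x}" "\<not> rich {c, x}"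
  shows "block {f1, f2, f3}"
proof -
  note d = hub_distinct[OF h] and tr = hub_tri[OF h] and bds = hub_edges[OF h]
  have "sc f1 {a, c} \<le> - 7 / 5" using hub_sc[OF hub_swap2[OF h]] nr by simp
  moreover have "sc f2 {a, x} \<le> - 7 / 5" using hub_sc[OF h] nr by simp
  moreover have "sc f3 {c, x} \<le> - 7 / 5" using hub_sc[OF hub_swap1[OF h]] nr by simp
  ultimately have "sum Sc {f1, f2, f3} \<le> 0" using d hub_Sc[OF h] by simp
  moreover have "closed_tri {f1, f2, f3}"
  proof (rule closed_triI)
    fix f e g assume f: "f \<in> {f1, f2, f3}" "e \<in> bd f" "g \<in> Tri" "e \<in> bd g"
    have g: "g \<in> FF" using f by (simp add: Tri_def)
    have "bd f \<subseteq> {{a, b}, {b, c}, {b, x}} \<union> {{a, c}, {a, x}, {c, x}}"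
      using f(1) by (elim insertE emptyE) (simp_all add: bds)
    from subsetD[OF this f(2)] have "e \<in> {{a, b}, {b, c}, {b, x}} \<or> e \<in> {{a, c}, {a, x}, {c, x}}"
      by (simp only: Un_iff)
    then show "g \<in> {f1, f2, f3}"
    proof
      assume "e \<in> {{a, b}, {b, c}, {b, x}}"
      then show ?thesis using hub_used[OF h g] f(4) by auto
    next
      assume "e \<in> {{a, c}, {a, x}, {c, x}}"
      then have "\<not> rich e" using nr by auto
      moreover have "f \<in> Tri" using f tr by auto
      ultimately have "g = f" using nonrich_unique f by blast
      then show ?thesis using f by simp
    qed
  qed (use tr in auto)
  moreover have "{f1, f2, f3} \<subseteq> U" if "closed_tri U" "U \<inter> {f1, f2, f3} \<noteq> {}" for U
    using that hub_connected[OF h that(1)] by auto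
  ultimately show ?thesis unfolding block_def by blast
qed

text \<open>The setting of the next lemmas: a further triangle \<open>k\<close> with apex
  \<open>z\<close> lies across the outer edge \<open>{a, c}\<close> of the hub.\<close>

lemma hub1_facts:
  assumes h: "hub b a c x f1 f2 f3" and k: "T k a c z" "k \<noteq> f1" and nr: "\<not> rich {a, x}"
  shows "z \<notin> {a, b, c, x}" "k \<noteq> f2" "k \<noteq> f3" "adj a z" "adj c z"
proof -
  note d = hub_distinct[OF h] and tr = hub_tri[OF h] and bds = hub_edges[OF h]
  have dd: "distinct [a, b, c, x]" using h by (simp add: hub_def)
  have kac: "{a, c} \<in> bd k" using T_edges[OF k(1)] by simp
  have "{a, c} \<notin> bd f2" "{a, c} \<notin> bd f3" using bds dd by (auto simp: doubleton_eq_iff)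
  then show kn: "k \<noteq> f2" "k \<noteq> f3" using kac by auto
  have "z \<noteq> b" using hub_no_inner[OF h T_FF[OF k(1)] k(2) kn] T_edges[OF k(1)] by auto
  moreover have "z \<noteq> x"
  proof
    assume "z = x"
    then have "{a, x} \<in> bd k" using T_edges[OF k(1)] by simp
    moreover have "{a, x} \<in> bd f2" using bds by simp
    ultimately show False using nonrich_unique[OF nr] tr T_Tri[OF k(1)] kn by blast
  qed
  ultimately show "z \<notin> {a, b, c, x}" using k(1) by (auto simp: T_def)
  show "adj a z" "adj c z" using T_adj[OF k(1)] by auto
qed

text \<open>A second triangle \<open>a z w\<close> with a new apex gives the 5-cycle
  \<open>a z c b x\<close> with \<open>w\<close> joined to \<open>a\<close> and \<open>z\<close>.
  The old vertices are excluded as apexes because their edges have no face to spare or are not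
  rich.\<close>

lemma hub1_nonrich:
  assumes h: "hub b a c x f1 f2 f3" and k: "T k a c z" "k \<noteq> f1" and nr: "\<not> rich {a, x}"
  shows "\<not> rich {a, z}"
proof
  assume r: "rich {a, z}"
  note F = hub1_facts[OF h k nr]
  note d = hub_distinct[OF h] and tr = hub_tri[OF h] and bds = hub_edges[OF h]
  have dd: "distinct [a, b, c, x]" using h by (simp add: hub_def)
  obtain m where m: "m \<in> Tri" "m \<noteq> k" "{a, z} \<in> bd m"
    using rich_other[OF r T_Tri[OF k(1)]] T_edges[OF k(1)] by metis
  obtain w where w: "T m a z w" using third_vertex m by blast
  have "{a, z} \<notin> bd f1" "{a, z} \<notin> bd f2" "{a, z} \<notin> bd f3"
    unfolding bds using F(1) dd by (auto simp: doubleton_eq_iff)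
  then have mn: "m \<noteq> f1" "m \<noteq> f2" "m \<noteq> f3" using m(3) by auto
  have mF: "m \<in> FF" using m by (simp add: Tri_def)
  have "w \<noteq> c"
  proof
    assume "w = c"
    then have "{a, c} \<in> bd m" using T_edges[OF w] by simp
    moreover have "{a, c} \<in> bd f1" "{a, c} \<in> bd k" using bds T_edges[OF k(1)] by auto
    ultimately show False using at_most_two[of f1 k m "{a, c}"] mF tr T_FF[OF k(1)] k(2) mn m(2)
      by (auto simp: Tri_def)
  qed
  moreover have "w \<noteq> b" using hub_no_inner[OF h mF mn] T_edges[OF w] by auto
  moreover have "w \<noteq> x"
  proof
    assume "w = x"
    then have "{a, x} \<in> bd m" using T_edges[OF w] by simp
    then show False using nonrich_unique[OF nr, of f2 m] tr m(1) mn bds by auto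
  qed
  ultimately have "distinct [a, z, c, b, x, w]" using dd F w by (auto simp: T_def)
  from theta[OF this] show False using hub_adj[OF h] F T_adj[OF w] by (simp add: insert_commute)
qed

lemma hub1_no_tedge:
  assumes h: "hub b a c x f1 f2 f3" and k: "T k a c z" "k \<noteq> f1" and nr: "\<not> rich {a, x}"
    and g: "g \<in> FF" "card (bd g) = 4" "bd g = {{a, z}, {z, c}, {c, q}, {q, a}}"
    and q: "q \<notin> {a, b, c, x, z}"
  shows "\<not> tedge {q, a}"
proof
  assume "tedge {q, a}"
  then obtain m where m: "m \<in> Tri" "{q, a} \<in> bd m" by (auto simp: tedge_def)
  note F = hub1_facts[OF h k nr]
  note d = hub_distinct[OF h] and tr = hub_tri[OF h] and bds = hub_edges[OF h]
  have dd: "distinct [a, b, c, x]" using h by (simp add: hub_def)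
  obtain w where w: "T m q a w" using third_vertex m by blast
  have "{q, a} \<notin> bd f1" "{q, a} \<notin> bd f2" "{q, a} \<notin> bd f3"
    unfolding bds using q dd by (auto simp: doubleton_eq_iff)
  then have mn: "m \<noteq> f1" "m \<noteq> f2" "m \<noteq> f3" using m(2) by auto
  have mF: "m \<in> FF" using m by (simp add: Tri_def)
  have "{q, a} \<notin> bd k" using k(1) q by (auto simp: T_mem)
  then have mk: "m \<noteq> k" using m by auto
  have "w \<noteq> c"
  proof
    assume "w = c"
    then have "{a, c} \<in> bd m" using T_edges[OF w] by simp
    moreover have "{a, c} \<in> bd f1" "{a, c} \<in> bd k" using bds T_edges[OF k(1)] by auto
    ultimately show False using at_most_two[of f1 k m "{a, c}"] mF tr T_FF[OF k(1)] k(2) mn mk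
      by (auto simp: Tri_def)
  qed
  moreover have "w \<noteq> b" using hub_no_inner[OF h mF mn] T_edges[OF w] by auto
  moreover have "w \<noteq> x"
  proof
    assume "w = x"
    then have "{a, x} \<in> bd m" using T_edges[OF w] by simp
    then show False using nonrich_unique[OF nr, of f2 m] tr m(1) mn bds by auto
  qed
  ultimately have "distinct [a, q, c, b, x, w]" using dd q w by (auto simp: T_def)
  moreover have "adj q a" "adj c q" using bdE[OF g(1)] g(3) by auto
  ultimately show False using theta[of a q c b x w] hub_adj[OF h] T_adj[OF w] by (simp add: insert_commute)
qed

text \<open>As at the outer edges of the hub: the 4-face must return through \<open>c\<close>, and
  its other two edges border no triangle.\<close>

lemma hub1_four_tdeg:
  assumes h: "hub b a c x f1 f2 f3" and k: "T k a c z" "k \<noteq> f1" and nr: "\<not> rich {a, x}" "\<not> rich {c, x}"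
    and g: "g \<in> FF" "{a, z} \<in> bd g" "g \<noteq> k" "card (bd g) = 4"
  shows "tdeg g = 2"
proof -
  note F = hub1_facts[OF h k nr(1)]
  note d = hub_distinct[OF h] and tr = hub_tri[OF h] and bds = hub_edges[OF h]
  have dd: "distinct [a, b, c, x]" using h by (simp add: hub_def)
  obtain p q where pq: "distinct [a, z, p, q]" "bd g = {{a, z}, {z, p}, {p, q}, {q, a}}"
    using four_face[OF g(1,4,2)] .
  have gn: "g \<noteq> f1" "g \<noteq> f2" "g \<noteq> f3" using hub_card[OF h] g(4) by auto
  note no = hub_no_inner[OF h g(1) gn]
  have "{a, c} \<in> bd f1" "{a, c} \<in> bd k" using bds T_edges[OF k(1)] by auto
  then have noac: "{a, c} \<notin> bd g"
    using at_most_two[of f1 k g "{a, c}"] g tr T_FF[OF k(1)] k(2) gn by (auto simp: Tri_def)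
  have "q \<noteq> c" using noac pq by (auto simp: insert_commute)
  have "q \<noteq> b" using no pq by auto
  have E: "adj z p" "adj p q" "adj q a" using bdE[OF g(1)] pq(2) by auto
  \<comment> \<open>Otherwise \<open>p = b\<close>, with the 5-cycle \<open>a b x c z\<close> and
    the extra vertex \<open>q\<close>, or the 5-cycle \<open>a c z p q\<close> with the extra vertex
    \<open>b\<close> is forbidden.\<close>
  have "p = c"
  proof (rule ccontr)
    assume "p \<noteq> c"
    show False
    proof (cases "p = b")
      case True
      have "q \<noteq> x" using True no pq by auto
      then have "distinct [a, b, x, c, z, q]" using True dd F pq \<open>q \<noteq> c\<close> by auto
      from theta[OF this] show False using hub_adj[OF h] E F True by (simp add: insert_commute)
    next
      case False
      then have "distinct [a, c, z, p, q, b]" using pq dd F \<open>p \<noteq> c\<close> \<open>q \<noteq> c\<close> \<open>q \<noteq> b\<close> by auto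
      from theta[OF this] show False using hub_adj[OF h] E F by (simp add: insert_commute)
    qed
  qed
  then have gb: "bd g = {{a, z}, {z, c}, {c, q}, {q, a}}" using pq by simp
  have "q \<noteq> x"
  proof
    assume "q = x"
    then have "bd g = {{a, x}, {c, x}, {c, z}, {a, z}}" using gb by (auto simp: insert_commute)
    then show False using hub_closed5[OF h k] F g by auto
  qed
  then have q: "q \<notin> {a, b, c, x, z}" using pq \<open>q \<noteq> c\<close> \<open>q \<noteq> b\<close> by auto
  have gb': "bd g = {{c, z}, {z, a}, {a, q}, {q, c}}" using gb by (auto simp: insert_commute)
  have "\<not> tedge {q, a}" using hub1_no_tedge[OF h k nr(1) g(1,4) gb q] .
  moreover have "\<not> tedge {q, c}"
    using hub1_no_tedge[OF hub_swap1[OF h] _ k(2) nr(2) g(1,4) gb'] T_perms[OF k(1)] q by auto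
  moreover have "tedge {a, z}" "tedge {z, c}"
    using T_Tri[OF k(1)] T_edges[OF k(1)] unfolding tedge_def by blast+
  ultimately have "{e\<in>bd g. tedge e} = {{a, z}, {z, c}}" using gb by (auto simp: insert_commute)
  moreover have "{a, z} \<noteq> {z, c}" using dd F by (auto simp: doubleton_eq_iff)
  ultimately show ?thesis by (simp add: tdeg_def)
qed

lemma hub1_sc:
  assumes h: "hub b a c x f1 f2 f3" and k: "T k a c z" "k \<noteq> f1" and nr: "\<not> rich {a, x}" "\<not> rich {c, x}"
  shows "sc k {a, z} \<le> - 7 / 5"
  using T_Tri[OF k(1)] T_edges[OF k(1)] hub1_nonrich[OF h k nr(1)] hub1_four_tdeg[OF h k nr]
  by (intro sc_le_75) blast+

text \<open>The budget: 1 + 1/2 for \<open>f1\<close>, at most 1 - 7/5 for each of \<open>f2\<close>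
  and \<open>f3\<close>, and at most 1/2 - 14/5 for \<open>k\<close>, in total at most -8/5.\<close>

lemma hub1_block:
  assumes h: "hub b a c x f1 f2 f3" and k: "T k a c z" "k \<noteq> f1" and nr: "\<not> rich {a, x}" "\<not> rich {c, x}"
  shows "block {f1, f2, f3, k}"
proof -
  note F = hub1_facts[OF h k nr(1)]
  note d = hub_distinct[OF h] and tr = hub_tri[OF h] and bds = hub_edges[OF h]
  have kT: "k \<in> Tri" using T_Tri[OF k(1)] .
  have h': "hub b c a x f1 f3 f2" using hub_swap1[OF h] .
  have k': "T k c a z" using T_perms[OF k(1)] by simp
  have bk: "bd k = {{a, c}, {c, z}, {a, z}}" using k(1) by (auto simp: T_def insert_commute)
  have rac: "rich {a, c}" using kT tr k(2) bds bk unfolding rich_def by blast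
  have nrz: "\<not> rich {a, z}" "\<not> rich {c, z}" using hub1_nonrich[OF h k nr(1)] hub1_nonrich[OF h' k' k(2) nr(2)] .
  have "sc f2 {a, x} \<le> - 7 / 5" using hub_sc[OF h] nr by simp
  moreover have "sc f3 {c, x} \<le> - 7 / 5" using hub_sc[OF h'] nr by simp
  moreover have "sc k {a, z} \<le> - 7 / 5" using hub1_sc[OF h k nr] .
  moreover have "sc k {c, z} \<le> - 7 / 5" using hub1_sc[OF h' k' k(2) nr(2,1)] .
  moreover have "Sc k = sc k {a, c} + sc k {c, z} + sc k {a, z}" using Sc_T[OF k(1)] .
  ultimately have "sum Sc {f1, f2, f3, k} \<le> 0"
    using d hub_Sc[OF h] k(2) F(2,3) sc_rich[OF rac, of f1] sc_rich[OF rac, of k] by simp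
  moreover have "closed_tri {f1, f2, f3, k}"
  proof (rule closed_triI)
    fix f e g assume f: "f \<in> {f1, f2, f3, k}" "e \<in> bd f" "g \<in> Tri" "e \<in> bd g"
    have g: "g \<in> FF" using f by (simp add: Tri_def)
    have "bd f \<subseteq> {{a, b}, {b, c}, {b, x}} \<union> {{a, c}} \<union> {{a, x}, {c, x}, {a, z}, {c, z}}"
      using f(1) by (elim insertE emptyE) (simp_all add: bds bk)
    from subsetD[OF this f(2)]
    have "e \<in> {{a, b}, {b, c}, {b, x}} \<or> e = {a, c} \<or> e \<in> {{a, x}, {c, x}, {a, z}, {c, z}}"
      by (simp only: Un_iff singleton_iff disj_assoc)
    then show "g \<in> {f1, f2, f3, k}"
    proof (elim disjE)
      assume "e \<in> {{a, b}, {b, c}, {b, x}}"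
      then show ?thesis using hub_used[OF h g] f(4) by auto
    next
      assume "e = {a, c}"
      then show ?thesis using at_most_two[of f1 k g e] tr kT g k(2) f(4) bds bk by (auto simp: Tri_def)
    next
      assume "e \<in> {{a, x}, {c, x}, {a, z}, {c, z}}"
      then have "\<not> rich e" using nr nrz by auto
      moreover have "f \<in> Tri" using f tr kT by auto
      ultimately have "g = f" using nonrich_unique f by blast
      then show ?thesis using f by simp
    qed
  qed (use tr kT in auto)
  moreover have "{f1, f2, f3, k} \<subseteq> U" if "closed_tri U" "U \<inter> {f1, f2, f3, k} \<noteq> {}" for U
  proof -
    have "f1 \<in> U \<longleftrightarrow> k \<in> U" using closed_triD[OF that(1)] tr kT bds bk by (metis insertI1 insertI2)
    then show ?thesis using that hub_connected[OF h that(1)] by auto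
  qed
  ultimately show ?thesis unfolding block_def by blast
qed

end

section \<open>Hubs with several rich outer edges\<close>

context theta_free_faces
begin

lemma T_bd: "T f a b c \<Longrightarrow> bd f = {{a, b}, {b, c}, {a, c}}"
  by (auto simp: T_def insert_commute)

text \<open>Different apexes would give the 5-cycle \<open>c x b a z\<close> with \<open>z'\<close>
  joined to \<open>c\<close> and \<open>x\<close>.\<close>

lemma hub_same_apex:
  assumes h: "hub b a c x f1 f2 f3" and k: "T k a c z" "z \<notin> {a, b, c, x}" and m: "T m c x z'" "z' \<notin> {a, b, c, x}"
  shows "z = z'"
proof (rule ccontr)
  assume "z \<noteq> z'"
  then have "distinct [c, x, b, a, z, z']" using h k m by (auto simp: hub_def)
  from theta[OF this] show False using hub_adj[OF h] T_adj[OF k(1)] T_adj[OF m(1)] by blast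
qed

lemma hub_outer_apex:
  assumes h: "hub b a c x f1 f2 f3" and k: "T k a c z" "k \<noteq> f1"
  shows "z \<notin> {a, b, c, x}" "k \<noteq> f2" "k \<noteq> f3"
proof -
  note d = hub_distinct[OF h] and tr = hub_tri[OF h] and bds = hub_edges[OF h]
  have dd: "distinct [a, b, c, x]" using h by (simp add: hub_def)
  have "{a, c} \<notin> bd f2" "{a, c} \<notin> bd f3" unfolding bds using dd by (auto simp: doubleton_eq_iff)
  then show kn: "k \<noteq> f2" "k \<noteq> f3" using T_edges[OF k(1)] by auto
  have "z \<noteq> b" using hub_no_inner[OF h T_FF[OF k(1)] k(2) kn] T_edges[OF k(1)] by auto
  moreover have "z \<noteq> x"
  proof
    assume "z = x"
    then have "bd k = {{a, c}, {c, x}, {a, x}}" using T_bd[OF k(1)] by simp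
    then show False using hub_outer_K4[OF h T_FF[OF k(1)] k(2)] by blast
  qed
  ultimately show "z \<notin> {a, b, c, x}" using k(1) by (auto simp: T_def)
qed

text \<open>The six triangles are all faces of a drawing of \<open>K\<^sub>5\<close> minus the edge
  \<open>{b, z}\<close> and close up on five vertices.\<close>

lemma hub2_closed6:
  assumes h: "hub b a c x f1 f2 f3" and k: "T k a c z" "k \<noteq> f1" and m: "T m c x z" "m \<noteq> f3"
    and g: "g \<in> FF" "g \<noteq> f2" "bd g = {{a, x}, {x, z}, {a, z}}"
  shows False
proof -
  note d = hub_distinct[OF h] and tr = hub_tri[OF h] and bds = hub_edges[OF h]
  have dd: "distinct [a, b, c, x]" using h by (simp add: hub_def)
  have h': "hub b c x a f3 f1 f2" using hub_swap1[OF hub_swap2[OF hub_swap1[OF hub_swap2[OF h]]]]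
    using hub_swap1 hub_swap2 h by blast
  note K = hub_outer_apex[OF h k] and M = hub_outer_apex[OF h' m]
  note bk = T_bd[OF k(1)] and bm = T_bd[OF m(1)]
  have "{a, c} \<notin> bd m" "{a, c} \<notin> bd g" "{c, z} \<notin> bd g" "{a, b} \<notin> bd g" "{b, c} \<notin> bd g"
    unfolding bm g(3) using dd K(1) by (auto simp: doubleton_eq_iff)
  moreover have "{a, c} \<in> bd k" "{c, z} \<in> bd m" "{a, b} \<in> bd f1" "{b, c} \<in> bd f3" by (simp_all add: bk bm bds)
  ultimately have n: "m \<noteq> k" "g \<noteq> k" "g \<noteq> m" "g \<noteq> f1" "g \<noteq> f3" by auto
  show False
  proof (rule small_closed_edges[of "{f1, f2, f3, k, m, g}"
        "{{a, b}, {b, c}, {b, x}, {a, c}, {a, x}, {c, x}, {a, z}, {c, z}, {x, z}}" "{a, b, c, x, z}"])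
    show "{f1, f2, f3, k, m, g} \<subseteq> FF" using tr T_FF[OF k(1)] T_FF[OF m(1)] g by (auto simp: Tri_def)
    show "bd f \<subseteq> {{a, b}, {b, c}, {b, x}, {a, c}, {a, x}, {c, x}, {a, z}, {c, z}, {x, z}}"
      if "f \<in> {f1, f2, f3, k, m, g}" for f
      using that by (elim insertE emptyE) (simp_all add: bds bk bm g(3))
    show "\<forall>e\<in>{{a, b}, {b, c}, {b, x}, {a, c}, {a, x}, {c, x}, {a, z}, {c, z}, {x, z}}.
        \<exists>g'\<in>{f1, f2, f3, k, m, g}. \<exists>g''\<in>{f1, f2, f3, k, m, g}. g' \<noteq> g'' \<and> e \<in> bd g' \<and> e \<in> bd g''"
      using d K M n k(2) m(2) g(2) by (simp add: bds bk bm g(3))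
    show "card {a, b, c, x, z} \<le> 5" by (simp add: card_insert_if)
  qed auto
qed

text \<open>Two rich outer edges of a hub give a copy of \<open>K\<^sub>5\<close> minus an edge all of whose remaining
  sides are the edges of the triangle \<open>{a, x, z}\<close>.\<close>

lemma hub2_outer:
  assumes h: "hub b a c x f1 f2 f3" and k: "T k a c z" "k \<noteq> f1" and m: "T m c x z" "m \<noteq> f3"
    and g: "g \<in> FF" "g \<notin> {f1, f2, f3, k, m}"
    and uvt: "{u, v, t} = {a, x, z}" "distinct [u, v, t]" and e: "{u, v} \<in> bd g"
  shows "6 \<le> card (bd g)"
proof (rule ccontr)
  assume small: "\<not> 6 \<le> card (bd g)"
  note d = hub_distinct[OF h] and tr = hub_tri[OF h] and bds = hub_edges[OF h] and A = hub_adj[OF h]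
  have dd: "distinct [a, b, c, x]" using h by (simp add: hub_def)
  have h': "hub b c x a f3 f1 f2" using hub_swap1 hub_swap2 h by blast
  note K = hub_outer_apex[OF h k] and M = hub_outer_apex[OF h' m]
  note bk = T_bd[OF k(1)] and bm = T_bd[OF m(1)]
  have d5: "distinct [a, b, c, x, z]" using dd K(1) by auto
  have "{a, c} \<notin> bd m" "{c, z} \<in> bd k" "{c, z} \<in> bd m" "{a, c} \<in> bd k"
    using d5 by (auto simp: bm bk doubleton_eq_iff)
  then have mk: "m \<noteq> k" by auto
  have mF: "m \<in> FF" "k \<in> FF" "f1 \<in> FF" "f3 \<in> FF" using T_FF[OF m(1)] T_FF[OF k(1)] tr by (auto simp: Tri_def)
  have Adj: "adj a z" "adj z a" "adj c z" "adj z c" "adj x z" "adj z x"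
    using T_adj[OF k(1)] T_adj[OF m(1)] by auto
  \<comment> \<open>The other nine pairs are edges, so this one would complete a
    \<open>K\<^sub>5\<close>.\<close>
  have nbz: "\<not> adj b z"
    using noK5[of a b c x z] d5 A Adj by (auto simp: insert_commute)
  have no1: "{a, b} \<notin> bd g" "{b, c} \<notin> bd g" "{b, x} \<notin> bd g" "{b, z} \<notin> bd g"
    using hub_no_inner[OF h g(1)] g(2) nbz bdE[OF g(1)] by auto
  have no2: "{a, c} \<notin> bd g" "{c, x} \<notin> bd g" "{c, z} \<notin> bd g"
    using at_most_two[OF mF(3) mF(2) g(1), of "{a, c}"] at_most_two[OF mF(4) mF(1) g(1), of "{c, x}"]
      at_most_two[OF mF(2) mF(1) g(1), of "{c, z}"] g(2) k(2) m(2) mk bds bk bm by auto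
  have uvS: "u \<in> {a, x, z}" "v \<in> {a, x, z}" "t \<in> {a, x, z}" using uvt(1) by blast+
  have nb: "{b, s} \<notin> bd g" "{s, b} \<notin> bd g" "{c, s} \<notin> bd g" "{s, c} \<notin> bd g" if "s \<in> {a, x, z}" for s
    using that no1 no2 by (auto simp: insert_commute)
  have nbc: "{c, b} \<notin> bd g" "{b, c} \<notin> bd g" using no1 by (auto simp: insert_commute)
  have Auvt: "adj s s'" if "s \<in> {a, x, z}" "s' \<in> {a, x, z}" "s \<noteq> s'" for s s'
    using that A Adj by (elim insertE emptyE) auto
  have Ac: "adj c s" "adj s c" if "s \<in> {a, x, z}" for s
    using that A Adj by (elim insertE emptyE; simp)+
  have bcS: "b \<notin> {a, x, z}" "c \<notin> {a, x, z}" "b \<noteq> c" using d5 by auto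
  \<comment> \<open>A new vertex cannot be joined to two of \<open>a\<close>, \<open>x\<close>,
    \<open>z\<close>: any two of these are consecutive on a 5-cycle through all five old
    vertices.\<close>
  have F2: False if w: "w \<notin> {a, b, c, x, z}" "adj w s" "adj w s'" "s \<in> {a, x, z}" "s' \<in> {a, x, z}" "s \<noteq> s'" for w s s'
  proof -
    have "{s, s'} = {a, x} \<or> {s, s'} = {a, z} \<or> {s, s'} = {x, z}" using w(4-6) by auto
    then show False
    proof (elim disjE)
      assume s: "{s, s'} = {a, x}"
      have "distinct [a, x, b, c, z, w]" using d5 w by auto
      from theta[OF this] show False using A Adj w(2,3) s by (auto simp: doubleton_eq_iff)
    next
      assume s: "{s, s'} = {a, z}"
      have "distinct [a, z, c, b, x, w]" using d5 w by auto
      from theta[OF this] show False using A Adj w(2,3) s by (auto simp: doubleton_eq_iff)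
    next
      assume s: "{s, s'} = {x, z}"
      have "distinct [x, z, c, b, a, w]" using d5 w by auto
      from theta[OF this] show False using A Adj w(2,3) s by (auto simp: doubleton_eq_iff)
    qed
  qed
  \<comment> \<open>A path \<open>v p q u\<close> through new vertices is closed to a 5-cycle by
    \<open>c\<close>, and \<open>b\<close> is joined to \<open>c\<close> and to one of
    \<open>u\<close>, \<open>v\<close>, since \<open>z\<close> is the only outer vertex not adjacent
    to \<open>b\<close>.\<close>
  have F3: False if pq: "p \<notin> {a, b, c, x, z}" "q \<notin> {a, b, c, x, z}" "p \<noteq> q" "adj v p" "adj p q" "adj q u" for p q
  proof (cases "u = z")
    case False
    then have "adj b u" using uvS A by auto
    moreover have "distinct [u, c, v, p, q, b]" using pq uvS uvt(2) d5 bcS by auto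
    ultimately show False using theta[of u c v p q b] pq Ac[OF uvS(1)] Ac[OF uvS(2)] A by blast
  next
    case True
    then have "adj b v" using uvS uvt(2) A by auto
    moreover have "distinct [c, v, p, q, u, b]" using pq uvS uvt(2) d5 bcS by auto
    ultimately show False using theta[of c v p q u b] pq Ac[OF uvS(1)] Ac[OF uvS(2)] A by blast
  qed
  have "3 \<le> card (bd g)" using cycle_card_Union[OF cyc[OF g(1)]] by simp
  then consider "card (bd g) = 3" | "card (bd g) = 4" | "card (bd g) = 5" using small by linarith
  then show False
  proof cases
    case 1
    then have gT: "g \<in> Tri" using g by (simp add: Tri_def)
    obtain w where w: "T g u v w" using third_vertex[OF gT e] .
    note we = T_edges[OF w] and wa = T_adj[OF w]
    have wuv: "w \<noteq> u" "w \<noteq> v" using w by (auto simp: T_def)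
    have "w \<noteq> b" "w \<noteq> c" using we nb uvS by auto
    moreover have "w \<in> {a, b, c, x, z}"
      using F2[of w u v] wa uvS uvt(2) by auto
    ultimately have "w \<in> {u, v, t}" using uvt(1) by auto
    then have "w = t" using wuv by auto
    then have "{u, v} \<in> bd g" "{v, t} \<in> bd g" "{u, t} \<in> bd g" using we by auto
    then have pr: "{s, s'} \<in> bd g" if "s \<in> {u, v, t}" "s' \<in> {u, v, t}" "s \<noteq> s'" for s s'
      using that by (elim insertE emptyE) (simp_all add: insert_commute)
    have "{{a, x}, {x, z}, {a, z}} \<subseteq> bd g"
      using pr[of a x] pr[of x z] pr[of a z] d5 unfolding uvt(1) by simp
    moreover have "card {{a, x}, {x, z}, {a, z}} = 3" using d5 by (auto simp: card_insert_if doubleton_eq_iff)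
    moreover have "finite (bd g)" using 1 card.infinite by fastforce
    ultimately have "bd g = {{a, x}, {x, z}, {a, z}}" using 1 card_subset_eq[of "bd g" "{{a, x}, {x, z}, {a, z}}"] by simp
    then show False using hub2_closed6[OF h k m g(1)] g(2) by auto
  next
    case 2
    obtain p q where pq: "distinct [u, v, p, q]" "bd g = {{u, v}, {v, p}, {p, q}, {q, u}}"
      using four_face[OF g(1) 2 e] .
    then have ed: "{v, p} \<in> bd g" "{p, q} \<in> bd g" "{q, u} \<in> bd g" by auto
    then have ad: "adj v p" "adj p q" "adj q u" using bdE[OF g(1)] by auto
    have ne: "p \<noteq> b" "p \<noteq> c" "q \<noteq> b" "q \<noteq> c" using ed nb uvS by auto
    have mem: "s \<in> {a, b, c, x, z} \<longleftrightarrow> s = b \<or> s = c \<or> s = u \<or> s = v \<or> s = t" for s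
    proof -
      have "s \<in> {a, b, c, x, z} \<longleftrightarrow> s = b \<or> s = c \<or> s \<in> {a, x, z}" by auto
      then show ?thesis unfolding uvt(1)[symmetric] by auto
    qed
    show False
    proof (cases "p = t")
      case True
      then have "q \<notin> {a, b, c, x, z}" unfolding mem using pq(1) ne by auto
      then show False using F2[of q t u] ad True uvS uvt(2) by (auto simp: insert_commute)
    next
      case pt: False
      show False
      proof (cases "q = t")
        case True
        then have "p \<notin> {a, b, c, x, z}" unfolding mem using pq(1) ne by auto
        then show False using F2[of p t v] ad True uvS uvt(2) by (auto simp: insert_commute)
      next
        case False
        then have "p \<notin> {a, b, c, x, z}" "q \<notin> {a, b, c, x, z}" unfolding mem using pt pq(1) ne by auto
        then show False using F3[of p q] ad pq(1) by auto
      qed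
    qed
  next
    case 3
    obtain p q r where pq: "distinct [u, v, p, q, r]" "bd g = {{u, v}, {v, p}, {p, q}, {q, r}, {r, u}}"
      using five_face[OF g(1) 3 e] .
    then have ed: "{v, p} \<in> bd g" "{p, q} \<in> bd g" "{q, r} \<in> bd g" "{r, u} \<in> bd g" by auto
    then have ad: "adj v p" "adj p q" "adj q r" "adj r u" "adj u v" using bdE[OF g(1)] e by auto
    \<comment> \<open>The face is itself a 5-cycle through \<open>{u, v}\<close>, so the common
      neighbours \<open>c\<close> and \<open>t\<close> of \<open>u\<close> and \<open>v\<close> lie
      on it. Then \<open>c\<close> is opposite to \<open>{u, v}\<close> and \<open>t\<close> next to
      \<open>c\<close>; but the edges from \<open>c\<close> to the outer triangle already have two
      other faces.\<close>
    have common: "w \<in> {p, q, r}" if "adj w u" "adj w v" for w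
    proof (rule ccontr)
      assume "w \<notin> {p, q, r}"
      then have "distinct [u, v, p, q, r, w]" using pq(1) adj_neq[OF that(1)] adj_neq[OF that(2)] by auto
      from theta[OF this] show False using ad that by blast
    qed
    have "c \<in> {p, q, r}" using common Ac uvS by auto
    moreover have "c \<noteq> p" "c \<noteq> r" using ed nb uvS by auto
    ultimately have "q = c" by auto
    have "adj t u" "adj t v" using Auvt[OF uvS(3) uvS(1)] Auvt[OF uvS(3) uvS(2)] uvt(2) by auto
    then have "t \<in> {p, q, r}" using common by auto
    moreover have "t \<noteq> q" using \<open>q = c\<close> uvS(3) bcS by auto
    ultimately have "t = p \<or> t = r" by auto
    then show False using ed nb(3,4)[OF uvS(3)] \<open>q = c\<close> by auto
  qed
qed

text \<open>The budget leaves no room: 3/2 for each of \<open>f1\<close> and \<open>f3\<close>, and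
  at most -1 for each of \<open>f2\<close>, \<open>k\<close> and \<open>m\<close>, in total at most
  0.\<close>

lemma hub2_block:
  assumes h: "hub b a c x f1 f2 f3" and k: "T k a c z" "k \<noteq> f1" and m: "T m c x z" "m \<noteq> f3"
    and nr: "\<not> rich {a, x}"
  shows "block {f1, f2, f3, k, m}"
proof -
  note d = hub_distinct[OF h] and tr = hub_tri[OF h] and bds = hub_edges[OF h]
  have dd: "distinct [a, b, c, x]" using h by (simp add: hub_def)
  have h': "hub b c x a f3 f1 f2" using hub_swap1 hub_swap2 h by blast
  note K = hub_outer_apex[OF h k] and M = hub_outer_apex[OF h' m]
  note bk = T_bd[OF k(1)] and bm = T_bd[OF m(1)]
  have d5: "distinct [a, b, c, x, z]" using dd K(1) by auto
  have kT: "k \<in> Tri" "m \<in> Tri" using T_Tri k(1) m(1) by auto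
  have "{a, c} \<notin> bd m" "{a, c} \<in> bd k" using d5 by (auto simp: bm bk doubleton_eq_iff)
  then have mk: "m \<noteq> k" by auto
  have rich3: "rich {a, c}" "rich {c, x}" "rich {c, z}"
    using kT tr k(2) m(2) mk bds bk bm unfolding rich_def by (metis insertI1 insertI2)+
  \<comment> \<open>Each side of the triangle \<open>{a, x, z}\<close> has one face in the cluster;
    the face beyond has at least six edges and asks only 3, so \<open>sc\<close> is at most 3 -
    5.\<close>
  have main: "sc f {u, v} \<le> - 2 \<and> \<not> rich {u, v}"
    if f: "f \<in> {f1, f2, f3, k, m}" "{u, v} \<in> bd f" and t: "{u, v, t} = {a, x, z}" "distinct [u, v, t]"
      and un: "\<And>f'. f' \<in> {f1, f2, f3, k, m} \<Longrightarrow> {u, v} \<in> bd f' \<Longrightarrow> f' = f" for f u v t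
  proof -
    have fT: "f \<in> Tri" using f tr kT by auto
    then have "f \<in> FF" by (simp add: Tri_def)
    then obtain g where g: "g \<in> FF" "g \<noteq> f" "{u, v} \<in> bd g" using other_face f(2) by blast
    have gn: "g \<notin> {f1, f2, f3, k, m}"
    proof
      assume "g \<in> {f1, f2, f3, k, m}"
      then show False using un[OF _ g(3)] g(2) by simp
    qed
    have "6 \<le> card (bd g)" using hub2_outer[OF h k m g(1) gn t g(3)] .
    then show ?thesis using sc_le_2[OF fT f(2) g(1,3,2)] by blast
  qed
  have ax: "sc f2 {a, x} \<le> - 2 \<and> \<not> rich {a, x}"
  proof (rule main)
    show "f' = f2" if "f' \<in> {f1, f2, f3, k, m}" "{a, x} \<in> bd f'" for f'
      using that d5 by (elim insertE emptyE) (auto simp: bds bk bm doubleton_eq_iff)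
  qed (use d5 bds in auto)
  have az: "sc k {a, z} \<le> - 2 \<and> \<not> rich {a, z}"
  proof (rule main)
    show "f' = k" if "f' \<in> {f1, f2, f3, k, m}" "{a, z} \<in> bd f'" for f'
      using that d5 by (elim insertE emptyE) (auto simp: bds bk bm doubleton_eq_iff)
    show "{a, z, x} = {a, x, z}" by auto
  qed (use d5 bk in auto)
  have xz: "sc m {x, z} \<le> - 2 \<and> \<not> rich {x, z}"
  proof (rule main)
    show "f' = m" if "f' \<in> {f1, f2, f3, k, m}" "{x, z} \<in> bd f'" for f'
      using that d5 by (elim insertE emptyE) (auto simp: bds bk bm doubleton_eq_iff)
    show "{x, z, a} = {a, x, z}" by auto
  qed (use d5 bm in auto)
  have "Sc k = sc k {a, c} + sc k {c, z} + sc k {a, z}" "Sc m = sc m {c, x} + sc m {x, z} + sc m {c, z}"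
    using Sc_T[OF k(1)] Sc_T[OF m(1)] .
  then have "sum Sc {f1, f2, f3, k, m} \<le> 0"
    using d hub_Sc[OF h] k(2) m(2) K(2,3) M(2,3) mk ax az xz
    by (simp add: sc_rich[OF rich3(1)] sc_rich[OF rich3(2)] sc_rich[OF rich3(3)])
  moreover have "closed_tri {f1, f2, f3, k, m}"
  proof (rule closed_triI)
    fix f e g assume f: "f \<in> {f1, f2, f3, k, m}" "e \<in> bd f" "g \<in> Tri" "e \<in> bd g"
    have g: "g \<in> FF" using f by (simp add: Tri_def)
    have F: "f1 \<in> FF" "f3 \<in> FF" "k \<in> FF" "m \<in> FF" using tr kT by (auto simp: Tri_def)
    have "bd f \<subseteq> {{a, b}, {b, c}, {b, x}} \<union> {{a, c}} \<union> {{c, x}} \<union> {{c, z}} \<union> {{a, x}, {a, z}, {x, z}}"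
      using f(1) by (elim insertE emptyE) (simp_all add: bds bk bm)
    from subsetD[OF this f(2)]
    have "e \<in> {{a, b}, {b, c}, {b, x}} \<or> e = {a, c} \<or> e = {c, x} \<or> e = {c, z} \<or> e \<in> {{a, x}, {a, z}, {x, z}}"
      by (simp only: Un_iff singleton_iff disj_assoc)
    then show "g \<in> {f1, f2, f3, k, m}"
    proof (elim disjE)
      assume "e \<in> {{a, b}, {b, c}, {b, x}}"
      then show ?thesis using hub_used[OF h g] f(4) by auto
    next
      assume "e = {a, c}"
      then show ?thesis using at_most_two[OF F(1,3) g, of e] k(2) f(4) bds bk by auto
    next
      assume "e = {c, x}"
      then show ?thesis using at_most_two[OF F(2,4) g, of e] m(2) f(4) bds bm by auto
    next
      assume "e = {c, z}"
      then show ?thesis using at_most_two[OF F(3,4) g, of e] mk f(4) bm bk by auto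
    next
      assume "e \<in> {{a, x}, {a, z}, {x, z}}"
      then have "\<not> rich e" using ax az xz by auto
      moreover have "f \<in> Tri" using f tr kT by auto
      ultimately have "g = f" using nonrich_unique f by blast
      then show ?thesis using f by simp
    qed
  qed (use tr kT in auto)
  moreover have "{f1, f2, f3, k, m} \<subseteq> U" if "closed_tri U" "U \<inter> {f1, f2, f3, k, m} \<noteq> {}" for U
  proof -
    have "f1 \<in> U \<longleftrightarrow> k \<in> U" "f3 \<in> U \<longleftrightarrow> m \<in> U"
      using closed_triD[OF that(1)] tr kT bds bk bm by (metis insertI1 insertI2)+
    then show ?thesis using that hub_connected[OF h that(1)] by auto
  qed
  ultimately show ?thesis unfolding block_def by blast
qed

lemma hub_outer_rich:
  assumes h: "hub b a c x f1 f2 f3" and r: "rich {a, c}"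
  obtains k z where "T k a c z" "k \<noteq> f1"
proof -
  have "f1 \<in> Tri" "{a, c} \<in> bd f1" using hub_tri[OF h] hub_edges[OF h] by auto
  then obtain k where "k \<in> Tri" "k \<noteq> f1" "{a, c} \<in> bd k" using rich_other r by metis
  then show ?thesis using third_vertex that by metis
qed

text \<open>By the number of rich outer edges. With three of them all apexes agree and six triangles
  would close up; one or two lead to the clusters above after renaming.\<close>

lemma hub_block:
  assumes h: "hub b a c x f1 f2 f3"
  shows "\<exists>K. {f1, f2, f3} \<subseteq> K \<and> block K"
proof -
  have one: "\<exists>K. {g1, g2, g3} \<subseteq> K \<and> block K"
    if H: "hub b u v w g1 g2 g3" and r: "rich {u, v}" "\<not> rich {u, w}" "\<not> rich {v, w}" for u v w g1 g2 g3
  proof -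
    obtain k z where "T k u v z" "k \<noteq> g1" using hub_outer_rich[OF H r(1)] .
    then show ?thesis using hub1_block[OF H _ _ r(2,3)] by blast
  qed
  have two: "\<exists>K. {g1, g2, g3} \<subseteq> K \<and> block K"
    if H: "hub b u v w g1 g2 g3" and r: "rich {u, v}" "rich {v, w}" "\<not> rich {u, w}" for u v w g1 g2 g3
  proof -
    have H': "hub b v w u g3 g1 g2" using hub_swap1 hub_swap2 H by blast
    obtain k z where k: "T k u v z" "k \<noteq> g1" using hub_outer_rich[OF H r(1)] .
    obtain m z' where m: "T m v w z'" "m \<noteq> g3" using hub_outer_rich[OF H' r(2)] .
    have z': "z' \<notin> {u, b, v, w}" using hub_outer_apex(1)[OF H' m] by blast
    have "z = z'" using hub_same_apex[OF H k(1) hub_outer_apex(1)[OF H k] m(1) z'] .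
    then have m': "T m v w z" using m(1) by simp
    show ?thesis using hub2_block[OF H k m' m(2) r(3)] by (intro exI conjI) auto
  qed
  have three: False if r: "rich {a, c}" "rich {c, x}" "rich {a, x}"
  proof -
    have h': "hub b c x a f3 f1 f2" "hub b a x c f2 f1 f3" "hub b c a x f1 f3 f2" using hub_swap1 hub_swap2 h by blast+
    obtain k z where k: "T k a c z" "k \<noteq> f1" using hub_outer_rich[OF h r(1)] .
    obtain m z' where m: "T m c x z'" "m \<noteq> f3" using hub_outer_rich[OF h'(1) r(2)] .
    obtain g z'' where g: "T g a x z''" "g \<noteq> f2" using hub_outer_rich[OF h'(2) r(3)] .
    note K = hub_outer_apex[OF h k] and M = hub_outer_apex[OF h'(1) m] and L = hub_outer_apex[OF h'(2) g]
    have "z = z'" using hub_same_apex[OF h k(1) _ m(1)] K(1) M(1) by auto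
    moreover have "z = z''" using hub_same_apex[OF h'(3) T_perms(3)[OF k(1)] _ g(1)] K(1) L(1) by auto
    ultimately show False using hub2_closed6[OF h k _ m(2) T_FF[OF g(1)] g(2)] m(1) T_bd[OF g(1)] by simp
  qed
  have hs: "hub b c a x f1 f3 f2" "hub b a x c f2 f1 f3" "hub b x a c f2 f3 f1" "hub b c x a f3 f1 f2" "hub b x c a f3 f2 f1"
    using hub_swap1 hub_swap2 h by blast+
  note R = insert_commute[of x a "{}"] insert_commute[of c a "{}"] insert_commute[of x c "{}"]
  have perm: "{f2, f1, f3} = {f1, f2, f3}" "{f3, f1, f2} = {f1, f2, f3}" "{f1, f3, f2} = {f1, f2, f3}" by auto
  show ?thesis
  proof (cases "rich {a, c}"; cases "rich {c, x}"; cases "rich {a, x}")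
    assume "\<not> rich {a, c}" "\<not> rich {c, x}" "\<not> rich {a, x}"
    then show ?thesis using hub0_block[OF h] by blast
  next
    assume "rich {a, c}" "rich {c, x}" "rich {a, x}"
    then show ?thesis using three by blast
  next
    assume "rich {a, c}" "\<not> rich {c, x}" "\<not> rich {a, x}"
    then show ?thesis using one[OF h] by blast
  next
    assume "\<not> rich {a, c}" "rich {c, x}" "\<not> rich {a, x}"
    then show ?thesis using one[OF hs(4)] unfolding R perm by blast
  next
    assume "\<not> rich {a, c}" "\<not> rich {c, x}" "rich {a, x}"
    then show ?thesis using one[OF hs(2)] unfolding R perm by blast
  next
    assume "rich {a, c}" "rich {c, x}" "\<not> rich {a, x}"
    then show ?thesis using two[OF h] by blast
  next
    assume "rich {a, c}" "\<not> rich {c, x}" "rich {a, x}"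
    then show ?thesis using two[OF hs(1)] unfolding R perm by blast
  next
    assume "\<not> rich {a, c}" "rich {c, x}" "rich {a, x}"
    then show ?thesis using two[OF hs(2)] unfolding R perm by blast
  qed
qed

section \<open>Wheels and the remaining triangles\<close>

text \<open>A second triangle \<open>b x w\<close> with a new apex gives the 5-cycle
  \<open>b x y c a\<close> with \<open>w\<close> joined to \<open>b\<close> and \<open>x\<close>.
  For \<open>w = y\<close> the wheel around \<open>b\<close> with rim \<open>a c y x\<close> is
  complete, and together with \<open>g\<close> it closes up.\<close>

lemma wheel_spoke_nonrich:
  assumes f: "T f a b c" and f': "T f' a b x" "f' \<noteq> f" and f'': "T f'' b c y" "f'' \<noteq> f"
    and d: "distinct [a, b, c, x, y]" and g: "g \<in> FF" "bd g = {{a, c}, {c, y}, {x, y}, {a, x}}"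
  shows "\<not> rich {b, x}"
proof
  assume r: "rich {b, x}"
  note bf = T_bd[OF f] T_bd[OF f'(1)] T_bd[OF f''(1)]
  have tri: "f \<in> Tri" "f' \<in> Tri" "f'' \<in> Tri" using T_Tri f f'(1) f''(1) by auto
  have F: "f \<in> FF" "f' \<in> FF" "f'' \<in> FF" using tri by (auto simp: Tri_def)
  obtain m where m: "m \<in> Tri" "m \<noteq> f'" "{b, x} \<in> bd m"
    using rich_other[OF r tri(2)] bf(2) by auto
  obtain w where w: "T m b x w" using third_vertex[OF m(1,3)] .
  note we = T_edges[OF w]
  have mF: "m \<in> FF" using m by (simp add: Tri_def)
  have "{b, x} \<notin> bd f" "{b, x} \<notin> bd f''" "{a, b} \<notin> bd f''" "{a, b} \<notin> bd g" "{b, c} \<notin> bd g"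
    using d unfolding bf g(2) by (auto simp: doubleton_eq_iff)
  moreover have "{a, b} \<in> bd f" "{a, b} \<in> bd f'" "{b, c} \<in> bd f''" by (simp_all add: bf)
  ultimately have n: "m \<noteq> f" "m \<noteq> f''" "f' \<noteq> f''" "g \<noteq> f" "g \<noteq> f'" "g \<noteq> f''"
    using m(3) by metis+
  have "w \<noteq> a"
    using at_most_two[OF F(1,2) mF, of "{a, b}"] bf f'(2) n m(2) we by auto
  moreover have "w \<noteq> c"
    using at_most_two[OF F(1,3) mF, of "{b, c}"] bf f''(2) n we by auto
  moreover have "w \<noteq> y"
  proof
    assume "w = y"
    then have bm: "bd m = {{b, x}, {x, y}, {b, y}}" using T_bd[OF w] by simp
    have "{b, x} \<notin> bd g" using d unfolding g(2) by (auto simp: doubleton_eq_iff)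
    then have gm: "g \<noteq> m" using m by auto
    show False
    proof (rule small_closed_edges[of "{f, f', f'', m, g}"
          "{{a, b}, {b, c}, {a, c}, {b, x}, {a, x}, {b, y}, {c, y}, {x, y}}" "{a, b, c, x, y}"])
      show "{f, f', f'', m, g} \<subseteq> FF" using F mF g by auto
      show "bd k \<subseteq> {{a, b}, {b, c}, {a, c}, {b, x}, {a, x}, {b, y}, {c, y}, {x, y}}" if "k \<in> {f, f', f'', m, g}" for k
        using that by (elim insertE emptyE) (simp_all add: bf bm g(2))
      show "\<forall>e\<in>{{a, b}, {b, c}, {a, c}, {b, x}, {a, x}, {b, y}, {c, y}, {x, y}}.
          \<exists>g'\<in>{f, f', f'', m, g}. \<exists>g''\<in>{f, f', f'', m, g}. g' \<noteq> g'' \<and> e \<in> bd g' \<and> e \<in> bd g''"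
        using n f'(2) f''(2) m(2) gm by (simp add: bf bm g(2))
      show "card {a, b, c, x, y} \<le> 5" by (simp add: card_insert_if)
    qed auto
  qed
  ultimately have "distinct [b, x, y, c, a, w]" using d w by (auto simp: T_def)
  moreover have "adj x y" "adj c y" using bdE[OF g(1)] g(2) by auto
  ultimately show False using theta[of b x y c a w] T_adj[OF w] T_adj[OF f] T_adj[OF f'(1)]
    by (simp add: insert_commute)
qed

text \<open>Forbidden 5-cycles force both \<open>x\<close> and \<open>y\<close> onto the 4-face at
  \<open>{a, c}\<close>, in the order \<open>a c y x\<close>, because the other order completes a
  \<open>K\<^sub>5\<close>. Then only \<open>{a, b}\<close> and \<open>{b, c}\<close> are rich in
  the three triangles, and the total is at most 1/2 - 1/2 - 1/2.\<close>

lemma wheel_block: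
  assumes f: "T f a b c" and f': "T f' a b x" "f' \<noteq> f" and f'': "T f'' b c y" "f'' \<noteq> f" and xy: "x \<noteq> y"
    and g: "g \<in> FF" "{a, c} \<in> bd g" "card (bd g) = 4"
  shows "block {f, f', f''}"
proof -
  note bf = T_bd[OF f] T_bd[OF f'(1)] T_bd[OF f''(1)]
  have tri: "f \<in> Tri" "f' \<in> Tri" "f'' \<in> Tri" using T_Tri f f'(1) f''(1) by auto
  have F: "f \<in> FF" "f' \<in> FF" "f'' \<in> FF" using tri by (auto simp: Tri_def)
  have gn: "g \<noteq> f" "g \<noteq> f'" "g \<noteq> f''" using tri g(3) by (auto simp: Tri_def)
  have dd: "distinct [a, b, c]" "a \<noteq> x" "b \<noteq> x" "b \<noteq> y" "c \<noteq> y" using f f'(1) f''(1) by (auto simp: T_def)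
  have acF: "{a, c} \<notin> bd f'" "{a, c} \<notin> bd f''"
    using at_most_two[OF F(1) g(1) F(2), of "{a, c}"] at_most_two[OF F(1) g(1) F(3), of "{a, c}"] bf g(2) gn f'(2) f''(2)
    by auto
  have "x \<noteq> c" "y \<noteq> a" using acF bf by (auto simp: insert_commute)
  then have d: "distinct [a, b, c, x, y]" using dd xy by auto
  obtain p q where pq: "distinct [a, c, p, q]" "bd g = {{a, c}, {c, p}, {p, q}, {q, a}}"
    using four_face[OF g(1,3,2)] .
  have ad: "adj c p" "adj p q" "adj q a" using bdE[OF g(1)] pq(2) by auto
  note A = T_adj[OF f] T_adj[OF f'(1)] T_adj[OF f''(1)]
  have "{a, b} \<notin> bd g" "{b, c} \<notin> bd g"
    using at_most_two[OF F(1,2) g(1), of "{a, b}"] at_most_two[OF F(1,3) g(1), of "{b, c}"] bf gn f'(2) f''(2) by auto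
  then have "b \<noteq> p" "b \<noteq> q" using pq(2) by (auto simp: insert_commute)
  have "x \<in> {p, q}"
  proof (rule ccontr)
    assume "x \<notin> {p, q}"
    then have "distinct [a, b, c, p, q, x]" using d pq(1) \<open>b \<noteq> p\<close> \<open>b \<noteq> q\<close> by auto
    from theta[OF this] show False using A ad by blast
  qed
  moreover have "y \<in> {p, q}"
  proof (rule ccontr)
    assume "y \<notin> {p, q}"
    then have "distinct [b, c, p, q, a, y]" using d pq(1) \<open>b \<noteq> p\<close> \<open>b \<noteq> q\<close> by auto
    from theta[OF this] show False using A ad by blast
  qed
  ultimately have "p = x \<and> q = y \<or> p = y \<and> q = x" using xy by auto
  moreover have False if "p = x" "q = y"
    using noK5[of a b c x y] d A ad that by (auto simp: insert_commute)
  ultimately have "p = y" "q = x" by auto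
  then have gb: "bd g = {{a, c}, {c, y}, {x, y}, {a, x}}" using pq(2) by (auto simp: insert_commute)
  then have gb': "bd g = {{c, a}, {a, x}, {y, x}, {c, y}}" by (auto simp: insert_commute)
  have nr1: "\<not> rich {b, x}" using wheel_spoke_nonrich[OF f f' f'' d g(1) gb] .
  have nr2: "\<not> rich {b, y}"
    using wheel_spoke_nonrich[OF T_perms(5)[OF f] T_perms(3)[OF f''(1)] f''(2) T_perms(3)[OF f'(1)] f'(2) _ g(1) gb'] d by auto
  have nrg: "\<not> rich e" if "e \<in> bd g" "h \<in> FF" "h \<in> Tri" "e \<in> bd h" for e h
  proof
    assume "rich e"
    from rich_other[OF this that(3,4)] obtain h' where h': "h' \<in> Tri" "h' \<noteq> h" "e \<in> bd h'" .
    then show False using at_most_two[of h h' g e] that g by (auto simp: Tri_def)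
  qed
  have nr3: "\<not> rich {a, c}" "\<not> rich {a, x}" "\<not> rich {c, y}"
    using nrg[of "{a, c}" f] nrg[of "{a, x}" f'] nrg[of "{c, y}" f''] gb bf F tri by auto
  have "{a, b} \<notin> bd f''" using d unfolding bf by (auto simp: doubleton_eq_iff)
  moreover have "{a, b} \<in> bd f'" by (simp add: bf)
  ultimately have n: "f' \<noteq> f''" by metis
  have r: "rich {a, b}" "rich {b, c}" using tri f'(2) f''(2) bf unfolding rich_def by (metis insertI1 insertI2)+
  have le: "sc f {a, c} \<le> -1/2" "sc f' {b, x} \<le> -1/2" "sc f' {a, x} \<le> -1/2" "sc f'' {c, y} \<le> -1/2" "sc f'' {b, y} \<le> -1/2"
    using sc_le_half[OF tri(1) _ nr3(1)] sc_le_half[OF tri(2) _ nr1] sc_le_half[OF tri(2) _ nr3(2)]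
      sc_le_half[OF tri(3) _ nr3(3)] sc_le_half[OF tri(3) _ nr2]
    by (simp_all add: bf)
  have "sum Sc {f, f', f''} \<le> 0"
    using Sc_T[OF f] Sc_T[OF f'(1)] Sc_T[OF f''(1)] le f'(2) f''(2) n
    by (simp add: sc_rich[OF r(1)] sc_rich[OF r(2)])
  moreover have "closed_tri {f, f', f''}"
  proof (rule closed_triI)
    fix h e k assume h: "h \<in> {f, f', f''}" "e \<in> bd h" "k \<in> Tri" "e \<in> bd k"
    have k: "k \<in> FF" using h by (simp add: Tri_def)
    have "bd h \<subseteq> {{a, b}} \<union> {{b, c}} \<union> {{a, c}, {b, x}, {a, x}, {b, y}, {c, y}}"
      using h(1) by (elim insertE emptyE) (simp_all add: bf)
    from subsetD[OF this h(2)]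
    have "e = {a, b} \<or> e = {b, c} \<or> e \<in> {{a, c}, {b, x}, {a, x}, {b, y}, {c, y}}"
      by (simp only: Un_iff singleton_iff disj_assoc)
    then show "k \<in> {f, f', f''}"
    proof (elim disjE)
      assume "e = {a, b}"
      then show ?thesis using at_most_two[OF F(1,2) k, of e] f'(2) h(4) bf by auto
    next
      assume "e = {b, c}"
      then show ?thesis using at_most_two[OF F(1,3) k, of e] f''(2) h(4) bf by auto
    next
      assume "e \<in> {{a, c}, {b, x}, {a, x}, {b, y}, {c, y}}"
      then have "\<not> rich e" using nr1 nr2 nr3 by auto
      moreover have "h \<in> Tri" using h tri by auto
      ultimately have "k = h" using nonrich_unique h by blast
      then show ?thesis using h by simp
    qed
  qed (use tri in auto)
  moreover have "{f, f', f''} \<subseteq> U" if "closed_tri U" "U \<inter> {f, f', f''} \<noteq> {}" for U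
  proof -
    have "f \<in> U \<longleftrightarrow> f' \<in> U" "f \<in> U \<longleftrightarrow> f'' \<in> U"
      using closed_triD[OF that(1)] tri bf by (metis insertI1 insertI2)+
    then show ?thesis using that by auto
  qed
  ultimately show ?thesis unfolding block_def by blast
qed

text \<open>Two faces with the same three edges would close up on three vertices.\<close>

lemma two_triangles_distinct:
  assumes f: "T f a b c" and g: "T g a b x" "g \<noteq> f"
  shows "x \<noteq> c"
proof
  assume "x = c"
  then have b: "bd f = {{a, b}, {b, c}, {a, c}}" "bd g = {{a, b}, {b, c}, {a, c}}" using T_bd f g by auto
  show False
    by (rule small_closed_edges[of "{f, g}" "{{a, b}, {b, c}, {a, c}}" "{a, b, c}"])
      (use T_FF[OF f] T_FF[OF g(1)] b g(2) in \<open>auto simp: card_insert_if\<close>)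
qed

text \<open>A positive charge leaves more than -1 on \<open>{a, c}\<close>, which only a 4-face
  beyond this edge permits. Equal apexes over the rich edges give a hub, different ones a
  wheel.\<close>

lemma two_rich_block:
  assumes f: "T f a b c" and r: "rich {a, b}" "rich {b, c}" "\<not> rich {a, c}" and pos: "0 < Sc f"
  shows "\<exists>K. f \<in> K \<and> block K"
proof -
  note bf = T_bd[OF f]
  have fT: "f \<in> Tri" using T_Tri f by auto
  obtain f' where f': "f' \<in> Tri" "f' \<noteq> f" "{a, b} \<in> bd f'" using rich_other[OF r(1) fT] bf by auto
  obtain f'' where f'': "f'' \<in> Tri" "f'' \<noteq> f" "{b, c} \<in> bd f''" using rich_other[OF r(2) fT] bf by auto
  obtain x where x: "T f' a b x" using third_vertex[OF f'(1,3)] .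
  obtain y where y: "T f'' b c y" using third_vertex[OF f''(1,3)] .
  have xc: "x \<noteq> c" using two_triangles_distinct[OF f x f'(2)] .
  have "sc f {a, c} > - 1"
    using pos Sc_T[OF f] by (simp add: sc_rich[OF r(1)] sc_rich[OF r(2)])
  then have "\<not> sc f {a, c} \<le> - 7 / 5" by simp
  moreover have "{a, c} \<in> bd f" using bf by simp
  ultimately obtain g where g: "g \<in> FF" "{a, c} \<in> bd g" "card (bd g) = 4"
    using sc_le_75[OF fT _ r(3)] by blast
  show ?thesis
  proof (cases "x = y")
    case True
    then have "T f'' c b x" using T_perms[OF y] by simp
    moreover have "distinct [a, b, c, x]" using f x y xc True by (auto simp: T_def)
    ultimately have "hub b a c x f f' f''" unfolding hub_def using f x by blast
    from hub_block[OF this] obtain K where "{f, f', f''} \<subseteq> K" "block K" by blast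
    then show ?thesis by (intro exI[of _ K]) simp
  next
    case False
    then show ?thesis using wheel_block[OF f x f'(2) y f''(2) False g] by blast
  qed
qed

text \<open>If the three apexes differ, \<open>a b y c z\<close> is a 5-cycle and \<open>x\<close>
  is joined to \<open>a\<close> and \<open>b\<close>. So two apexes agree and make a hub.\<close>

lemma three_rich_block:
  assumes f: "T f a b c" and r: "rich {a, b}" "rich {b, c}" "rich {a, c}"
  shows "\<exists>K. f \<in> K \<and> block K"
proof -
  note bf = T_bd[OF f]
  have fT: "f \<in> Tri" using T_Tri f by auto
  obtain f1 where f1: "f1 \<in> Tri" "f1 \<noteq> f" "{a, b} \<in> bd f1" using rich_other[OF r(1) fT] bf by auto
  obtain f2 where f2: "f2 \<in> Tri" "f2 \<noteq> f" "{b, c} \<in> bd f2" using rich_other[OF r(2) fT] bf by auto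
  obtain f3 where f3: "f3 \<in> Tri" "f3 \<noteq> f" "{a, c} \<in> bd f3" using rich_other[OF r(3) fT] bf by auto
  obtain x where x: "T f1 a b x" using third_vertex[OF f1(1,3)] .
  obtain y where y: "T f2 b c y" using third_vertex[OF f2(1,3)] .
  obtain z where z: "T f3 a c z" using third_vertex[OF f3(1,3)] .
  have n: "x \<noteq> c" "y \<noteq> a" "z \<noteq> b"
    using two_triangles_distinct[OF f x f1(2)] two_triangles_distinct[OF T_perms(1)[OF f] y f2(2)]
      two_triangles_distinct[OF T_perms(4)[OF f] z f3(2)] .
  have dd: "distinct [a, b, c]" "x \<notin> {a, b}" "y \<notin> {b, c}" "z \<notin> {a, c}" using f x y z by (auto simp: T_def)
  have hubI: "\<exists>K. f \<in> K \<and> block K" if "T f v u w" "T g v u s" "T h w u s" "distinct [v, u, w, s]" for u v w s g h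
  proof -
    have "hub u v w s f g h" unfolding hub_def using that by blast
    from hub_block[OF this] obtain K where "{f, g, h} \<subseteq> K" "block K" by blast
    then show ?thesis by (intro exI[of _ K]) simp
  qed
  consider "x = y" | "y = z" | "x = z" | "distinct [x, y, z]" by auto
  then show ?thesis
  proof cases
    case 1
    show ?thesis
      by (rule hubI[of a b c f1 x f2]) (use f x T_perms[OF y] 1 n dd in auto)
  next
    case 2
    show ?thesis
      by (rule hubI[of b c a f2 y f3]) (use T_perms[OF f] y T_perms[OF z] z 2 n dd in auto)
  next
    case 3
    show ?thesis
      by (rule hubI[of b a c f1 x f3]) (use T_perms[OF f] T_perms[OF x] T_perms[OF z] 3 n dd in auto)
  next
    case 4
    have "distinct [a, b, y, c, z, x]" using 4 n dd by auto
    from theta[OF this] show ?thesis using T_adj[OF f] T_adj[OF x] T_adj[OF y] T_adj[OF z] by blast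
  qed
qed

text \<open>With at most one rich edge the charge is at most 1/2 - 1/2 - 1/2, so at least two edges
  are rich.\<close>

lemma positive_block:
  assumes "f \<in> Tri" "0 < Sc f"
  shows "\<exists>K. f \<in> K \<and> block K"
proof -
  obtain a b c where f: "T f a b c" using Tri_T[OF assms(1)] .
  note bf = T_bd[OF f] and p = T_perms[OF f]
  have le: "sc f e \<le> (if rich e then 1 / 2 else - 1 / 2)" if "e \<in> bd f" for e
    using sc_le_half[OF assms(1) that] sc_rich by (cases "rich e") (auto simp: sc_def)
  have S: "Sc f = sc f {a, b} + sc f {b, c} + sc f {a, c}" using Sc_T[OF f] .
  have l3: "sc f {a, b} \<le> (if rich {a, b} then 1 / 2 else - 1 / 2)" "sc f {b, c} \<le> (if rich {b, c} then 1 / 2 else - 1 / 2)"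
    "sc f {a, c} \<le> (if rich {a, c} then 1 / 2 else - 1 / 2)"
    using le bf by auto
  consider "rich {a, b}" "rich {b, c}" "rich {a, c}" | "rich {a, b}" "rich {b, c}" "\<not> rich {a, c}"
    | "rich {a, b}" "\<not> rich {b, c}" "rich {a, c}" | "\<not> rich {a, b}" "rich {b, c}" "rich {a, c}"
    using assms(2) l3 unfolding S by (cases "rich {a, b}"; cases "rich {b, c}"; cases "rich {a, c}") auto
  then show ?thesis
  proof cases
    case 1 then show ?thesis using three_rich_block[OF f] by blast
  next
    case 2 then show ?thesis using two_rich_block[OF f] assms by blast
  next
    case 3
    have R: "rich {b, a}" using 3 by (simp add: insert_commute)
    show ?thesis using two_rich_block[OF p(3) R] 3 assms by blast
  next
    case 4
    have R: "rich {c, b}" "\<not> rich {a, b}" "rich {a, c}" using 4 by (simp_all add: insert_commute)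
    show ?thesis using two_rich_block[OF p(4)] R assms by blast
  qed
qed

lemma face_bound: "18 * real (card FF) \<le> 11 * real (card (edges G))"
  using discharging positive_block by blast

end

section \<open>The upper bound\<close>

lemma simple_graph_card_edges:
  assumes "simple_graph G"
  shows "finite (edges G)" "card (edges G) \<le> card (vertices G) choose 2"
proof -
  have fin: "finite (vertices G)" using assms by (simp add: simple_graph_def)
  have sub: "edges G \<subseteq> {e. e \<subseteq> vertices G \<and> card e = 2}" using assms by (auto simp: simple_graph_def)
  have "finite {e. e \<subseteq> vertices G \<and> card e = 2}" using fin by simp
  then show "finite (edges G)" using sub by (rule rev_finite_subset)
  show "card (edges G) \<le> card (vertices G) choose 2"
    using card_mono[OF \<open>finite {e. e \<subseteq> vertices G \<and> card e = 2}\<close> sub] n_subsets[OF fin, of 2] by simp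
qed

lemma planar_subgraph:
  assumes "planar G" "V \<subseteq> vertices G" "E \<subseteq> edges G" "\<And>e. e \<in> E \<Longrightarrow> e \<subseteq> V"
  shows "planar (V, E)"
proof -
  obtain p \<gamma> where d: "plane_drawing G p \<gamma>" using assms(1) by (auto simp: planar_def)
  have "plane_drawing (V, E) p \<gamma>"
    unfolding plane_drawing_def fst_conv snd_conv
  proof (intro conjI ballI impI)
    have "inj_on p (vertices G)" using d by (simp add: plane_drawing_def)
    then show "inj_on p V" using assms(2) by (rule inj_on_subset)
    fix e assume e: "e \<in> E"
    then have eG: "e \<in> edges G" using assms(3) by auto
    have D: "arc (\<gamma> e)" "{pathstart (\<gamma> e), pathfinish (\<gamma> e)} = p ` e"
      "path_image (\<gamma> e) \<inter> p ` vertices G = p ` e"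
      using d eG unfolding plane_drawing_def by auto
    show "arc (\<gamma> e)" "{pathstart (\<gamma> e), pathfinish (\<gamma> e)} = p ` e" by (rule D)+
    have "p ` e \<subseteq> p ` V" using assms(4)[OF e] by (rule image_mono)
    then show "path_image (\<gamma> e) \<inter> p ` V = p ` e" using D(3) assms(2) by blast
    fix e' assume "e' \<in> E" "e \<noteq> e'"
    then show "path_image (\<gamma> e) \<inter> path_image (\<gamma> e') = p ` (e \<inter> e')"
      using d eG assms(3) unfolding plane_drawing_def by blast
  qed
  then show ?thesis by (auto simp: planar_def)
qed

lemma contains_theta:
  assumes d: "distinct [a, b, c, d, e, w]" and E: "{a, b} \<in> edges G" "{b, c} \<in> edges G"
      "{c, d} \<in> edges G" "{d, e} \<in> edges G" "{e, a} \<in> edges G" "{w, a} \<in> edges G" "{w, b} \<in> edges G"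
    and G: "simple_graph G"
  shows "contains_subgraph G Theta_6_2"
proof -
  \<comment> \<open>The 6-cycle is \<open>a w b c d e\<close>, and its chord \<open>{1, 3}\<close>
    becomes \<open>{a, b}\<close>.\<close>
  define xs where "xs = [a, w, b, c, d, e]"
  define f where "f = (\<lambda>i::nat. xs ! (i - 1))"
  have "f \<in> edges G \<Longrightarrow> f \<subseteq> vertices G" for f using G by (simp add: simple_graph_def)
  from this[OF E(1)] this[OF E(3)] this[OF E(5)] this[OF E(6)]
  have v: "{a, b, c, d, e, w} \<subseteq> vertices G" by simp
  have S: "{1..6} = {1, 2, 3, 4, 5, 6::nat}" by auto
  have F: "f 1 = a" "f (Suc 0) = a" "f 2 = w" "f 3 = b" "f 4 = c" "f 5 = d" "f 6 = e"
    by (simp_all add: f_def xs_def numeral_eq_Suc)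
  have "inj_on f {1..6}" unfolding S using d by (auto simp: inj_on_def F)
  moreover have "f ` {1..6} \<subseteq> vertices G" unfolding S using v by (auto simp: F)
  moreover have "\<forall>e\<in>edges Theta_6_2. f ` e \<in> edges G"
    unfolding Theta_6_2_def using E by (simp add: F insert_commute)
  ultimately show ?thesis unfolding contains_subgraph_def Theta_6_2_def by auto
qed

lemma face_system_edge_sum:
  assumes fs: "face_system G FF bd" and G: "simple_graph G"
  shows "(\<Sum>f\<in>FF. card (bd f)) = 2 * card (edges G)"
proof -
  have fin: "finite FF" "finite (edges G)" using fs simple_graph_card_edges[OF G] by (auto simp: face_system_def)
  have sub: "bd f \<subseteq> edges G" if "f \<in> FF" for f using fs that by (auto simp: face_system_def)
  have "(\<Sum>f\<in>FF. card (bd f)) = (\<Sum>f\<in>FF. \<Sum>e\<in>{e\<in>edges G. e \<in> bd f}. 1)"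
  proof (intro sum.cong refl)
    fix f assume "f \<in> FF"
    then have "bd f = {e\<in>edges G. e \<in> bd f}" using sub by blast
    then show "card (bd f) = (\<Sum>e\<in>{e\<in>edges G. e \<in> bd f}. 1)" by simp
  qed
  also have "\<dots> = (\<Sum>e\<in>edges G. \<Sum>f\<in>{f\<in>FF. e \<in> bd f}. 1)"
    using fin by (intro sum.swap_restrict) auto
  also have "\<dots> = (\<Sum>e\<in>edges G. 2)" using fs by (intro sum.cong) (auto simp: face_system_def)
  finally show ?thesis by simp
qed

text \<open>From six vertices on, discharging and Euler's formula; for five, faces of length at
  least 3 and Euler's formula allow nine edges; below five, counting pairs is enough.
  \<open>noK5\<close> enters as a hypothesis because it concerns subgraphs, about which the face
  system of \<open>G\<close> says nothing directly.\<close>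

lemma nonseparable_bound:
  fixes G :: "'a ugraph"
  assumes G: "simple_graph G" "planar G" "\<not> separable G" and n: "card (vertices G) = n" "2 \<le> n"
    and free: "\<not> contains_subgraph G Theta_6_2"
    and noK5: "\<And>S. S \<subseteq> vertices G \<Longrightarrow> card S = 5 \<Longrightarrow> 6 \<le> n \<Longrightarrow> card {e\<in>edges G. e \<subseteq> S} \<le> 9"
  shows "7 * card (edges G) + 36 \<le> 18 * n + (if n \<le> 5 then 9 else 0)"
proof -
  have ch: "card (edges G) \<le> n choose 2" using simple_graph_card_edges[OF G(1)] n by simp
  consider "n = 2" | "n = 3" | "n = 4" | "n = 5" | "6 \<le> n" using n(2) by linarith
  then show ?thesis
  proof cases
    case 4
    have "3 \<le> card (vertices G)" using n 4 by simp
    from planar_face_system[OF G this] obtain FF :: "(complex set \<times> 'a set set) set" where FF: "face_system G FF snd"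
      and "\<Union>(edges G) = vertices G" .
    have "3 \<le> card (snd f)" if "f \<in> FF" for f
      using FF that cycle_card_Union[of "snd f"] by (auto simp: face_system_def)
    then have "(\<Sum>f\<in>FF. 3) \<le> (\<Sum>f\<in>FF. card (snd f))" by (intro sum_mono)
    then have "3 * card FF \<le> 2 * card (edges G)" using face_system_edge_sum[OF FF G(1)] by simp
    moreover have "card FF + 5 = card (edges G) + 2" using FF n 4 by (simp add: face_system_def)
    ultimately have "card (edges G) \<le> 9" by simp
    then show ?thesis using 4 by simp
  next
    case 5
    then have "3 \<le> card (vertices G)" using n by simp
    from planar_face_system[OF G this] obtain FF :: "(complex set \<times> 'a set set) set" where FF: "face_system G FF snd" "\<Union>(edges G) = vertices G" .
    interpret theta_free_faces G FF snd
    proof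
      show "6 \<le> card (vertices G)" using 5 n by simp
      fix a b c d e assume ds: "distinct [a, b, c, d, e]"
        and E: "{a, b} \<in> edges G" "{a, c} \<in> edges G" "{a, d} \<in> edges G" "{a, e} \<in> edges G" "{b, c} \<in> edges G"
          "{b, d} \<in> edges G" "{b, e} \<in> edges G" "{c, d} \<in> edges G" "{c, e} \<in> edges G" "{d, e} \<in> edges G"
      have "f \<in> edges G \<Longrightarrow> f \<subseteq> vertices G" for f using G(1) by (simp add: simple_graph_def)
      from this[OF E(1)] this[OF E(8)] this[OF E(10)]
      have S: "{a, b, c, d, e} \<subseteq> vertices G" by simp
      have "card {a, b, c, d, e} = 5" using ds by simp
      from noK5[OF S this 5] have le: "card {f\<in>edges G. f \<subseteq> {a, b, c, d, e}} \<le> 9" .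
      let ?K = "{{a, b}, {a, c}, {a, d}, {a, e}, {b, c}, {b, d}, {b, e}, {c, d}, {c, e}, {d, e}}"
      have "card ?K = 10" using ds by (simp add: card_insert_if doubleton_eq_iff)
      moreover have "card ?K \<le> card {f\<in>edges G. f \<subseteq> {a, b, c, d, e}}"
        using simple_graph_card_edges(1)[OF G(1)] E by (intro card_mono) auto
      ultimately show False using le by simp
    next
      fix a b c d e w
      assume "distinct [a, b, c, d, e, w]" "{a, b} \<in> edges G" "{b, c} \<in> edges G" "{c, d} \<in> edges G"
        "{d, e} \<in> edges G" "{e, a} \<in> edges G" "{w, a} \<in> edges G" "{w, b} \<in> edges G"
      then show False using contains_theta[of a b c d e w G] free G(1) by blast
    qed (use G FF in auto)
    have "18 * real (card FF) \<le> 11 * real (card (edges G))" by (rule face_bound)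
    then have "18 * card FF \<le> 11 * card (edges G)" by linarith
    moreover have "card FF + n = card (edges G) + 2" using FF n by (simp add: face_system_def)
    ultimately show ?thesis using 5 by simp
  qed (use ch in \<open>auto simp: choose_two\<close>)
qed

lemma contains_subgraph_mono:
  assumes "contains_subgraph G H" "vertices G \<subseteq> vertices G'" "edges G \<subseteq> edges G'"
  shows "contains_subgraph G' H"
  using assms unfolding contains_subgraph_def by blast

text \<open>The excess 9 is the least that admits nine edges on five vertices. Two excesses are
  still absorbed at a common vertex, since 18 (n + 1) - 72 + 18 = 18 n - 36.\<close>

lemma planar_theta_bound:
  fixes G :: "'a ugraph"
  assumes "simple_graph G" "planar G" "\<not> contains_subgraph G Theta_6_2" "card (vertices G) = n" "2 \<le> n"
  shows "7 * card (edges G) + 36 \<le> 18 * n + (if n \<le> 5 then 9 else 0)"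
  using assms
proof (induction n arbitrary: G rule: less_induct)
  case (less n)
  have fin: "finite (vertices G)" using less.prems by (simp add: simple_graph_def)
  let ?ind = "\<lambda>V. (V, {e\<in>edges G. e \<subseteq> V})"
  have sub: "7 * card {e\<in>edges G. e \<subseteq> V} + 36 \<le> 18 * card V + (if card V \<le> 5 then 9 else 0)"
    if V: "V \<subseteq> vertices G" "card V < n" "2 \<le> card V" for V
  proof -
    have "simple_graph (?ind V)"
      using less.prems(1) finite_subset[OF V(1) fin] by (simp add: simple_graph_def)
    moreover have "planar (?ind V)" by (rule planar_subgraph[OF less.prems(2) V(1)]) auto
    moreover have "\<not> contains_subgraph (?ind V) Theta_6_2"
      using contains_subgraph_mono[of "?ind V" Theta_6_2 G] less.prems(3) V(1) by auto
    ultimately show ?thesis using less.IH[OF V(2), of "?ind V"] V(3) by simp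
  qed
  show ?case
  proof (cases "separable G")
    case True
    then obtain V1 V2 where V: "vertices G = V1 \<union> V2" "card (V1 \<inter> V2) \<le> 1" "2 \<le> card V1" "2 \<le> card V2"
      "V1 \<noteq> vertices G" "V2 \<noteq> vertices G" "\<forall>e\<in>edges G. e \<subseteq> V1 \<or> e \<subseteq> V2"
      unfolding separable_def by blast
    have lt: "card V1 < n" "card V2 < n"
      using psubset_card_mono[OF fin, of V1] psubset_card_mono[OF fin, of V2] V(1,5,6) less.prems(4) by auto
    have finV: "finite V1" "finite V2" using fin V(1) by auto
    have "card V1 + card V2 \<le> n + 1"
      using card_Un_Int[OF finV] V(1,2) less.prems(4) by simp
    moreover have "{e\<in>edges G. e \<subseteq> V1} \<union> {e\<in>edges G. e \<subseteq> V2} = edges G" using V(7) by blast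
    then have "card (edges G) \<le> card {e\<in>edges G. e \<subseteq> V1} + card {e\<in>edges G. e \<subseteq> V2}"
      using card_Un_le[of "{e\<in>edges G. e \<subseteq> V1}" "{e\<in>edges G. e \<subseteq> V2}"] by argo
    moreover have "7 * card {e\<in>edges G. e \<subseteq> V1} + 36 \<le> 18 * card V1 + 9"
      using sub[OF _ lt(1) V(3)] V(1) by (simp split: if_splits)
    moreover have "7 * card {e\<in>edges G. e \<subseteq> V2} + 36 \<le> 18 * card V2 + 9"
      using sub[OF _ lt(2) V(4)] V(1) by (simp split: if_splits)
    ultimately show ?thesis by simp
  next
    case False
    show ?thesis
    proof (rule nonseparable_bound[OF less.prems(1,2) False less.prems(4,5,3)])
      fix S assume S: "S \<subseteq> vertices G" "card S = 5" "6 \<le> n"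
      \<comment> \<open>For five vertices the induction hypothesis is
        \<open>7 e + 36 \<le> 99\<close>, that is, at most nine edges.\<close>
      then show "card {e\<in>edges G. e \<subseteq> S} \<le> 9" using sub[of S] by simp
    qed
  qed
qed

lemma ex_planar_upper:
  assumes "6 \<le> n"
  shows "real (ex_planar n Theta_6_2) \<le> 18 / 7 * (real n - 2)"
proof -
  have "ex_planar n Theta_6_2 \<in> planar_free_sizes n Theta_6_2"
    unfolding ex_planar_def
    by (intro Max_in finite_planar_free_sizes planar_free_sizes_nonempty) (auto simp: Theta_6_2_def)
  then obtain G :: "nat ugraph" where G: "ex_planar n Theta_6_2 = card (edges G)" "simple_graph G"
    "card (vertices G) = n" "planar G" "\<not> contains_subgraph G Theta_6_2"
    unfolding planar_free_sizes_def by blast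
  have "7 * card (edges G) + 36 \<le> 18 * n"
    using planar_theta_bound[OF G(2,4,5,3)] assms by simp
  then have "7 * real (card (edges G)) + 36 \<le> 18 * real n" by linarith
  then show ?thesis unfolding G(1) by (simp add: field_simps)
qed

section \<open>Doubling a straight-line drawing\<close>

lemma planarI:
  fixes G :: "'a ugraph" and p :: "'a \<Rightarrow> complex" and D :: "'a set \<Rightarrow> complex set"
  assumes inj: "inj_on p (vertices G)"
    and arcs: "\<And>e. e \<in> edges G \<Longrightarrow> \<exists>g. arc g \<and> {pathstart g, pathfinish g} = p ` e \<and> path_image g = D e"
    and vert: "\<And>e. e \<in> edges G \<Longrightarrow> D e \<inter> p ` vertices G = p ` e"
    and cross: "\<And>e f. e \<in> edges G \<Longrightarrow> f \<in> edges G \<Longrightarrow> e \<noteq> f \<Longrightarrow> D e \<inter> D f = p ` (e \<inter> f)"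
  shows "planar G"
proof -
  obtain \<gamma> where "\<forall>e\<in>edges G. arc (\<gamma> e) \<and> {pathstart (\<gamma> e), pathfinish (\<gamma> e)} = p ` e \<and> path_image (\<gamma> e) = D e"
    using bchoice[of "edges G"] arcs by meson
  then have "plane_drawing G p \<gamma>"
    unfolding plane_drawing_def using inj vert cross by simp
  then show ?thesis by (auto simp: planar_def)
qed

lemma planar_relabel:
  assumes pl: "planar G" and h: "inj_on h (vertices G)" and sub: "\<And>e. e \<in> edges G \<Longrightarrow> e \<subseteq> vertices G"
  shows "planar (h ` vertices G, (`) h ` edges G)"
proof -
  obtain p \<gamma> where d: "plane_drawing G p \<gamma>" using pl by (auto simp: planar_def)
  define k where "k = inv_into (vertices G) h"
  have kh: "k (h v) = v" if "v \<in> vertices G" for v using that h by (simp add: k_def)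
  have khe: "k ` h ` e = e" if "e \<subseteq> vertices G" for e
    using that kh by (force simp: image_image)
  have D: "inj_on p (vertices G)"
    "\<And>e. e \<in> edges G \<Longrightarrow> arc (\<gamma> e) \<and> {pathstart (\<gamma> e), pathfinish (\<gamma> e)} = p ` e \<and> path_image (\<gamma> e) \<inter> p ` vertices G = p ` e"
    "\<And>e f. e \<in> edges G \<Longrightarrow> f \<in> edges G \<Longrightarrow> e \<noteq> f \<Longrightarrow> path_image (\<gamma> e) \<inter> path_image (\<gamma> f) = p ` (e \<inter> f)"
    using d unfolding plane_drawing_def by auto
  have pk: "(p \<circ> k) ` h ` e = p ` e" if "e \<subseteq> vertices G" for e
    using khe[OF that] by (metis image_comp)
  show ?thesis
  proof (rule planarI[where p = "p \<circ> k" and D = "\<lambda>e. path_image (\<gamma> (k ` e))"], unfold fst_conv snd_conv)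
    show "inj_on (p \<circ> k) (h ` vertices G)"
      using D(1) kh by (auto simp: inj_on_def)
    fix e' assume "e' \<in> (`) h ` edges G"
    then obtain e where e: "e \<in> edges G" "e' = h ` e" by auto
    have ke: "k ` e' = e" using khe sub e by simp
    show "\<exists>g. arc g \<and> {pathstart g, pathfinish g} = (p \<circ> k) ` e' \<and> path_image g = path_image (\<gamma> (k ` e'))"
      unfolding ke unfolding e(2) pk[OF sub[OF e(1)]] using D(2)[OF e(1)] by blast
    show "path_image (\<gamma> (k ` e')) \<inter> (p \<circ> k) ` h ` vertices G = (p \<circ> k) ` e'"
      unfolding ke unfolding e(2) pk[OF sub[OF e(1)]] pk[OF order_refl] using D(2)[OF e(1)] by blast
    fix f' assume "f' \<in> (`) h ` edges G" and ne: "e' \<noteq> f'"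
    then obtain f where f: "f \<in> edges G" "f' = h ` f" by auto
    have kf: "k ` f' = f" using khe sub f by simp
    have "e' \<inter> f' = h ` (e \<inter> f)"
      unfolding e(2) f(2) using inj_on_image_Int[OF h sub[OF e(1)] sub[OF f(1)]] by simp
    moreover have "e \<inter> f \<subseteq> vertices G" using sub[OF e(1)] by auto
    ultimately have "(p \<circ> k) ` (e' \<inter> f') = p ` (e \<inter> f)" using pk by simp
    moreover have "e \<noteq> f" using ne e(2) f(2) by auto
    ultimately show "path_image (\<gamma> (k ` e')) \<inter> path_image (\<gamma> (k ` f')) = (p \<circ> k) ` (e' \<inter> f')"
      unfolding ke kf using D(3)[OF e(1) f(1)] by simp
  qed
qed

text \<open>Lets the extremal graphs be built on a convenient vertex type, although
  \<open>planar_free_sizes\<close> speaks of vertices in \<open>nat\<close>.\<close>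

lemma planar_free_sizes_relabel:
  fixes G :: "'a ugraph"
  assumes G: "simple_graph G" "planar G" "\<not> contains_subgraph G H"
  shows "card (edges G) \<in> planar_free_sizes (card (vertices G)) H"
proof -
  have fin: "finite (vertices G)" using G by (simp add: simple_graph_def)
  then obtain h :: "'a \<Rightarrow> nat" where h: "inj_on h (vertices G)"
    using ex_bij_betw_finite_nat[OF fin] by (auto simp: bij_betw_def)
  have sub: "e \<subseteq> vertices G" "card e = 2" if "e \<in> edges G" for e using G that by (auto simp: simple_graph_def)
  let ?G = "(h ` vertices G, (`) h ` edges G)"
  have inj: "inj_on ((`) h) (edges G)"
    using inj_on_image_eq_iff[OF h] sub(1) by (auto intro!: inj_onI)
  have "simple_graph ?G"
    unfolding simple_graph_def
  proof (intro conjI ballI, unfold fst_conv snd_conv)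
    fix e' assume "e' \<in> (`) h ` edges G"
    then obtain e where e: "e \<in> edges G" "e' = h ` e" by auto
    then show "e' \<subseteq> h ` vertices G" using sub by auto
    show "card e' = 2" using card_image[OF inj_on_subset[OF h sub(1)[OF e(1)]]] sub(2)[OF e(1)] e(2) by simp
  qed (use fin in simp)
  moreover have "planar ?G" using planar_relabel[OF G(2) h] sub by blast
  moreover have "\<not> contains_subgraph ?G H"
  proof
    assume "contains_subgraph ?G H"
    then obtain f where f: "inj_on f (vertices H)" "f ` vertices H \<subseteq> h ` vertices G"
      "\<And>e. e \<in> edges H \<Longrightarrow> f ` e \<in> (`) h ` edges G"
      unfolding contains_subgraph_def by auto
    define k where "k = inv_into (vertices G) h"
    have "inj_on (k \<circ> f) (vertices H)"
      unfolding k_def using f(1,2) by (intro comp_inj_on) (auto intro: inj_on_subset[OF inj_on_inv_into])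
    moreover have "(k \<circ> f) ` vertices H \<subseteq> vertices G"
    proof -
      have "k ` h ` vertices G \<subseteq> vertices G" using h by (simp add: k_def)
      then show ?thesis using f(2) by (force simp: image_comp[symmetric])
    qed
    moreover have "(k \<circ> f) ` e \<in> edges G" if "e \<in> edges H" for e
    proof -
      from f(3)[OF that] obtain e' where e': "e' \<in> edges G" "f ` e = h ` e'" by auto
      have "(k \<circ> f) ` e = k ` h ` e'" using e'(2) by (metis image_comp)
      also have "\<dots> = e'" using h sub(1)[OF e'(1)] by (simp add: k_def inv_into_image_cancel)
      finally show ?thesis using e'(1) by simp
    qed
    ultimately show False using G(3) unfolding contains_subgraph_def by blast
  qed
  moreover have "card (edges ?G) = card (edges G)" "card (vertices ?G) = card (vertices G)"
    using card_image[OF inj] card_image[OF h] by simp_all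
  ultimately show ?thesis unfolding planar_free_sizes_def by (metis (mono_tags, lifting) mem_Collect_eq)
qed

text \<open>A straight-line drawing inside the unit ball of a gauge \<open>\<rho>\<close> is doubled by the inversion
  \<open>z \<mapsto> z / \<rho>(z)\<^sup>2\<close>, which fixes the boundary of that ball.\<close>

locale straight_half_drawing =
  fixes \<rho> :: "complex \<Rightarrow> real" and W :: "'a set" and F F' :: "'a set set" and pos :: "'a \<Rightarrow> complex"
  assumes cont: "continuous_on UNIV \<rho>" and scale: "\<And>r z. 0 < r \<Longrightarrow> \<rho> (r *\<^sub>R z) = r * \<rho> z"
    and pos_gauge: "\<And>z. z \<noteq> 0 \<Longrightarrow> 0 < \<rho> z"
    and inj: "inj_on pos W" and Wdom: "\<And>v. v \<in> W \<Longrightarrow> pos v \<noteq> 0 \<and> \<rho> (pos v) \<le> 1"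
    and F: "\<And>e. e \<in> F \<Longrightarrow> e \<subseteq> W \<and> card e = 2" and F': "F' \<subseteq> F"
    and F'_inner: "\<And>e. e \<in> F' \<Longrightarrow> \<exists>v\<in>e. \<rho> (pos v) \<noteq> 1"
    and hull_dom: "\<And>e z. e \<in> F \<Longrightarrow> z \<in> convex hull (pos ` e) \<Longrightarrow> z \<noteq> 0 \<and> \<rho> z \<le> 1"
    and hull_bd: "\<And>e z. e \<in> F \<Longrightarrow> z \<in> convex hull (pos ` e) \<Longrightarrow> \<rho> z = 1 \<Longrightarrow> z \<in> pos ` e"
    and hull_vert: "\<And>e v. e \<in> F \<Longrightarrow> v \<in> W \<Longrightarrow> pos v \<in> convex hull (pos ` e) \<Longrightarrow> v \<in> e"
    and hull_cross: "\<And>e f z. e \<in> F \<Longrightarrow> f \<in> F \<Longrightarrow> e \<noteq> f \<Longrightarrow> z \<in> convex hull (pos ` e) \<Longrightarrow>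
      z \<in> convex hull (pos ` f) \<Longrightarrow> z \<in> pos ` (e \<inter> f)"
begin

definition \<psi> :: "complex \<Rightarrow> complex" where "\<psi> z = (1 / (\<rho> z)\<^sup>2) *\<^sub>R z"

definition \<phi> :: "bool \<Rightarrow> complex \<Rightarrow> complex" where "\<phi> b = (if b then \<psi> else id)"

definition dom :: "complex set" where "dom = {z. z \<noteq> 0 \<and> \<rho> z \<le> 1}"

text \<open>Boundary vertices of the unit ball lose their flag, so that the two copies are glued
  there.\<close>

definition \<beta> :: "bool \<Rightarrow> 'a \<Rightarrow> 'a \<times> bool" where "\<beta> b v = (v, b \<and> \<rho> (pos v) \<noteq> 1)"

lemma rho_psi: "z \<noteq> 0 \<Longrightarrow> \<rho> (\<psi> z) = 1 / \<rho> z"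
  using pos_gauge[of z] by (simp add: \<psi>_def scale power2_eq_square)

lemma psi_bd: "\<rho> z = 1 \<Longrightarrow> \<psi> z = z" by (simp add: \<psi>_def)

lemma inj_phi: "inj_on (\<phi> b) dom"
proof -
  have "z = w" if "z \<in> dom" "w \<in> dom" "\<psi> z = \<psi> w" for z w
  proof -
    have nz: "z \<noteq> 0" "w \<noteq> 0" using that by (auto simp: dom_def)
    have "1 / \<rho> z = 1 / \<rho> w" using rho_psi nz that(3) by metis
    then have r: "\<rho> z = \<rho> w" by simp
    then show ?thesis using that(3) pos_gauge[OF nz(2)] by (simp add: \<psi>_def)
  qed
  then show ?thesis by (auto simp: \<phi>_def inj_on_def)
qed

lemma continuous_phi: "continuous_on dom (\<phi> b)"
proof -
  have "continuous_on dom \<rho>" using cont by (rule continuous_on_subset) simp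
  moreover have "\<forall>z\<in>dom. (\<rho> z)\<^sup>2 \<noteq> 0" using pos_gauge by (force simp: dom_def)
  ultimately show ?thesis
    unfolding \<phi>_def \<psi>_def id_def by (auto intro!: continuous_intros)
qed

text \<open>The gauge of \<open>\<psi> y\<close> is the inverse of that of \<open>y\<close>. If
  \<open>x = \<psi> y\<close>, the gauges of \<open>x\<close> and \<open>y\<close> have product 1
  and are at most 1, so both are 1, where \<open>\<psi>\<close> is the identity.\<close>

lemma phi_eq_other_side:
  assumes "z \<in> dom" "w \<in> dom" "\<phi> b z = \<phi> c w" "b \<noteq> c"
  shows "z = w \<and> \<rho> z = 1"
proof -
  have key: "x = y \<and> \<rho> x = 1" if "x \<in> dom" "y \<in> dom" "x = \<psi> y" for x y
  proof -
    have "\<rho> x = 1 / \<rho> y" "0 < \<rho> y" "\<rho> y \<le> 1" "\<rho> x \<le> 1"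
      using that rho_psi[of y] pos_gauge[of y] by (auto simp: dom_def)
    moreover from this have "\<rho> x * \<rho> y \<le> 1 * \<rho> y" by (intro mult_right_mono) auto
    ultimately have "\<rho> y = 1" by (simp add: field_simps)
    then show ?thesis using that(3) psi_bd by simp
  qed
  show ?thesis
  proof (cases b)
    case True
    then have "w = \<psi> z" using assms(3,4) by (simp add: \<phi>_def)
    from key[OF assms(2,1) this] show ?thesis by auto
  next
    case False
    then have "z = \<psi> w" using assms(3,4) by (simp add: \<phi>_def)
    from key[OF assms(1,2) this] show ?thesis by auto
  qed
qed

definition place :: "'a \<times> bool \<Rightarrow> complex" where "place x = \<phi> (snd x) (pos (fst x))"

lemma place_beta: "place (\<beta> b v) = \<phi> b (pos v)"
  by (auto simp: place_def \<beta>_def \<phi>_def psi_bd)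

text \<open>The copy to which an edge belongs is read off its vertices: by \<open>F'_inner\<close>
  every back edge keeps a raised flag at one of them.\<close>

definition side :: "('a \<times> bool) set \<Rightarrow> bool" where "side e \<longleftrightarrow> True \<in> snd ` e"

definition region :: "('a \<times> bool) set \<Rightarrow> complex set" where
  "region e = \<phi> (side e) ` (convex hull (pos ` fst ` e))"

lemma fst_beta: "fst ` \<beta> b ` e = e"
  by (auto simp: \<beta>_def image_image)

lemma side_beta: "e \<in> (if b then F' else F) \<Longrightarrow> side (\<beta> b ` e) = b"
  using F'_inner[of e] by (cases b) (force simp: side_def \<beta>_def image_image)+

lemma region_beta: "e \<in> (if b then F' else F) \<Longrightarrow> region (\<beta> b ` e) = \<phi> b ` (convex hull (pos ` e))"
  by (simp add: region_def fst_beta side_beta)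

text \<open>Within one copy the injectivity of \<open>\<phi>\<close> transfers the straight-line
  drawing. Points of different copies agree only on the boundary of the ball, where by
  \<open>hull_bd\<close> the edges have nothing but end vertices.\<close>

theorem planar_double:
  "planar (\<beta> False ` W \<union> \<beta> True ` W, (`) (\<beta> False) ` F \<union> (`) (\<beta> True) ` F')"
proof (rule planarI[where p = place and D = region], unfold fst_conv snd_conv)
  let ?V = "\<beta> False ` W \<union> \<beta> True ` W" and ?E = "(`) (\<beta> False) ` F \<union> (`) (\<beta> True) ` F'"
  have V: "\<exists>b v. v \<in> W \<and> x = \<beta> b v" if "x \<in> ?V" for x using that by auto
  have E: "\<exists>b e. e \<in> (if b then F' else F) \<and> e \<in> F \<and> x = \<beta> b ` e" if "x \<in> ?E" for x
    using that
  proof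
    assume "x \<in> (`) (\<beta> False) ` F"
    then show ?thesis by (intro exI[of _ False]) auto
  next
    assume "x \<in> (`) (\<beta> True) ` F'"
    then show ?thesis using F' by (intro exI[of _ True]) auto
  qed
  have hd: "convex hull (pos ` e) \<subseteq> dom" if "e \<in> F" for e using hull_dom[OF that] by (auto simp: dom_def)
  have pd: "pos v \<in> dom" if "v \<in> W" for v using Wdom[OF that] by (simp add: dom_def)
  show "inj_on place ?V"
  proof (rule inj_onI)
    fix x y assume "x \<in> ?V" "y \<in> ?V" and eq: "place x = place y"
    then obtain b v c w where x: "v \<in> W" "x = \<beta> b v" and y: "w \<in> W" "y = \<beta> c w" using V by meson
    have eq': "\<phi> b (pos v) = \<phi> c (pos w)" using eq x y place_beta by simp
    show "x = y"
    proof (cases "b = c")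
      case True
      then have "pos v = pos w" using eq' inj_onD[OF inj_phi[of b], of "pos v" "pos w"] pd x y by simp
      then show ?thesis using inj_onD[OF inj, of v w] x y True by simp
    next
      case False
      then have "pos v = pos w \<and> \<rho> (pos v) = 1" using phi_eq_other_side eq' pd x y by blast
      then show ?thesis using inj x y by (auto simp: \<beta>_def dest: inj_onD)
    qed
  qed
  have reg_sub: "place ` \<beta> b ` e \<subseteq> \<phi> b ` (convex hull (pos ` e))" for b e
    using hull_subset[of "pos ` e" convex] by (auto simp: place_beta)
  fix e' assume "e' \<in> ?E"
  then obtain b e where e: "e \<in> (if b then F' else F)" "e \<in> F" "e' = \<beta> b ` e" using E by meson
  note re = region_beta[OF e(1), folded e(3)]
  obtain u v where uv: "e = {u, v}" "u \<noteq> v" using F[OF e(2)] by (auto simp: card_2_iff)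
  have uvW: "u \<in> W" "v \<in> W" using F[OF e(2)] uv by auto
  have hull: "convex hull (pos ` e) = closed_segment (pos u) (pos v)"
    by (simp add: uv segment_convex_hull)
  show "\<exists>g. arc g \<and> {pathstart g, pathfinish g} = place ` e' \<and> path_image g = region e'"
  proof (intro exI conjI)
    let ?l = "linepath (pos u) (pos v)"
    have "pos u \<noteq> pos v" using inj uvW uv(2) by (auto dest: inj_onD)
    then have al: "arc ?l" by simp
    have pi: "path_image ?l \<subseteq> dom" using hd[OF e(2)] hull by simp
    have "path (\<phi> b \<circ> ?l)"
      using al continuous_on_subset[OF continuous_phi pi] by (intro path_continuous_image) (auto simp: arc_def)
    moreover have "inj_on (\<phi> b \<circ> ?l) {0..1}"
      using al inj_on_subset[OF inj_phi pi] by (intro comp_inj_on) (auto simp: arc_def path_image_def)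
    ultimately show "arc (\<phi> b \<circ> ?l)" by (simp add: arc_def)
    show "{pathstart (\<phi> b \<circ> ?l), pathfinish (\<phi> b \<circ> ?l)} = place ` e'"
      by (simp add: pathstart_compose pathfinish_compose e(3) uv(1) place_beta)
    show "path_image (\<phi> b \<circ> ?l) = region e'"
      by (simp add: path_image_compose re hull)
  qed
  show "region e' \<inter> place ` ?V = place ` e'"
  proof
    show "place ` e' \<subseteq> region e' \<inter> place ` ?V"
      using reg_sub[of b e] re e(3) F[OF e(2)] by (cases b) auto
    show "region e' \<inter> place ` ?V \<subseteq> place ` e'"
    proof
      fix z assume z: "z \<in> region e' \<inter> place ` ?V"
      then obtain x where "x \<in> ?V" "z = place x" by auto
      then obtain c w where w: "w \<in> W" "z = \<phi> c (pos w)" using V place_beta by metis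
      obtain y where y: "y \<in> convex hull (pos ` e)" "z = \<phi> b y" using z re by auto
      have yd: "y \<in> dom" using y hd[OF e(2)] by auto
      have "w \<in> e \<and> z = \<phi> b (pos w)"
      proof (cases "b = c")
        case True
        then have "y = pos w" using inj_onD[OF inj_phi[of b], of y "pos w"] y w yd pd by simp
        then show ?thesis using hull_vert[OF e(2) w(1)] y by simp
      next
        case False
        then have "y = pos w" using phi_eq_other_side[OF yd pd[OF w(1)], of b c] w(2) y(2) by simp
        then show ?thesis using hull_vert[OF e(2) w(1)] y by simp
      qed
      then show "z \<in> place ` e'" using e(3) place_beta by (metis imageI)
    qed
  qed
  fix f' assume "f' \<in> ?E" and ne: "e' \<noteq> f'"
  then obtain c f where f: "f \<in> (if c then F' else F)" "f \<in> F" "f' = \<beta> c ` f" using E by meson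
  note rf = region_beta[OF f(1), folded f(3)]
  show "region e' \<inter> region f' = place ` (e' \<inter> f')"
  proof
    show "place ` (e' \<inter> f') \<subseteq> region e' \<inter> region f'"
      using reg_sub[of b e] reg_sub[of c f] re rf e(3) f(3) by blast
    show "region e' \<inter> region f' \<subseteq> place ` (e' \<inter> f')"
    proof
      fix z assume z: "z \<in> region e' \<inter> region f'"
      then obtain x y where x: "x \<in> convex hull (pos ` e)" "z = \<phi> b x" and y: "y \<in> convex hull (pos ` f)" "z = \<phi> c y"
        using re rf by auto
      have d: "x \<in> dom" "y \<in> dom" using x y hd e(2) f(2) by auto
      show "z \<in> place ` (e' \<inter> f')"
      proof (cases "b = c")
        case True
        then have "x = y" using inj_onD[OF inj_phi[of b], of x y] x y d by simp
        moreover have "e \<noteq> f" using ne e f True by auto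
        ultimately obtain v where v: "v \<in> e \<inter> f" "x = pos v" using hull_cross[OF e(2) f(2) _ x(1)] y(1) by auto
        then have "\<beta> b v \<in> e' \<inter> f'" using e(3) f(3) True by auto
        then show ?thesis using x v place_beta by (metis imageI)
      next
        case False
        have "\<phi> b x = \<phi> c y" using x(2) y(2) by simp
        from phi_eq_other_side[OF d this False] have xy: "x = y" "\<rho> x = 1" by auto
        obtain v where v: "v \<in> e" "x = pos v" using hull_bd[OF e(2) x(1) xy(2)] by auto
        obtain w where w: "w \<in> f" "x = pos w" using hull_bd[OF f(2) y(1)] xy by auto
        have "v \<in> W" "w \<in> W" using v w F[OF e(2)] F[OF f(2)] by auto
        then have "v = w" using inj_onD[OF inj, of v w] v w by simp
        then have "\<beta> b v \<in> e'" "\<beta> c v \<in> f'" using e(3) f(3) v w by simp_all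
        moreover have "\<beta> b v = \<beta> c v" using v xy by (simp add: \<beta>_def)
        ultimately have "\<beta> b v \<in> e' \<inter> f'" by simp
        then show ?thesis using x v place_beta by (metis imageI)
      qed
    qed
  qed
qed

end

section \<open>The extremal graphs\<close>

text \<open>Small triangles are indexed by an orientation \<open>s\<close> and a lattice position. Local vertices 0, 1, 2
  are the outer vertices of the gadget, 3 and 4 its inner ones. An outer vertex lies in two small
  triangles and is named after the one with \<open>s = False\<close>; inner vertices get the tags 3, 4 or 5, 6
  according to orientation.\<close>

definition lv :: "bool \<Rightarrow> int \<Rightarrow> int \<Rightarrow> nat \<Rightarrow> nat \<times> int \<times> int" where
  "lv s i j l = (if l = 0 then (0, i, j) else if l = 1 then (1, if s then i + 1 else i, j)
     else if l = 2 then (2, i, if s then j + 1 else j) else (if s then l else l + 2, i, j))"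

text \<open>Local coordinates: the outer vertices are (0, 0), (5, 0), (0, 5) and the inner ones (1,
  1), (2, 2), so vertex 4 lies inside the triangle of 1, 2, 3.\<close>

definition lpx :: "nat \<Rightarrow> real" where
  "lpx l = (if l = 1 then 5 else if l = 3 then 1 else if l = 4 then 2 else 0)"

definition lpy :: "nat \<Rightarrow> real" where
  "lpy l = (if l = 2 then 5 else if l = 3 then 1 else if l = 4 then 2 else 0)"

definition sg :: "bool \<Rightarrow> real" where "sg s = (if s then 1 else - 1)"

text \<open>Lattice points are the multiples of 10, and a gadget fills the triangle of the midpoints
  of a lattice triangle. The two orientations differ by a half turn, which gives a shared vertex the
  same local number in both of its gadgets.\<close>

definition cpt :: "bool \<Rightarrow> int \<Rightarrow> int \<Rightarrow> real \<Rightarrow> real \<Rightarrow> complex" where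
  "cpt s i j x y = Complex (10 * of_int i + 5 + sg s * x) (10 * of_int j + 5 + sg s * y)"

fun pos :: "nat \<times> int \<times> int \<Rightarrow> complex" where
  "pos (k, i, j) = (if k = 0 then cpt True i j 0 0 else if k = 1 then cpt False i j 5 0
     else if k = 2 then cpt False i j 0 5 else if k \<le> 4 then cpt True i j (lpx k) (lpy k)
     else cpt False i j (lpx (k - 2)) (lpy (k - 2)))"

text \<open>The missing pair is \<open>(0, 4)\<close>. All pairs are increasing, so that an edge
  determines its pair.\<close>

definition LE :: "(nat \<times> nat) set" where
  "LE = {(0, 1), (0, 2), (1, 2), (0, 3), (1, 3), (2, 3), (3, 4), (1, 4), (2, 4)}"

definition lseg :: "nat \<Rightarrow> nat \<Rightarrow> real \<Rightarrow> real \<Rightarrow> bool" where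
  "lseg l m x y \<longleftrightarrow> (\<exists>u. 0 \<le> u \<and> u \<le> 1 \<and> x = (1 - u) * lpx l + u * lpx m \<and> y = (1 - u) * lpy l + u * lpy m)"

lemma less5: "l < 5 \<longleftrightarrow> l = 0 \<or> l = 1 \<or> l = 2 \<or> l = 3 \<or> l = (4::nat)"
  by auto

lemma LE_less5: "(l, m) \<in> LE \<Longrightarrow> l < 5 \<and> m < 5 \<and> l \<noteq> m"
  by (auto simp: LE_def)

lemma pos_lv: "l < 5 \<Longrightarrow> pos (lv s i j l) = cpt s i j (lpx l) (lpy l)"
  unfolding less5 by (elim disjE) (simp_all add: lv_def lpx_def lpy_def cpt_def sg_def)

lemma lseg_constraints:
  "lseg 0 1 x y \<Longrightarrow> y = 0 \<and> 0 \<le> x \<and> x \<le> 5" "lseg 0 2 x y \<Longrightarrow> x = 0 \<and> 0 \<le> y \<and> y \<le> 5"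
  "lseg 1 2 x y \<Longrightarrow> x + y = 5 \<and> 0 \<le> x \<and> 0 \<le> y" "lseg 0 3 x y \<Longrightarrow> x = y \<and> 0 \<le> x \<and> x \<le> 1"
  "lseg 1 3 x y \<Longrightarrow> x + 4 * y = 5 \<and> 1 \<le> x \<and> x \<le> 5" "lseg 2 3 x y \<Longrightarrow> 4 * x + y = 5 \<and> 1 \<le> y \<and> y \<le> 5"
  "lseg 3 4 x y \<Longrightarrow> x = y \<and> 1 \<le> x \<and> x \<le> 2" "lseg 1 4 x y \<Longrightarrow> 2 * x + 3 * y = 10 \<and> 2 \<le> x \<and> x \<le> 5"
  "lseg 2 4 x y \<Longrightarrow> 3 * x + 2 * y = 10 \<and> 2 \<le> y \<and> y \<le> 5"
  by (auto simp: lseg_def lpx_def lpy_def)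

text \<open>Segments as line equations with ranges, in the form of a case rule: incidence questions
  become linear arithmetic.\<close>

lemma lseg_line:
  assumes "(l, m) \<in> LE" "lseg l m x y"
  obtains "l = 0" "m = 1" "y = 0 \<and> 0 \<le> x \<and> x \<le> 5"
  | "l = 0" "m = 2" "x = 0 \<and> 0 \<le> y \<and> y \<le> 5"
  | "l = 1" "m = 2" "x + y = 5 \<and> 0 \<le> x \<and> 0 \<le> y"
  | "l = 0" "m = 3" "x = y \<and> 0 \<le> x \<and> x \<le> 1"
  | "l = 1" "m = 3" "x + 4 * y = 5 \<and> 1 \<le> x \<and> x \<le> 5"
  | "l = 2" "m = 3" "4 * x + y = 5 \<and> 1 \<le> y \<and> y \<le> 5"
  | "l = 3" "m = 4" "x = y \<and> 1 \<le> x \<and> x \<le> 2"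
  | "l = 1" "m = 4" "2 * x + 3 * y = 10 \<and> 2 \<le> x \<and> x \<le> 5"
  | "l = 2" "m = 4" "3 * x + 2 * y = 10 \<and> 2 \<le> y \<and> y \<le> 5"
proof -
  have "l = 0 \<and> m = 1 \<or> l = 0 \<and> m = 2 \<or> l = 1 \<and> m = 2 \<or> l = 0 \<and> m = 3 \<or> l = 1 \<and> m = 3 \<or> l = 2 \<and> m = 3 \<or> l = 3 \<and> m = 4 \<or> l = 1 \<and> m = 4 \<or> l = 2 \<and> m = 4"
    using assms(1) unfolding LE_def by simp
  then show ?thesis
    using assms(2) that lseg_constraints[of x y] by metis
qed

lemma lseg_region:
  assumes "(l, m) \<in> LE" "lseg l m x y"
  shows "0 \<le> x \<and> 0 \<le> y \<and> x + y \<le> 5"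
  by (rule lseg_line[OF assms]) auto

lemma lseg_vertex:
  assumes "(l, m) \<in> LE" "n < 5" "lseg l m (lpx n) (lpy n)"
  shows "n = l \<or> n = m"
  by (rule lseg_line[OF assms(1,3)]) (use assms(2) in \<open>auto simp: less5 lpx_def lpy_def\<close>)

lemma lseg_cross:
  assumes "(l, m) \<in> LE" "(l', m') \<in> LE" "(l, m) \<noteq> (l', m')" "lseg l m x y" "lseg l' m' x y"
  shows "\<exists>n\<in>{l, m} \<inter> {l', m'}. x = lpx n \<and> y = lpy n"
  apply (rule lseg_line[OF assms(1,4)])
          apply (rule lseg_line[OF assms(2,5)]; use assms(3) in \<open>simp add: lpx_def lpy_def\<close>)+
  done

lemma hull_cell:
  assumes "l < 5" "m < 5" "z \<in> convex hull (pos ` {lv s i j l, lv s i j m})"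
  obtains x y where "lseg l m x y" "z = cpt s i j x y"
proof -
  have "z \<in> closed_segment (cpt s i j (lpx l) (lpy l)) (cpt s i j (lpx m) (lpy m))"
    using assms by (simp add: segment_convex_hull pos_lv)
  then obtain u where u: "0 \<le> u" "u \<le> 1" "z = (1 - u) *\<^sub>R cpt s i j (lpx l) (lpy l) + u *\<^sub>R cpt s i j (lpx m) (lpy m)"
    by (auto simp: closed_segment_def)
  let ?x = "(1 - u) * lpx l + u * lpx m" and ?y = "(1 - u) * lpy l + u * lpy m"
  have "z = cpt s i j ?x ?y"
    unfolding u(3) by (simp add: complex_eq_iff cpt_def algebra_simps)
  moreover have "lseg l m ?x ?y" using u by (auto simp: lseg_def)
  ultimately show ?thesis using that by blast
qed

text \<open>Gadgets of equal orientation are translates by multiples of 10 but have extent 5, so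
  they are disjoint. For opposite orientations only the offsets (0, 0), (1, 0) and (0, 1) are
  possible, and they force the common outer vertex 0, 1 or 2.\<close>

lemma cell_regions:
  assumes ne: "(s, i, j) \<noteq> (s', i', j')" and eq: "cpt s i j x y = cpt s' i' j' x' y'"
    and r: "0 \<le> x" "0 \<le> y" "x + y \<le> 5" "0 \<le> x'" "0 \<le> y'" "x' + y' \<le> 5"
  obtains k where "k < 3" "x = lpx k" "y = lpy k" "x' = lpx k" "y' = lpy k" "lv s i j k = lv s' i' j' k"
proof -
  have E: "10 * real_of_int (i - i') = sg s' * x' - sg s * x" "10 * real_of_int (j - j') = sg s' * y' - sg s * y"
    using eq by (auto simp: cpt_def)
  have opp: "\<exists>k<3. x = lpx k \<and> y = lpy k \<and> x' = lpx k \<and> y' = lpy k \<and> lv True i j k = lv False i' j' k"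
    if e: "10 * real_of_int (i' - i) = x + x'" "10 * real_of_int (j' - j) = y + y'"
      and r: "0 \<le> x" "0 \<le> y" "x + y \<le> 5" "0 \<le> x'" "0 \<le> y'" "x' + y' \<le> 5" for i j i' j' x y x' y'
  proof -
    define p q where "p = i' - i" and "q = j' - j"
    have "0 \<le> real_of_int p" "0 \<le> real_of_int q"
      "real_of_int p \<le> 1" "real_of_int q \<le> 1"
      using e[folded p_def q_def] r by (auto simp: field_simps)
    then have "0 \<le> p" "0 \<le> q" "p \<le> 1" "q \<le> 1" by simp_all
    moreover have "p + q \<le> 1"
    proof -
      have "10 * (real_of_int p + real_of_int q) \<le> 10" using e[folded p_def q_def] r by simp
      then have "real_of_int (p + q) \<le> real_of_int 1" by simp
      then show ?thesis by (simp only: of_int_le_iff)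
    qed
    ultimately have "(i' - i) + (j' - j) \<le> 1" "0 \<le> i' - i" "0 \<le> j' - j" unfolding p_def q_def by simp_all
    then consider "i' = i" "j' = j" | "i' = i + 1" "j' = j" | "i' = i" "j' = j + 1" by linarith
    then show ?thesis
    proof cases
      case 1
      then have "x = 0" "x' = 0" "y = 0" "y' = 0" using e r by auto
      then show ?thesis using 1 by (intro exI[of _ 0]) (simp add: lpx_def lpy_def lv_def)
    next
      case 2
      then have "x = 5" "x' = 5" "y = 0" "y' = 0" using e r by auto
      then show ?thesis using 2 by (intro exI[of _ 1]) (simp add: lpx_def lpy_def lv_def)
    next
      case 3
      then have "x = 0" "x' = 0" "y = 5" "y' = 5" using e r by auto
      then show ?thesis using 3 by (intro exI[of _ 2]) (simp add: lpx_def lpy_def lv_def)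
    qed
  qed
  show ?thesis
  proof (cases s; cases s')
    assume s: "s" "s'"
    have "\<bar>real_of_int (i - i')\<bar> < 1" "\<bar>real_of_int (j - j')\<bar> < 1" using E r s by (auto simp: sg_def)
    then have "i = i'" "j = j'" by linarith+
    then show ?thesis using ne s by auto
  next
    assume s: "\<not> s" "\<not> s'"
    have "\<bar>real_of_int (i - i')\<bar> < 1" "\<bar>real_of_int (j - j')\<bar> < 1" using E r s by (auto simp: sg_def)
    then have "i = i'" "j = j'" by linarith+
    then show ?thesis using ne s by auto
  next
    assume s: "s" "\<not> s'"
    have "10 * real_of_int (i' - i) = x + x'" "10 * real_of_int (j' - j) = y + y'" using E s by (auto simp: sg_def)
    from opp[OF this r] show ?thesis using that s by auto
  next
    assume s: "\<not> s" "s'"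
    have "10 * real_of_int (i - i') = x' + x" "10 * real_of_int (j - j') = y' + y" using E s by (auto simp: sg_def)
    from opp[OF this r(4-6,1-3)] show ?thesis using that s by auto
  qed
qed

section \<open>The large triangle and its gauge\<close>

text \<open>The large triangle is given by \<open>x \<ge> - 10 t\<close>,
  \<open>y \<ge> - 10 t\<close>, \<open>x + y \<le> 10 t\<close>. The lattice triangle with
  \<open>s\<close> has the corner \<open>(10 i + 10, 10 j + 10)\<close>, whence the bound 2, while
  the one without \<open>s\<close> reaches only one step.\<close>

definition valid :: "int \<Rightarrow> bool \<Rightarrow> int \<Rightarrow> int \<Rightarrow> bool" where
  "valid t s i j \<longleftrightarrow> - t \<le> i \<and> - t \<le> j \<and> i + j \<le> t - (if s then 2 else 1)"

definition bdv :: "int \<Rightarrow> nat \<times> int \<times> int \<Rightarrow> bool" where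
  "bdv t v \<longleftrightarrow> (case v of (k, i, j) \<Rightarrow> k = 0 \<and> i + j = t - 1 \<or> k = 1 \<and> i = - t \<or> k = 2 \<and> j = - t)"

definition W :: "int \<Rightarrow> (nat \<times> int \<times> int) set" where
  "W t = {lv s i j l |s i j l. valid t s i j \<and> l < 5}"

definition F :: "int \<Rightarrow> (nat \<times> int \<times> int) set set" where
  "F t = {{lv s i j l, lv s i j m} |s i j l m. valid t s i j \<and> (l, m) \<in> LE}"

text \<open>The flag \<open>b\<close> selects the front or the back copy; it is dropped on the boundary, where the copies
  are glued.\<close>

definition kp :: "int \<Rightarrow> bool \<Rightarrow> nat \<times> int \<times> int \<Rightarrow> (nat \<times> int \<times> int) \<times> bool" where
  "kp t b v = (v, b \<and> \<not> bdv t v)"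

text \<open>The Minkowski functional of the large triangle with respect to the origin in its
  interior.\<close>

definition gauge :: "int \<Rightarrow> complex \<Rightarrow> real" where
  "gauge t z = max (- Re z) (max (- Im z) (Re z + Im z)) / (10 * of_int t)"

text \<open>The origin is a lattice point and gadgets stay away from those, so the inversion is
  defined on the drawing. The sides of the large triangle are touched only in midpoints of lattice
  edges, which are outer vertices of gadgets with \<open>s = False\<close>.\<close>

lemma gauge_region:
  assumes t: "1 \<le> t" and v: "valid t s i j" and r: "0 \<le> x" "0 \<le> y" "x + y \<le> 5" and z: "z = cpt s i j x y"
  shows "z \<noteq> 0" "gauge t z \<le> 1"
    "gauge t z = 1 \<longleftrightarrow> \<not> s \<and> (x = 0 \<and> y = 0 \<and> i + j = t - 1 \<or> x = 5 \<and> y = 0 \<and> i = - t \<or> x = 0 \<and> y = 5 \<and> j = - t)"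
proof -
  have t': "1 \<le> real_of_int t" using t by simp
  have R: "- real_of_int t \<le> i" "- real_of_int t \<le> j" "real_of_int i + real_of_int j \<le> t - (if s then 2 else 1)"
    using v unfolding valid_def by (auto simp: of_int_add[symmetric] simp del: of_int_add)
  show "z \<noteq> 0"
  proof
    assume "z = 0"
    then have e: "10 * real_of_int i + 5 + sg s * x = 0" "10 * real_of_int j + 5 + sg s * y = 0"
      using z by (auto simp: cpt_def complex_eq_iff)
    show False
    proof (cases s)
      case True
      then have "real_of_int i < 0" "real_of_int j < 0" using e r by (auto simp: sg_def)
      then have "i \<le> -1" "j \<le> -1" by simp_all
      then have "real_of_int i \<le> real_of_int (- 1)" "real_of_int j \<le> real_of_int (- 1)" by (simp_all only: of_int_le_iff)
      then show False using e r True by (simp add: sg_def)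
    next
      case False
      then have "real_of_int i > -1" "real_of_int j > -1" using e r by (auto simp: sg_def)
      then have "real_of_int (- 1) < real_of_int i" "real_of_int (- 1) < real_of_int j" by simp_all
      then have "0 \<le> i" "0 \<le> j" by (simp_all only: of_int_less_iff)
      then have "real_of_int i \<ge> 0" "real_of_int j \<ge> 0" by simp_all
      then show False using e r False by (simp add: sg_def)
    qed
  qed
  have M: "gauge t z \<le> 1 \<longleftrightarrow> - Re z \<le> 10 * t \<and> - Im z \<le> 10 * t \<and> Re z + Im z \<le> 10 * t"
    "gauge t z = 1 \<longleftrightarrow> max (- Re z) (max (- Im z) (Re z + Im z)) = 10 * t"
    using t' by (auto simp: gauge_def field_simps)
  have ReIm: "Re z = 10 * i + 5 + sg s * x" "Im z = 10 * j + 5 + sg s * y" by (simp_all add: z cpt_def)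
  have b: "- Re z \<le> 10 * t" "- Im z \<le> 10 * t" "Re z + Im z \<le> 10 * t"
    using R r unfolding ReIm by (cases s; simp add: sg_def; linarith)+
  then show "gauge t z \<le> 1" using M by simp
  have "gauge t z = 1 \<longleftrightarrow> - Re z = 10 * t \<or> - Im z = 10 * t \<or> Re z + Im z = 10 * t"
    unfolding M(2) using b by (auto simp: max_def)
  also have "\<dots> \<longleftrightarrow> \<not> s \<and> (x = 0 \<and> y = 0 \<and> i + j = t - 1 \<or> x = 5 \<and> y = 0 \<and> i = - t \<or> x = 0 \<and> y = 5 \<and> j = - t)"
  proof (cases s)
    case True
    then have "- Re z \<noteq> 10 * t" "- Im z \<noteq> 10 * t" "Re z + Im z \<noteq> 10 * t"
      using R r unfolding ReIm by (auto simp: sg_def)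
    then show ?thesis using True by simp
  next
    case False
    have 1: "- Re z = 10 * t \<longleftrightarrow> x = 5 \<and> y = 0 \<and> i = - t"
    proof
      assume a: "- Re z = 10 * t"
      then have "x = 5" "real_of_int i = - t" using R r False unfolding ReIm by (simp add: sg_def; linarith)+
      then show "x = 5 \<and> y = 0 \<and> i = - t" using r by (simp; linarith)
    qed (use ReIm False in \<open>simp add: sg_def\<close>)
    have 2: "- Im z = 10 * t \<longleftrightarrow> x = 0 \<and> y = 5 \<and> j = - t"
    proof
      assume a: "- Im z = 10 * t"
      then have "y = 5" "real_of_int j = - t" using R r False unfolding ReIm by (simp add: sg_def; linarith)+
      then show "x = 0 \<and> y = 5 \<and> j = - t" using r by (simp; linarith)
    qed (use ReIm False in \<open>simp add: sg_def\<close>)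
    have 3: "Re z + Im z = 10 * t \<longleftrightarrow> x = 0 \<and> y = 0 \<and> i + j = t - 1"
    proof
      assume a: "Re z + Im z = 10 * t"
      then have "x = 0" "y = 0" "real_of_int i + real_of_int j = t - 1"
        using R r False unfolding ReIm by (simp add: sg_def; linarith)+
      then show "x = 0 \<and> y = 0 \<and> i + j = t - 1" by (simp; linarith)
    next
      assume "x = 0 \<and> y = 0 \<and> i + j = t - 1"
      moreover from this have "real_of_int i + real_of_int j = t - 1" by linarith
      ultimately show "Re z + Im z = 10 * t" using ReIm False by (simp add: sg_def)
    qed
    show ?thesis unfolding 1 2 3 using False by blast
  qed
  finally show "gauge t z = 1 \<longleftrightarrow> \<not> s \<and> (x = 0 \<and> y = 0 \<and> i + j = t - 1 \<or> x = 5 \<and> y = 0 \<and> i = - t \<or> x = 0 \<and> y = 5 \<and> j = - t)" .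
qed

lemma lp_region: "l < 5 \<Longrightarrow> 0 \<le> lpx l \<and> 0 \<le> lpy l \<and> lpx l + lpy l \<le> 5"
  by (auto simp: lpx_def lpy_def)

lemma lp_inj: "l < 5 \<Longrightarrow> m < 5 \<Longrightarrow> lpx l = lpx m \<Longrightarrow> lpy l = lpy m \<Longrightarrow> l = m"
  unfolding less5 by (elim disjE) (simp_all add: lpx_def lpy_def)

lemma cpt_eq: "cpt s i j x y = cpt s i j x' y' \<longleftrightarrow> x = x' \<and> y = y'"
  by (auto simp: cpt_def sg_def)

lemma bdv_gauge:
  assumes t: "1 \<le> t" and v: "v \<in> W t"
  shows "gauge t (pos v) = 1 \<longleftrightarrow> bdv t v"
proof -
  obtain s i j l where l: "v = lv s i j l" "valid t s i j" "l < 5" using v unfolding W_def by blast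
  have "gauge t (pos v) = 1 \<longleftrightarrow> \<not> s \<and> (lpx l = 0 \<and> lpy l = 0 \<and> i + j = t - 1 \<or> lpx l = 5 \<and> lpy l = 0 \<and> i = - t \<or>
      lpx l = 0 \<and> lpy l = 5 \<and> j = - t)"
    using gauge_region(3)[OF t l(2) _ _ _ pos_lv[OF l(3)]] lp_region[OF l(3)] l(1) by simp
  also have "\<dots> \<longleftrightarrow> bdv t v"
    using l(2,3) unfolding l(1) less5 by (elim disjE) (auto simp: lpx_def lpy_def bdv_def lv_def valid_def)
  finally show ?thesis .
qed

lemma vertex_in_cell:
  assumes "(l, m) \<in> LE" "lseg l m x y" "n < 5" "pos (lv s' i' j' n) = cpt s i j x y"
  shows "lv s' i' j' n = lv s i j l \<or> lv s' i' j' n = lv s i j m"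
proof (cases "(s, i, j) = (s', i', j')")
  case True
  then have "x = lpx n" "y = lpy n" using assms(4) by (auto simp: pos_lv[OF assms(3)] cpt_eq)
  then show ?thesis using lseg_vertex[OF assms(1,3)] assms(2) True by auto
next
  case False
  have eq: "cpt s i j x y = cpt s' i' j' (lpx n) (lpy n)" using assms(4) pos_lv[OF assms(3)] by simp
  obtain k where k: "k < 3" "x = lpx k" "y = lpy k" "lpx n = lpx k" "lpy n = lpy k" "lv s i j k = lv s' i' j' k"
    using cell_regions[OF False eq] lseg_region[OF assms(1,2)] lp_region[OF assms(3)] by metis
  have "n = k" using lp_inj[OF assms(3)] k by simp
  moreover have "k = l \<or> k = m" using lseg_vertex[OF assms(1)] assms(2) k by simp
  ultimately show ?thesis using k by auto
qed

text \<open>An edge between two boundary vertices would be the same edge in both copies; the back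
  copy therefore omits it.\<close>

lemma half_drawing:
  assumes t: "1 \<le> t"
  shows "straight_half_drawing (gauge t) (W t) (F t) {e \<in> F t. \<exists>v\<in>e. \<not> bdv t v} pos"
proof
  have t': "0 < real_of_int t" using t by simp
  show "continuous_on UNIV (gauge t)"
    unfolding gauge_def using t' by (auto intro!: continuous_intros)
  show "gauge t (r *\<^sub>R z) = r * gauge t z" if "0 < r" for r z
    using that t' by (simp add: gauge_def max_mult_distrib_left algebra_simps)
  show "0 < gauge t z" if "z \<noteq> 0" for z
  proof -
    have "0 < max (- Re z) (max (- Im z) (Re z + Im z))"
      using that by (auto simp: max_def complex_eq_iff)
    then show ?thesis using t' by (simp add: gauge_def)
  qed
  have Wd: "pos v \<noteq> 0 \<and> gauge t (pos v) \<le> 1" if "v \<in> W t" for v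
  proof -
    from that obtain s i j l where l: "v = lv s i j l" "valid t s i j" "l < 5" unfolding W_def by blast
    show ?thesis using gauge_region(1,2)[OF t l(2) _ _ _ pos_lv[OF l(3)]] lp_region[OF l(3)] l(1) by simp
  qed
  then show "\<And>v. v \<in> W t \<Longrightarrow> pos v \<noteq> 0 \<and> gauge t (pos v) \<le> 1" .
  show "inj_on pos (W t)"
  proof (rule inj_onI)
    fix v w assume "v \<in> W t" "w \<in> W t" and eq: "pos v = pos w"
    then obtain s i j l s' i' j' n where l: "v = lv s i j l" "l < 5" and n: "w = lv s' i' j' n" "n < 5"
      by (auto simp: W_def)
    have eq': "cpt s i j (lpx l) (lpy l) = cpt s' i' j' (lpx n) (lpy n)"
      using eq l n by (simp add: pos_lv)
    show "v = w"
    proof (cases "(s, i, j) = (s', i', j')")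
      case True
      then show ?thesis using eq' lp_inj l n by (auto simp: cpt_eq)
    next
      case False
      obtain k where k: "k < 3" "lpx l = lpx k" "lpy l = lpy k" "lpx n = lpx k" "lpy n = lpy k" "lv s i j k = lv s' i' j' k"
        using cell_regions[OF False eq'] lp_region[OF l(2)] lp_region[OF n(2)] by metis
      then have "l = k" "n = k" using lp_inj l n by auto
      then show ?thesis using k l n by simp
    qed
  qed
  have Fd: "\<exists>s i j l m. e = {lv s i j l, lv s i j m} \<and> valid t s i j \<and> (l, m) \<in> LE" if "e \<in> F t" for e
    using that unfolding F_def by blast
  show "e \<subseteq> W t \<and> card e = 2" if "e \<in> F t" for e
  proof -
    from Fd[OF that] obtain s i j l m where e: "e = {lv s i j l, lv s i j m}" "valid t s i j" "(l, m) \<in> LE" by blast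
    have lm: "l < 5" "m < 5" "l \<noteq> m" using LE_less5[OF e(3)] by auto
    have "lv s i j l \<noteq> lv s i j m" using lp_inj[OF lm(1,2)] lm(3) pos_lv[OF lm(1)] pos_lv[OF lm(2)] cpt_eq by metis
    then show ?thesis using e lm by (auto simp: W_def)
  qed
  show "{e \<in> F t. \<exists>v\<in>e. \<not> bdv t v} \<subseteq> F t" by auto
  have hull: "\<exists>s i j l m x y. e = {lv s i j l, lv s i j m} \<and> valid t s i j \<and> (l, m) \<in> LE \<and> lseg l m x y \<and> z = cpt s i j x y"
    if "e \<in> F t" "z \<in> convex hull (pos ` e)" for e z
  proof -
    from Fd[OF that(1)] obtain s i j l m where e: "e = {lv s i j l, lv s i j m}" "valid t s i j" "(l, m) \<in> LE" by blast
    have "z \<in> convex hull (pos ` {lv s i j l, lv s i j m})" using that(2) e(1) by simp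
    then obtain x y where "lseg l m x y" "z = cpt s i j x y" using hull_cell LE_less5[OF e(3)] by metis
    then show ?thesis using e by blast
  qed
  show "z \<noteq> 0 \<and> gauge t z \<le> 1" if z: "e \<in> F t" "z \<in> convex hull (pos ` e)" for e z
  proof -
    obtain s i j l m x y where h: "valid t s i j" "(l, m) \<in> LE" "lseg l m x y" "z = cpt s i j x y"
      using hull[OF z] by blast
    show ?thesis using gauge_region(1,2)[OF t h(1) _ _ _ h(4)] lseg_region[OF h(2,3)] by simp
  qed
  show "\<exists>v\<in>e. gauge t (pos v) \<noteq> 1" if "e \<in> {e \<in> F t. \<exists>v\<in>e. \<not> bdv t v}" for e
  proof -
    from that obtain v where v: "v \<in> e" "\<not> bdv t v" "e \<in> F t" by auto
    obtain s i j l m where e: "e = {lv s i j l, lv s i j m}" "valid t s i j" "(l, m) \<in> LE" using Fd[OF v(3)] by blast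
    then have "v \<in> W t" using v(1) LE_less5[OF e(3)] by (auto simp: W_def)
    then show ?thesis using bdv_gauge[OF t] v by blast
  qed
  show "z \<in> pos ` e" if z: "e \<in> F t" "z \<in> convex hull (pos ` e)" "gauge t z = 1" for e z
  proof -
    obtain s i j l m x y where h: "e = {lv s i j l, lv s i j m}" "valid t s i j" "(l, m) \<in> LE" "lseg l m x y" "z = cpt s i j x y"
      using hull[OF z(1,2)] by blast
    have "\<exists>k<5. x = lpx k \<and> y = lpy k"
    proof -
      have "x = 0 \<and> y = 0 \<or> x = 5 \<and> y = 0 \<or> x = 0 \<and> y = 5"
        using gauge_region(3)[OF t h(2) _ _ _ h(5)] lseg_region[OF h(3,4)] z(3) by auto
      then show ?thesis
      proof (elim disjE)
        assume "x = 0 \<and> y = 0" then show ?thesis by (intro exI[of _ 0]) (simp add: lpx_def lpy_def)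
      next
        assume "x = 5 \<and> y = 0" then show ?thesis by (intro exI[of _ 1]) (simp add: lpx_def lpy_def)
      next
        assume "x = 0 \<and> y = 5" then show ?thesis by (intro exI[of _ 2]) (simp add: lpx_def lpy_def)
      qed
    qed
    then obtain k where k: "k < 5" "x = lpx k" "y = lpy k" by auto
    then have "k = l \<or> k = m" using lseg_vertex[OF h(3) k(1)] h(4) by simp
    moreover have "z = pos (lv s i j k)" using h(5) k pos_lv by simp
    ultimately show ?thesis using h(1) by auto
  qed
  show "v \<in> e" if z: "e \<in> F t" "v \<in> W t" "pos v \<in> convex hull (pos ` e)" for e v
  proof -
    obtain s i j l m x y where h: "e = {lv s i j l, lv s i j m}" "(l, m) \<in> LE" "lseg l m x y" "pos v = cpt s i j x y"
      using hull[OF z(1,3)] by blast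
    obtain s' i' j' n where n: "v = lv s' i' j' n" "n < 5" using z(2) unfolding W_def by blast
    show ?thesis using vertex_in_cell[OF h(2,3) n(2)] h(1,4) n(1) by blast
  qed
  show "z \<in> pos ` (e \<inter> f)" if z: "e \<in> F t" "f \<in> F t" "e \<noteq> f" "z \<in> convex hull (pos ` e)" "z \<in> convex hull (pos ` f)" for e f z
  proof -
    obtain s i j l m x y where h: "e = {lv s i j l, lv s i j m}" "(l, m) \<in> LE" "lseg l m x y" "z = cpt s i j x y"
      using hull[OF z(1,4)] by blast
    obtain s' i' j' l' m' x' y' where h': "f = {lv s' i' j' l', lv s' i' j' m'}" "(l', m') \<in> LE" "lseg l' m' x' y'" "z = cpt s' i' j' x' y'"
      using hull[OF z(2,5)] by blast
    show ?thesis
    proof (cases "(s, i, j) = (s', i', j')")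
      case True
      then have xy: "x = x'" "y = y'" using h(4) h'(4) by (auto simp: cpt_eq)
      have "(l, m) \<noteq> (l', m')" using z(3) h(1) h'(1) True by auto
      from lseg_cross[OF h(2) h'(2) this h(3)] h'(3) xy obtain n where n: "n \<in> {l, m} \<inter> {l', m'}" "x = lpx n" "y = lpy n" by auto
      then have "n < 5" using LE_less5[OF h(2)] by auto
      then have "z = pos (lv s i j n)" using h(4) n pos_lv by simp
      moreover have "lv s i j n \<in> e \<inter> f" using n(1) h(1) h'(1) True by auto
      ultimately show ?thesis by blast
    next
      case False
      have "cpt s i j x y = cpt s' i' j' x' y'" using h h' by simp
      then obtain k where k: "k < 3" "x = lpx k" "y = lpy k" "x' = lpx k" "y' = lpy k" "lv s i j k = lv s' i' j' k"
        using cell_regions[OF False] lseg_region[OF h(2,3)] lseg_region[OF h'(2,3)] by metis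
      have k5: "k < 5" using k by simp
      have "k = l \<or> k = m" "k = l' \<or> k = m'" using lseg_vertex[OF h(2) k5] lseg_vertex[OF h'(2) k5] h(3) h'(3) k by auto
      then have "lv s i j k \<in> e \<inter> f" using h(1) h'(1) k(6) by auto
      moreover have "z = pos (lv s i j k)" using h(4) k(2,3) pos_lv[OF k5, of s i j] by simp
      ultimately show ?thesis by blast
    qed
  qed
qed

lemma planar_double_triangle:
  assumes t: "1 \<le> t"
  shows "planar (kp t False ` W t \<union> kp t True ` W t,
    (`) (kp t False) ` F t \<union> (`) (kp t True) ` {e \<in> F t. \<exists>v\<in>e. \<not> bdv t v})"
proof -
  interpret straight_half_drawing "gauge t" "W t" "F t" "{e \<in> F t. \<exists>v\<in>e. \<not> bdv t v}" pos
    using half_drawing[OF t] .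
  have k: "kp t b v = \<beta> b v" if "v \<in> W t" for b v
    using bdv_gauge[OF t that] by (simp add: kp_def \<beta>_def)
  then have V: "kp t b ` W t = \<beta> b ` W t" for b by simp
  have kE: "kp t b ` e = \<beta> b ` e" if e: "e \<in> F t" for b e
  proof (rule image_cong[OF refl])
    fix v assume "v \<in> e"
    then have "v \<in> W t" using conjunct1[OF F[OF e]] by (rule rev_subsetD)
    then show "kp t b v = \<beta> b v" by (rule k)
  qed
  have E: "(`) (kp t b) ` A = (`) (\<beta> b) ` A" if A: "A \<subseteq> F t" for b A
    by (rule image_cong[OF refl kE]) (rule subsetD[OF A])
  have sub: "{e \<in> F t. \<exists>v\<in>e. \<not> bdv t v} \<subseteq> F t" by auto
  show ?thesis unfolding V E[OF order_refl] E[OF sub] by (rule planar_double)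
qed

section \<open>The glued graph and the adjacency of its gadgets\<close>

type_synonym cell = "bool \<times> int \<times> int \<times> bool"
type_synonym vert = "(nat \<times> int \<times> int) \<times> bool"

definition cells :: "int \<Rightarrow> cell set" where
  "cells t = {(s, i, j, b). valid t s i j}"

definition bdl :: "int \<Rightarrow> nat \<Rightarrow> int \<Rightarrow> int \<Rightarrow> bool" where
  "bdl t k i j \<longleftrightarrow> k = 0 \<and> i + j = t - 1 \<or> k = 1 \<and> i = - t \<or> k = 2 \<and> j = - t"

definition corner :: "int \<Rightarrow> bool \<Rightarrow> int \<Rightarrow> int \<Rightarrow> bool" where
  "corner t s i j \<longleftrightarrow> \<not> s \<and> (i = - t \<and> j = - t \<or> i + j = t - 1 \<and> (i = - t \<or> j = - t))"

definition loc :: "int \<Rightarrow> cell \<Rightarrow> nat \<Rightarrow> vert" where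
  "loc t c l = (case c of (s, i, j, b) \<Rightarrow> kp t b (lv s i j l))"

text \<open>In a corner triangle two outer vertices are common to front and back. The front keeps a \<open>K\<^sub>4\<close>,
  and the back keeps only the edges from its third outer vertex to these two.\<close>

definition LV :: "int \<Rightarrow> cell \<Rightarrow> nat set" where
  "LV t c = (case c of (s, i, j, b) \<Rightarrow> if corner t s i j then (if b then {0, 1, 2} else {0, 1, 2, 3}) else {0, 1, 2, 3, 4})"

definition LC :: "int \<Rightarrow> cell \<Rightarrow> (nat \<times> nat) set" where
  "LC t c = (case c of (s, i, j, b) \<Rightarrow> if corner t s i j
     then (if b then {(l, m) \<in> {(0, 1), (0, 2), (1, 2)}. \<not> (bdl t l i j \<and> bdl t m i j)}
       else {(0, 1), (0, 2), (1, 2), (0, 3), (1, 3), (2, 3)}) else LE)"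

definition VC :: "int \<Rightarrow> cell \<Rightarrow> vert set" where "VC t c = loc t c ` LV t c"

definition EC :: "int \<Rightarrow> cell \<Rightarrow> vert set set" where
  "EC t c = (\<lambda>(l, m). {loc t c l, loc t c m}) ` LC t c"

definition GV :: "int \<Rightarrow> vert set" where "GV t = (\<Union>c\<in>cells t. VC t c)"

definition GE :: "int \<Rightarrow> vert set set" where "GE t = (\<Union>c\<in>cells t. EC t c)"

text \<open>The cell reached by leaving a cell through its outer vertex \<open>k\<close>.\<close>

fun nb :: "int \<Rightarrow> nat \<Rightarrow> cell \<Rightarrow> cell \<Rightarrow> bool" where
  "nb t k (s, i, j, b) (s', i', j', b') \<longleftrightarrow>
     b' = b \<and> s' = (\<not> s) \<and> i' = i + (if k = 1 then (if s then 1 else - 1) else 0) \<and>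
       j' = j + (if k = 2 then (if s then 1 else - 1) else 0) \<or>
     \<not> s \<and> \<not> s' \<and> i' = i \<and> j' = j \<and> b' = (\<not> b) \<and> bdl t k i j"

lemma LV_less5: "l \<in> LV t c \<Longrightarrow> l < 5"
  by (auto simp: LV_def split: prod.splits if_splits)

text \<open>An outer vertex has the same local number in all of its gadgets, and the tag and
  position of an inner vertex determine its gadget.\<close>

lemma loc_eq_cases:
  assumes c: "c \<in> cells t" "c' \<in> cells t" and l: "l < 5" "m < 5" and eq: "loc t c l = loc t c' m"
  shows "l = m \<and> (c = c' \<or> l < 3 \<and> nb t l c c')"
proof -
  obtain s i j b s' i' j' b' where cc: "c = (s, i, j, b)" "c' = (s', i', j', b')"
    by (metis surj_pair)
  have v: "valid t s i j" "valid t s' i' j'" using c by (auto simp: cells_def cc)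
  have e: "lv s i j l = lv s' i' j' m" "b \<and> \<not> bdv t (lv s i j l) \<longleftrightarrow> b' \<and> \<not> bdv t (lv s' i' j' m)"
    using eq by (auto simp: loc_def cc kp_def)
  have "l = m"
    using e(1) l unfolding less5 by (elim disjE) (auto simp: lv_def split: if_splits)
  moreover have "c = c' \<or> m < 3 \<and> nb t m c c'"
    using l(2) e v unfolding \<open>l = m\<close> less5 cc
    apply (elim disjE)
        apply (cases s; cases s'; cases b; cases b'; simp add: lv_def bdv_def valid_def bdl_def; linarith?)+
    done
  ultimately show ?thesis by simp
qed

text \<open>Passing through an outer vertex changes either the orientation or the copy, never both,
  and so this colour. Distinct gadgets at a common vertex thus have different colours.\<close>

definition col :: "cell \<Rightarrow> bool" where "col c = (case c of (s, i, j, b) \<Rightarrow> s = b)"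

text \<open>Front and back gadget of one corner: the only distinct gadgets that share two
  vertices.\<close>

definition twin :: "int \<Rightarrow> cell \<Rightarrow> cell \<Rightarrow> bool" where
  "twin t c c' \<longleftrightarrow> (\<exists>i j b. c = (False, i, j, b) \<and> c' = (False, i, j, \<not> b) \<and> corner t False i j)"

lemma shared_vertex:
  assumes "c \<in> cells t" "c' \<in> cells t" "c \<noteq> c'" "v \<in> VC t c" "v \<in> VC t c'"
  obtains k where "k < 3" "nb t k c c'" "v = loc t c k" "v = loc t c' k"
proof -
  obtain l m where lm: "l \<in> LV t c" "m \<in> LV t c'" "v = loc t c l" "v = loc t c' m"
    using assms(4,5) by (auto simp: VC_def)
  have "loc t c l = loc t c' m" using lm by simp
  from loc_eq_cases[OF assms(1,2) LV_less5[OF lm(1)] LV_less5[OF lm(2)] this] assms(3) lm that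
  show ?thesis by auto
qed

lemma shared_colour:
  assumes "c \<in> cells t" "c' \<in> cells t" "c \<noteq> c'" "v \<in> VC t c" "v \<in> VC t c'"
  shows "col c \<noteq> col c'"
proof -
  obtain k where "nb t k c c'" using shared_vertex[OF assms] .
  then show ?thesis by (cases c; cases c') (auto simp: col_def)
qed

text \<open>Within one copy the offset determines \<open>k\<close>. So both passages change the
  copy, and two outer vertices of the gadget lie on the boundary.\<close>

lemma nb_two:
  assumes t: "1 \<le> t" and k: "k < 3" "k' < 3" "k \<noteq> k'" and n: "nb t k c c'" "nb t k' c c'"
  shows "twin t c c'"
proof -
  obtain s i j b s' i' j' b' where cc: "c = (s, i, j, b)" "c' = (s', i', j', b')"
    by (metis surj_pair)
  have k3: "k = 0 \<or> k = 1 \<or> k = 2" "k' = 0 \<or> k' = 1 \<or> k' = 2" using k by auto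
  have "\<not> s \<and> \<not> s' \<and> i' = i \<and> j' = j \<and> b' = (\<not> b) \<and> bdl t k i j \<and> bdl t k' i j"
    using n k(3) k3 unfolding cc by (auto split: if_splits)
  then show ?thesis using k(3) k3 t unfolding cc twin_def by (auto simp: corner_def bdl_def)
qed

lemma shared_two:
  assumes t: "1 \<le> t" and c: "c \<in> cells t" "c' \<in> cells t" "c \<noteq> c'" and v: "v \<in> VC t c" "v \<in> VC t c'"
    and w: "w \<in> VC t c" "w \<in> VC t c'" "v \<noteq> w"
  shows "twin t c c'"
proof -
  obtain k where k: "k < 3" "nb t k c c'" "v = loc t c k" using shared_vertex[OF c v] .
  obtain k' where k': "k' < 3" "nb t k' c c'" "w = loc t c k'" using shared_vertex[OF c w(1,2)] .
  have "k \<noteq> k'" using k k' w(3) by auto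
  then show ?thesis using nb_two t k k' by blast
qed

text \<open>A passage within a copy is a translation with sign given by the orientation; a change of
  copy moves nothing. On returning to the start the translations cancel. Four of them would give
  equal sums for \<open>k1\<close>, \<open>k3\<close> and \<open>k2\<close>, \<open>k4\<close>, two
  of them equal consecutive labels, and with none the opposite gadgets coincide.\<close>

lemma nb_four:
  assumes t: "1 \<le> t" and k: "k1 < 3" "k2 < 3" "k3 < 3" "k4 < 3" "k1 \<noteq> k2" "k2 \<noteq> k3" "k3 \<noteq> k4" "k4 \<noteq> k1"
    and n: "nb t k1 c0 c1" "nb t k2 c1 c2" "nb t k3 c2 c3" "nb t k4 c3 c0"
    and ne: "k1 = k3 \<Longrightarrow> c0 \<noteq> c2" "k2 = k4 \<Longrightarrow> c1 \<noteq> c3"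
  shows False
proof -
  obtain s0 i0 j0 b0 s1 i1 j1 b1 where c01: "c0 = (s0, i0, j0, b0)" "c1 = (s1, i1, j1, b1)" by (metis surj_pair)
  obtain s2 i2 j2 b2 s3 i3 j3 b3 where c23: "c2 = (s2, i2, j2, b2)" "c3 = (s3, i3, j3, b3)" by (metis surj_pair)
  have K: "k1 = 0 \<or> k1 = 1 \<or> k1 = 2" "k2 = 0 \<or> k2 = 1 \<or> k2 = 2" "k3 = 0 \<or> k3 = 1 \<or> k3 = 2" "k4 = 0 \<or> k4 = 1 \<or> k4 = 2"
    using k by auto
  define d e :: "nat \<Rightarrow> int" where "d = (\<lambda>k. if k = 1 then 1 else 0)" and "e = (\<lambda>k. if k = 2 then 1 else 0)"
  have step: "\<not> (s \<and> s') \<and> (if s = s' then i' = i \<and> j' = j \<and> b' = (\<not> b)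
      else b' = b \<and> i' = i + (if s then d k else - d k) \<and> j' = j + (if s then e k else - e k))"
    if "nb t k (s, i, j, b) (s', i', j', b')" for k s i j b s' i' j' b'
    using that by (cases s; cases s') (auto simp: d_def e_def)
  note st = step[OF n(1)[unfolded c01]] step[OF n(2)[unfolded c01 c23]] step[OF n(3)[unfolded c23]] step[OF n(4)[unfolded c01 c23]]
  have inj: "k = k'" if "k < 3" "k' < 3" "d k = d k'" "e k = e k'" for k k'
    using that by (auto simp: d_def e_def split: if_splits)
  \<comment> \<open>The labels stand for the vectors (0, 0), (1, 0), (0, 1). Equal sums mean equal
    pairs, so \<open>k1\<close> would be \<open>k2\<close> or \<open>k4\<close>.\<close>
  have two: False if "d k1 + d k3 = d k2 + d k4" "e k1 + e k3 = e k2 + e k4"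
  proof -
    have "d 0 = 0" "d 1 = 1" "d 2 = 0" "e 0 = 0" "e 1 = 0" "e 2 = 1" by (simp_all add: d_def e_def)
    note de = this
    show False
      using K(1)
      apply (elim disjE)
      subgoal using K(2,3,4) k(5-8) that by (elim disjE) (simp_all add: de[unfolded One_nat_def])
      subgoal using K(2,3,4) k(5-8) that by (elim disjE) (simp_all add: de[unfolded One_nat_def])
      subgoal using K(2,3,4) k(5-8) that by (elim disjE) (simp_all add: de[unfolded One_nat_def])
      done
  qed
  \<comment> \<open>Only three labels are available for four places with different
    neighbours.\<close>
  have kk: "k1 = k3 \<or> k2 = k4" using k by linarith
  have ne': "k1 = k3 \<Longrightarrow> \<not> (s0 = s2 \<and> i0 = i2 \<and> j0 = j2 \<and> b0 = b2)" "k2 = k4 \<Longrightarrow> \<not> (s1 = s3 \<and> i1 = i3 \<and> j1 = j3 \<and> b1 = b3)"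
    using ne unfolding c01 c23 by simp_all
  consider "s0 \<and> \<not> s1 \<and> s2 \<and> \<not> s3 \<or> \<not> s0 \<and> s1 \<and> \<not> s2 \<and> s3" | "\<not> s0 \<and> \<not> s1 \<and> \<not> s2 \<and> \<not> s3"
    | "s0 \<and> \<not> s1 \<and> \<not> s2 \<and> \<not> s3" | "\<not> s0 \<and> s1 \<and> \<not> s2 \<and> \<not> s3"
    | "\<not> s0 \<and> \<not> s1 \<and> s2 \<and> \<not> s3" | "\<not> s0 \<and> \<not> s1 \<and> \<not> s2 \<and> s3"
    using st by blast
  then show False
  proof cases
    case 1
    then have "d k1 + d k3 = d k2 + d k4 \<and> e k1 + e k3 = e k2 + e k4"
      using st by (elim disjE) simp_all
    then show ?thesis using two by blast
  next
    case 2
    then show ?thesis using st ne' kk by auto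
  next
    case 3
    then have "d k1 = d k4 \<and> e k1 = e k4" using st by simp
    then show ?thesis using inj k by metis
  next
    case 4
    then have "d k1 = d k2 \<and> e k1 = e k2" using st by simp
    then show ?thesis using inj k by metis
  next
    case 5
    then have "d k2 = d k3 \<and> e k2 = e k3" using st by simp
    then show ?thesis using inj k by metis
  next
    case 6
    then have "d k3 = d k4 \<and> e k3 = e k4" using st by simp
    then show ?thesis using inj k by metis
  qed
qed

text \<open>\<open>nb_four\<close> in terms of vertices: if opposite labels agreed together with the
  opposite gadgets, then so would the vertices.\<close>

lemma ring_four:
  assumes t: "1 \<le> t" and c: "c0 \<in> cells t" "c1 \<in> cells t" "c2 \<in> cells t" "c3 \<in> cells t"
    and ne: "c0 \<noteq> c1" "c1 \<noteq> c2" "c2 \<noteq> c3" "c3 \<noteq> c0"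
    and v: "v1 \<in> VC t c0" "v1 \<in> VC t c1" "v2 \<in> VC t c1" "v2 \<in> VC t c2" "v3 \<in> VC t c2" "v3 \<in> VC t c3"
      "v4 \<in> VC t c3" "v4 \<in> VC t c0"
    and d: "distinct [v1, v2, v3, v4]"
  shows False
proof -
  obtain k1 where k1: "k1 < 3" "nb t k1 c0 c1" "v1 = loc t c0 k1" "v1 = loc t c1 k1" using shared_vertex[OF c(1,2) ne(1) v(1,2)] .
  obtain k2 where k2: "k2 < 3" "nb t k2 c1 c2" "v2 = loc t c1 k2" "v2 = loc t c2 k2" using shared_vertex[OF c(2,3) ne(2) v(3,4)] .
  obtain k3 where k3: "k3 < 3" "nb t k3 c2 c3" "v3 = loc t c2 k3" "v3 = loc t c3 k3" using shared_vertex[OF c(3,4) ne(3) v(5,6)] .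
  obtain k4 where k4: "k4 < 3" "nb t k4 c3 c0" "v4 = loc t c3 k4" "v4 = loc t c0 k4" using shared_vertex[OF c(4,1) ne(4) v(7,8)] .
  have "k1 \<noteq> k2" "k2 \<noteq> k3" "k3 \<noteq> k4" "k4 \<noteq> k1" using d k1 k2 k3 k4 by auto
  moreover have "k1 = k3 \<Longrightarrow> c0 \<noteq> c2" "k2 = k4 \<Longrightarrow> c1 \<noteq> c3" using d k1(3) k3(3) k2(3) k4(3) by auto
  ultimately show False using nb_four[OF t k1(1) k2(1) k3(1) k4(1) _ _ _ _ k1(2) k2(2) k3(2) k4(2)] by blast
qed

text \<open>Each change of gadget along the cycle flips the colour, so the number of changes is
  even. Four changes are excluded by \<open>ring_four\<close>; with two changes the two gadgets
  share two vertices and are twins; with none the cycle stays in one gadget.\<close>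

lemma five_cycle_in_cell:
  assumes t: "1 \<le> t" and c: "c0 \<in> cells t" "c1 \<in> cells t" "c2 \<in> cells t" "c3 \<in> cells t" "c4 \<in> cells t"
    and v: "v0 \<in> VC t c4" "v0 \<in> VC t c0" "v1 \<in> VC t c0" "v1 \<in> VC t c1" "v2 \<in> VC t c1" "v2 \<in> VC t c2"
      "v3 \<in> VC t c2" "v3 \<in> VC t c3" "v4 \<in> VC t c3" "v4 \<in> VC t c4"
    and d: "distinct [v0, v1, v2, v3, v4]"
  shows "\<exists>c\<in>cells t. \<exists>c'\<in>cells t. (c = c' \<or> twin t c c') \<and> {v0, v1, v2, v3, v4} \<subseteq> VC t c \<union> VC t c'"
proof -
  have colne: "col c4 \<noteq> col c0 \<or> c4 = c0" "col c0 \<noteq> col c1 \<or> c0 = c1" "col c1 \<noteq> col c2 \<or> c1 = c2"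
    "col c2 \<noteq> col c3 \<or> c2 = c3" "col c3 \<noteq> col c4 \<or> c3 = c4"
    using shared_colour c v by metis+
  have d': "v0 \<noteq> v1" "v0 \<noteq> v2" "v0 \<noteq> v3" "v0 \<noteq> v4" "v1 \<noteq> v2" "v1 \<noteq> v3" "v1 \<noteq> v4" "v2 \<noteq> v3" "v2 \<noteq> v4" "v3 \<noteq> v4"
    using d by auto
  have fin: ?thesis if "x \<in> cells t" "y \<in> cells t" "x = y \<or> p \<in> VC t x \<and> p \<in> VC t y \<and> q \<in> VC t x \<and> q \<in> VC t y \<and> p \<noteq> q"
    "{v0, v1, v2, v3, v4} \<subseteq> VC t x \<union> VC t y" for x y p q
    using that shared_two[OF t that(1,2), of p q] by blast
  show ?thesis
  proof (cases "c4 = c0")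
    case e4: True
    show ?thesis
    proof (cases "c0 = c1")
      case e0: True
      show ?thesis
      proof (cases "c1 = c2")
        case e1: True
        show ?thesis by (rule fin[of c4 c3 v3 v4]) (use c v d' e4 e0 e1 in auto)
      next
        case n1: False
        show ?thesis
        proof (cases "c2 = c3")
          case True
          show ?thesis by (rule fin[of c4 c3 v2 v4]) (use c v d' e4 e0 True in auto)
        next
          case False
          then have "c3 = c4" using colne n1 e4 e0 by metis
          then show ?thesis by (intro fin[of c4 c2 v2 v3]) (use c v d' e4 e0 in auto)
        qed
      qed
    next
      case n0: False
      show ?thesis
      proof (cases "c1 = c2")
        case e1: True
        show ?thesis
        proof (cases "c2 = c3")
          case True
          show ?thesis by (rule fin[of c4 c3 v1 v4]) (use c v d' e4 e1 True in auto)
        next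
          case False
          then have "c3 = c4" using colne n0 e4 e1 by metis
          then show ?thesis by (intro fin[of c4 c2 v1 v3]) (use c v d' e4 e1 in auto)
        qed
      next
        case n1: False
        show ?thesis
        proof (cases "c2 = c3")
          case True
          then have "c3 = c4" using colne n0 n1 e4 by metis
          then show ?thesis by (intro fin[of c4 c1 v1 v2]) (use c v d' e4 True in auto)
        next
          case False
          have "c3 \<noteq> c4" using colne n0 n1 e4 False by metis
          then show ?thesis
            using ring_four[OF t c(1,2,3,4) n0 n1 False _ v(3-9), of ] v(10) d' e4 by auto
        qed
      qed
    qed
  next
    case n4: False
    show ?thesis
    proof (cases "c0 = c1")
      case e0: True
      show ?thesis
      proof (cases "c1 = c2")
        case e1: True
        show ?thesis
        proof (cases "c2 = c3")
          case True
          show ?thesis by (rule fin[of c4 c3 v0 v4]) (use c v d' n4 e0 e1 True in auto)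
        next
          case False
          then have "c3 = c4" using colne n4 e0 e1 by metis
          then show ?thesis by (intro fin[of c4 c2 v0 v3]) (use c v d' e0 e1 in auto)
        qed
      next
        case n1: False
        show ?thesis
        proof (cases "c2 = c3")
          case True
          then have "c3 = c4" using colne n4 e0 n1 by metis
          then show ?thesis by (intro fin[of c4 c1 v0 v2]) (use c v d' e0 True in auto)
        next
          case False
          have "c3 \<noteq> c4" using colne n4 e0 n1 False by metis
          then show ?thesis
            using ring_four[OF t c(5,2,3,4) _ n1 False _ _ _ v(5-9) v(10), of v0] n4 e0 v d' by auto
        qed
      qed
    next
      case n0: False
      show ?thesis
      proof (cases "c1 = c2")
        case e1: True
        show ?thesis
        proof (cases "c2 = c3")
          case True
          then have "c3 = c4" using colne n4 n0 e1 by metis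
          then show ?thesis by (intro fin[of c4 c0 v0 v1]) (use c v d' e1 True in auto)
        next
          case False
          have "c3 \<noteq> c4" using colne n4 n0 e1 False by metis
          then show ?thesis
            using ring_four[OF t c(5,1,3,4) n4 _ False _ v(1,2,3) _ v(7-10)] n0 e1 v d' by auto
        qed
      next
        case n1: False
        show ?thesis
        proof (cases "c2 = c3")
          case True
          have "c3 \<noteq> c4" using colne n4 n0 n1 True by metis
          then show ?thesis
            using ring_four[OF t c(5,1,2,4) n4 n0 _ _ v(1-5) _ v(9,10)] n1 True v d' by auto
        next
          case False
          have "c3 = c4" using colne n4 n0 n1 False by metis
          then show ?thesis
            using ring_four[OF t c(5,1,2,3) n4 n0 n1 _ v(1-6) v(7)] False v d' by auto
        qed
      qed
    qed
  qed
qed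

section \<open>No forbidden subgraph in the glued graph\<close>

lemma GE_cell:
  assumes "e \<in> GE t" "x \<in> e" "y \<in> e"
  obtains c where "c \<in> cells t" "x \<in> VC t c" "y \<in> VC t c"
proof -
  obtain c where c: "c \<in> cells t" "e \<in> EC t c" using assms(1) by (auto simp: GE_def)
  have "e \<subseteq> VC t c"
    using c(2) unfolding EC_def VC_def LC_def LV_def LE_def by (auto split: prod.splits if_splits)
  then show ?thesis using that c assms by blast
qed

lemma VC_card: "finite (VC t c) \<and> card (VC t c) \<le> card (LV t c)"
  unfolding VC_def by (auto simp: LV_def card_image_le split: prod.splits)

lemma twin_LV:
  assumes "twin t c c'"
  shows "LV t c \<subseteq> {0, 1, 2, 3}" "LV t c' \<subseteq> {0, 1, 2, 3}" "LV t c = {0, 1, 2} \<or> LV t c' = {0, 1, 2}"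
proof -
  obtain i j b where ij: "c = (False, i, j, b)" "c' = (False, i, j, \<not> b)" "corner t False i j"
    using assms unfolding twin_def by blast
  show "LV t c \<subseteq> {0, 1, 2, 3}" "LV t c' \<subseteq> {0, 1, 2, 3}" "LV t c = {0, 1, 2} \<or> LV t c' = {0, 1, 2}"
    unfolding ij(1,2) by (cases b; simp add: LV_def ij(3))+
qed

lemma corner_flags:
  assumes "corner t s i j" "k < 3" "k' < 3" "k \<noteq> k'"
  shows "bdl t k i j \<or> bdl t k' i j"
  using assms by (auto simp: corner_def bdl_def less_Suc_eq numeral_3_eq_3)

lemma loc_corner: "k < 3 \<Longrightarrow> loc t (False, i, j, b) k = ((k, i, j), b \<and> \<not> bdl t k i j)"
  by (auto simp: loc_def kp_def lv_def bdv_def bdl_def)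

text \<open>The outer vertex of a corner gadget lying on one side only: its two copies are the only
  vertices of the gadget that have neighbours outside.\<close>

lemma twin_outside:
  assumes t: "1 \<le> t" and tw: "twin t c c'" and c: "c \<in> cells t" "c' \<in> cells t" "d \<in> cells t" "d \<noteq> c" "d \<noteq> c'"
    and v: "v \<in> VC t c \<union> VC t c'" "v \<in> VC t d"
  shows "\<exists>i j k b. v = ((k, i, j), b) \<and> k < 3 \<and> corner t False i j \<and> \<not> bdl t k i j \<and> (\<exists>b'. c = (False, i, j, b'))"
proof -
  obtain i j b where ij: "c = (False, i, j, b)" "c' = (False, i, j, \<not> b)" "corner t False i j" using tw by (auto simp: twin_def)
  have "\<exists>f. v \<in> VC t (False, i, j, f) \<and> (False, i, j, f) \<in> cells t" using v(1) c ij by auto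
  then obtain f where f: "v \<in> VC t (False, i, j, f)" "(False, i, j, f) \<in> cells t" by auto
  have "d \<noteq> (False, i, j, f)" "d \<noteq> (False, i, j, \<not> f)" using c(4,5) ij by (cases b; cases f; auto)+
  then obtain k where k: "k < 3" "nb t k d (False, i, j, f)" "v = loc t (False, i, j, f) k"
    using shared_vertex[OF c(3) f(2) _ v(2) f(1)] by metis
  \<comment> \<open>At a boundary vertex the only two gadgets are the front and the back one, here
    the twins themselves.\<close>
  have "\<not> bdl t k i j"
  proof
    assume b: "bdl t k i j"
    obtain s' i' j' b' where d: "d = (s', i', j', b')" by (metis surj_pair)
    have "s'" using k(2) \<open>d \<noteq> (False, i, j, \<not> f)\<close> \<open>d \<noteq> (False, i, j, f)\<close> unfolding d by auto
    moreover have "valid t s' i' j'" using c(3) d by (simp add: cells_def)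
    ultimately show False using k(1,2) b unfolding d
      by (auto simp: valid_def bdl_def split: if_splits)
  qed
  then show ?thesis using k loc_corner[OF k(1)] ij by auto
qed

text \<open>The 5-cycle fills the at most five vertices of a gadget or of two twins, so
  \<open>w\<close> lies outside. For one gadget, the cells of \<open>{w, a}\<close> and
  \<open>{w, b}\<close> have the same colour, hence coincide, and share \<open>a\<close> and
  \<open>b\<close> with the gadget; it would be a twin and have at most four vertices. For twins,
  \<open>a\<close> and \<open>b\<close> must be the two copies of the outer vertex off the boundary,
  which no gadget contains together.\<close>

lemma theta_free:
  assumes t: "1 \<le> t" and d: "distinct [a, b, c, d, e, w]"
    and E: "{a, b} \<in> GE t" "{b, c} \<in> GE t" "{c, d} \<in> GE t" "{d, e} \<in> GE t" "{e, a} \<in> GE t" "{w, a} \<in> GE t" "{w, b} \<in> GE t"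
  shows False
proof -
  have cell: "\<exists>C\<in>cells t. x \<in> VC t C \<and> y \<in> VC t C" if "{x, y} \<in> GE t" for x y
    using GE_cell[OF that, of x y] by blast
  from cell[OF E(1)] obtain c0 where c0: "c0 \<in> cells t" "a \<in> VC t c0" "b \<in> VC t c0" by blast
  from cell[OF E(2)] obtain c1 where c1: "c1 \<in> cells t" "b \<in> VC t c1" "c \<in> VC t c1" by blast
  from cell[OF E(3)] obtain c2 where c2: "c2 \<in> cells t" "c \<in> VC t c2" "d \<in> VC t c2" by blast
  from cell[OF E(4)] obtain c3 where c3: "c3 \<in> cells t" "d \<in> VC t c3" "e \<in> VC t c3" by blast
  from cell[OF E(5)] obtain c4 where c4: "c4 \<in> cells t" "e \<in> VC t c4" "a \<in> VC t c4" by blast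
  from cell[OF E(6)] obtain c5 where c5: "c5 \<in> cells t" "w \<in> VC t c5" "a \<in> VC t c5" by blast
  from cell[OF E(7)] obtain c6 where c6: "c6 \<in> cells t" "w \<in> VC t c6" "b \<in> VC t c6" by blast
  note C = c0(1) c1(1) c2(1) c3(1) c4(1) c5(1) c6(1)
  note v = c0(2,3) c1(2,3) c2(2,3) c3(2,3) c4(2,3) c5(2,3) c6(2,3)
  have d5: "distinct [a, b, c, d, e]" using d by auto
  have "card {a, b, c, d, e} = 5" using d5 by simp
  from five_cycle_in_cell[OF t C(1-5) v(10,1-9) d5] obtain x y where xy: "x \<in> cells t" "y \<in> cells t"
    "x = y \<or> twin t x y" "{a, b, c, d, e} \<subseteq> VC t x \<union> VC t y" by blast
  have five: "5 \<le> card A" if "{a, b, c, d, e} \<subseteq> A" "finite A" for A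
    using card_mono[OF that(2,1)] \<open>card {a, b, c, d, e} = 5\<close> by simp
  have wout: "w \<notin> A" if "{a, b, c, d, e} \<subseteq> A" "finite A" "card A \<le> 5" for A
  proof
    assume "w \<in> A"
    have "{a, b, c, d, e} = A" using card_subset_eq[OF that(2,1)] five[OF that(1,2)] that(3) \<open>card {a, b, c, d, e} = 5\<close> by simp
    then show False using \<open>w \<in> A\<close> d by auto
  qed
  show False
  proof (cases "x = y")
    case True
    then have sub: "{a, b, c, d, e} \<subseteq> VC t x" using xy by simp
    have "card (LV t x) \<le> 5" by (auto simp: LV_def split: prod.splits)
    then have "w \<notin> VC t x" using wout[OF sub] VC_card[of t x] by auto
    then have n: "c5 \<noteq> x" "c6 \<noteq> x" using v by auto
    have "col c5 \<noteq> col x" "col c6 \<noteq> col x"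
      using shared_colour[OF C(6) xy(1) n(1), of a] shared_colour[OF C(7) xy(1) n(2), of b] v sub by auto
    then have "c5 = c6" using shared_colour[OF C(6,7)] v by blast
    then have "twin t c5 x" using shared_two[OF t C(6) xy(1) n(1), of a b] v sub d by auto
    then have "card (LV t x) \<le> card {0, 1, 2, 3::nat}" using twin_LV(2) by (intro card_mono) auto
    then show False using five[OF sub] VC_card[of t x] by simp
  next
    case False
    then have tw: "twin t x y" using xy(3) by blast
    let ?A = "VC t x \<union> VC t y"
    \<comment> \<open>Four vertices in front, and the back copy of the one outer vertex that is off
      the boundary.\<close>
    have A5: "card ?A \<le> 5"
    proof -
      obtain i j f where ij: "x = (False, i, j, f)" "y = (False, i, j, \<not> f)" "corner t False i j" using tw by (auto simp: twin_def)
      have "VC t (False, i, j, True) \<union> VC t (False, i, j, False) \<subseteq>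
        {loc t (False, i, j, False) 0, loc t (False, i, j, False) 1, loc t (False, i, j, False) 2, loc t (False, i, j, False) 3}
        \<union> loc t (False, i, j, True) ` {k. k < 3 \<and> \<not> bdl t k i j}" (is "_ \<subseteq> ?B \<union> ?D")
        using ij(3) by (auto simp: VC_def LV_def loc_corner)
      moreover have "finite {k. k < 3 \<and> \<not> bdl t k i j}" by simp
      moreover have "card {k. k < 3 \<and> \<not> bdl t k i j} \<le> 1"
        using corner_flags[OF ij(3)] by (subst card_le_Suc0_iff_eq[unfolded One_nat_def[symmetric]]) auto
      ultimately have "card (VC t (False, i, j, True) \<union> VC t (False, i, j, False)) \<le> card (?B \<union> ?D)" "card ?D \<le> 1"
        using card_image_le[of "{k. k < 3 \<and> \<not> bdl t k i j}" "loc t (False, i, j, True)"]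
        by (intro card_mono, auto)
      moreover have "card (?B \<union> ?D) \<le> card ?B + card ?D" by (rule card_Un_le)
      moreover have "card ?B \<le> 4" by (simp add: card_insert_if)
      moreover have "?A = VC t (False, i, j, True) \<union> VC t (False, i, j, False)" using ij by (cases f) auto
      ultimately show ?thesis by simp
    qed
    have finA: "finite ?A" using VC_card by blast
    have w: "w \<notin> ?A" using wout[OF xy(4) finA A5] .
    then have n: "c5 \<noteq> x" "c5 \<noteq> y" "c6 \<noteq> x" "c6 \<noteq> y" using v by auto
    obtain i j k f where a: "a = ((k, i, j), f)" "k < 3" "corner t False i j" "\<not> bdl t k i j" "\<exists>b'. x = (False, i, j, b')"
      using twin_outside[OF t tw xy(1,2) C(6) n(1,2), of a] xy(4) v by auto
    obtain i' j' k' f' where b: "b = ((k', i', j'), f')" "k' < 3" "\<not> bdl t k' i' j'" "\<exists>b'. x = (False, i', j', b')"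
      using twin_outside[OF t tw xy(1,2) C(7) n(3,4), of b] xy(4) v by auto
    have ij: "i' = i" "j' = j" using a(5) b(4) by auto
    \<comment> \<open>Only one outer vertex is off the boundary, so \<open>a\<close> and
      \<open>b\<close> differ just in the flag; yet both lie in \<open>c0\<close>, the gadget of the
      edge \<open>{a, b}\<close>, where vertices off the boundary have equal flags.\<close>
    have "k' = k" using corner_flags[OF a(3) a(2) b(2)] a(4) b(3) ij by auto
    then have ff: "f' = (\<not> f)" using a(1) b(1) ij d by auto
    obtain s0 i0 j0 b0 where c0: "c0 = (s0, i0, j0, b0)" by (metis surj_pair)
    obtain l m where lm: "a = loc t c0 l" "b = loc t c0 m" "l \<in> LV t c0" "m \<in> LV t c0" using v(1,2) by (auto simp: VC_def)
    have nb': "\<not> bdv t (k, i, j)" using a(4) by (simp add: bdv_def bdl_def)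
    have "f = b0" "f' = b0"
      using lm nb' a(1) b(1) ij \<open>k' = k\<close> unfolding c0 by (auto simp: loc_def kp_def)
    then show False using ff by simp
  qed
qed

section \<open>The glued graph inside the doubled drawing\<close>

lemma LC_LE: "(l, m) \<in> LC t c \<Longrightarrow> (l, m) \<in> LE"
  by (auto simp: LC_def LE_def split: prod.splits if_splits)

lemma bdv_lv:
  assumes "valid t s i j" "l < 5"
  shows "bdv t (lv s i j l) \<longleftrightarrow> \<not> s \<and> l < 3 \<and> bdl t l i j"
  using assms unfolding less5 by (elim disjE) (auto simp: bdv_def lv_def bdl_def valid_def)

lemma two_bdl_corner: "l < 3 \<Longrightarrow> m < 3 \<Longrightarrow> l \<noteq> m \<Longrightarrow> bdl t l i j \<Longrightarrow> bdl t m i j \<Longrightarrow> corner t False i j"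
  by (auto simp: bdl_def corner_def)

text \<open>A gadget with two outer vertices on the boundary is a corner gadget, and in the back the
  edge between these two is left out. So back edges are among those that the doubled drawing
  provides.\<close>

lemma EC_back:
  assumes c: "(s, i, j, True) \<in> cells t" and lm: "(l, m) \<in> LC t (s, i, j, True)"
  shows "\<not> bdv t (lv s i j l) \<or> \<not> bdv t (lv s i j m)"
proof (rule ccontr)
  assume neg: "\<not> ?thesis"
  have v: "valid t s i j" using c by (simp add: cells_def)
  have LE: "(l, m) \<in> LE" using LC_LE[OF lm] .
  note l5 = LE_less5[OF LE]
  have b: "\<not> s" "l < 3" "m < 3" "bdl t l i j" "bdl t m i j"
    using neg bdv_lv[OF v] l5 by auto
  then have "corner t s i j" using two_bdl_corner[of l m t i j] l5 by auto
  then show False using lm b by (auto simp: LC_def)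
qed

lemma EC_double:
  assumes c: "c \<in> cells t" and e: "e \<in> EC t c"
  shows "e \<in> (`) (kp t False) ` F t \<union> (`) (kp t True) ` {e \<in> F t. \<exists>v\<in>e. \<not> bdv t v}"
proof -
  obtain s i j b where cc: "c = (s, i, j, b)" by (metis surj_pair)
  obtain l m where lm: "(l, m) \<in> LC t c" "e = {loc t c l, loc t c m}" using e by (auto simp: EC_def)
  have v: "valid t s i j" using c by (simp add: cells_def cc)
  let ?f = "{lv s i j l, lv s i j m}"
  have f: "?f \<in> F t" using v LC_LE[OF lm(1)] unfolding F_def by blast
  have e': "e = kp t b ` ?f" using lm(2) by (simp add: loc_def cc)
  show ?thesis
  proof (cases b)
    case True
    then have "\<not> bdv t (lv s i j l) \<or> \<not> bdv t (lv s i j m)" using EC_back[of s i j t l m] c lm(1) cc by simp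
    then have "?f \<in> {e \<in> F t. \<exists>v\<in>e. \<not> bdv t v}" using f by blast
    then show ?thesis by (intro UnI2 image_eqI[of _ _ ?f]) (use e' True in simp_all)
  next
    case False
    then show ?thesis by (intro UnI1 image_eqI[of _ _ ?f]) (use e' f in simp_all)
  qed
qed

lemma LC_LV: "(l, m) \<in> LC t c \<Longrightarrow> l \<in> LV t c \<and> m \<in> LV t c"
  by (auto simp: LC_def LV_def LE_def split: prod.splits if_splits)

lemma loc_inj:
  assumes "c \<in> cells t" "l < 5" "m < 5" "loc t c l = loc t c m"
  shows "l = m"
  using loc_eq_cases[OF assms(1,1,2,3,4)] by blast

lemma finite_cells: "finite (cells t)"
proof (rule finite_subset)
  show "cells t \<subseteq> UNIV \<times> {- t..2 * t} \<times> {- t..2 * t} \<times> UNIV"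
    by (auto simp: cells_def valid_def split: if_splits)
qed simp

lemma simple_G: "simple_graph (GV t, GE t)"
  unfolding simple_graph_def
proof (intro conjI ballI, unfold fst_conv snd_conv)
  show "finite (GV t)" unfolding GV_def using finite_cells VC_card by blast
  fix e assume "e \<in> GE t"
  then obtain c l m where c: "c \<in> cells t" "(l, m) \<in> LC t c" "e = {loc t c l, loc t c m}"
    by (auto simp: GE_def EC_def)
  show "e \<subseteq> GV t" using c LC_LV[OF c(2)] unfolding GV_def VC_def by blast
  have "loc t c l \<noteq> loc t c m" using loc_inj[OF c(1)] LE_less5[OF LC_LE[OF c(2)]] by blast
  then show "card e = 2" using c(3) by simp
qed

lemma planar_G:
  assumes t: "1 \<le> t"
  shows "planar (GV t, GE t)"
proof (rule planar_subgraph[OF planar_double_triangle[OF t]], unfold fst_conv snd_conv)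
  show "GV t \<subseteq> kp t False ` W t \<union> kp t True ` W t"
  proof
    fix x assume "x \<in> GV t"
    then obtain c l where c: "c \<in> cells t" "l \<in> LV t c" "x = loc t c l" by (auto simp: GV_def VC_def)
    obtain s i j b where cc: "c = (s, i, j, b)" by (metis surj_pair)
    have "lv s i j l \<in> W t" using c(1) LV_less5[OF c(2)] unfolding W_def cells_def cc by blast
    moreover have "x = kp t b (lv s i j l)" using c(3) cc by (simp add: loc_def)
    ultimately show "x \<in> kp t False ` W t \<union> kp t True ` W t" by (cases b) auto
  qed
  show "GE t \<subseteq> (`) (kp t False) ` F t \<union> (`) (kp t True) ` {e \<in> F t. \<exists>v\<in>e. \<not> bdv t v}"
    unfolding GE_def by (intro UN_least subsetI EC_double)
  fix e assume "e \<in> GE t"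
  then show "e \<subseteq> GV t" using simple_G[of t] by (simp add: simple_graph_def)
qed

lemma free_G:
  assumes t: "1 \<le> t"
  shows "\<not> contains_subgraph (GV t, GE t) Theta_6_2"
proof
  assume "contains_subgraph (GV t, GE t) Theta_6_2"
  then obtain f where f: "inj_on f {1..6::nat}"
    and E: "\<forall>e\<in>{{1, 2}, {2, 3}, {3, 4}, {4, 5}, {5, 6}, {6, 1}} \<union> {{1, 3}}. f ` e \<in> GE t"
    unfolding contains_subgraph_def Theta_6_2_def by auto
  have ne: "f x \<noteq> f y" if "x \<in> {1..6}" "y \<in> {1..6}" "x \<noteq> y" for x y using inj_onD[OF f] that by blast
  have "distinct [f 1, f 3, f 4, f 5, f 6, f 2]" by (simp add: ne)
  moreover have "{f 1, f 3} \<in> GE t" "{f 3, f 4} \<in> GE t" "{f 4, f 5} \<in> GE t" "{f 5, f 6} \<in> GE t" "{f 6, f 1} \<in> GE t"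
    "{f 2, f 1} \<in> GE t" "{f 2, f 3} \<in> GE t"
    using E by (simp_all add: insert_commute)
  ultimately show False using theta_free[OF t] by blast
qed

section \<open>Counting vertices and edges\<close>

definition Co :: "int \<Rightarrow> cell set" where
  "Co t = {(False, - t, - t, False), (False, - t, - t, True), (False, - t, 2 * t - 1, False),
    (False, - t, 2 * t - 1, True), (False, 2 * t - 1, - t, False), (False, 2 * t - 1, - t, True)}"

lemma corner_Co:
  assumes "1 \<le> t" "(s, i, j, b) \<in> cells t"
  shows "corner t s i j \<longleftrightarrow> (s, i, j, b) \<in> Co t"
  using assms by (cases b) (auto simp: corner_def Co_def cells_def valid_def)

lemma Co_cells: "1 \<le> t \<Longrightarrow> Co t \<subseteq> cells t"
  by (auto simp: Co_def cells_def valid_def)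

text \<open>For counts that are \<open>r\<close> on ordinary gadgets and \<open>r0\<close>,
  \<open>r1\<close> on front and back corners. The six exceptional gadgets are moved to the left
  because subtraction on \<open>nat\<close> truncates.\<close>

lemma sum_cells:
  fixes h :: "cell \<Rightarrow> nat"
  assumes t: "1 \<le> t" and h: "\<And>c. c \<in> cells t - Co t \<Longrightarrow> h c = r"
    and h0: "\<And>i j. corner t False i j \<Longrightarrow> h (False, i, j, False) = r0 \<and> h (False, i, j, True) = r1"
  shows "(\<Sum>c\<in>cells t. h c) + 6 * r = r * card (cells t) + 3 * r0 + 3 * r1"
proof -
  have d: "- t \<noteq> 2 * t - 1" using t by simp
  have c6: "card (Co t) = 6" unfolding Co_def using d by (simp add: card_insert_if)
  have fin: "finite (cells t)" "finite (Co t)" using finite_cells by (auto simp: Co_def)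
  have cr: "corner t False (- t) (- t)" "corner t False (- t) (2 * t - 1)" "corner t False (2 * t - 1) (- t)"
    by (auto simp: corner_def)
  have "(\<Sum>c\<in>cells t. h c) = (\<Sum>c\<in>cells t - Co t. h c) + (\<Sum>c\<in>Co t. h c)"
    using sum.subset_diff[OF Co_cells[OF t] fin(1)] .
  also have "(\<Sum>c\<in>cells t - Co t. h c) = r * card (cells t - Co t)" using h by simp
  also have "(\<Sum>c\<in>Co t. h c) = 3 * r0 + 3 * r1"
    unfolding Co_def using d h0[OF cr(1)] h0[OF cr(2)] h0[OF cr(3)] by simp
  also have "card (cells t - Co t) = card (cells t) - 6" using card_Diff_subset[OF fin(2) Co_cells[OF t]] c6 by simp
  finally have s: "sum h (cells t) = r * (card (cells t) - 6) + (3 * r0 + 3 * r1)" .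
  have "6 \<le> card (cells t)" using card_mono[OF fin(1) Co_cells[OF t]] c6 by simp
  from le_Suc_ex[OF this] obtain q where q: "card (cells t) = 6 + q" ..
  show ?thesis using s unfolding q by (simp add: distrib_left)
qed

lemma EC_card:
  assumes c: "c \<in> cells t"
  shows "card (EC t c) = card (LC t c)"
proof -
  have "inj_on (\<lambda>(l, m). {loc t c l, loc t c m}) (LC t c)"
  proof (rule inj_onI, clarify)
    fix l m l' m' assume a: "(l, m) \<in> LC t c" "(l', m') \<in> LC t c" "{loc t c l, loc t c m} = {loc t c l', loc t c m'}"
    note L = LE_less5[OF LC_LE[OF a(1)]] LE_less5[OF LC_LE[OF a(2)]]
    have "l = l' \<and> m = m' \<or> l = m' \<and> m = l'"
      using a(3) loc_inj[OF c] L by (auto simp: doubleton_eq_iff)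
    moreover have "l < m" "l' < m'" using LC_LE[OF a(1)] LC_LE[OF a(2)] by (auto simp: LE_def)
    ultimately show "l = l' \<and> m = m'" by auto
  qed
  then show ?thesis unfolding EC_def by (rule card_image)
qed

text \<open>Only twins share two vertices, and of these the back one has a raised flag on every
  edge, which no front edge has.\<close>

lemma EC_disjoint:
  assumes t: "1 \<le> t" and c: "c \<in> cells t" "c' \<in> cells t" "c \<noteq> c'"
  shows "EC t c \<inter> EC t c' = {}"
proof (rule ccontr)
  assume "\<not> ?thesis"
  then obtain l m l' m' where lm: "(l, m) \<in> LC t c" "(l', m') \<in> LC t c'" and eq: "{loc t c l, loc t c m} = {loc t c' l', loc t c' m'}"
    by (auto simp: EC_def)
  have V: "loc t c l \<in> VC t c" "loc t c m \<in> VC t c" "loc t c' l' \<in> VC t c'" "loc t c' m' \<in> VC t c'"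
    using LC_LV[OF lm(1)] LC_LV[OF lm(2)] by (auto simp: VC_def)
  have "loc t c l \<noteq> loc t c m" using loc_inj[OF c(1)] LE_less5[OF LC_LE[OF lm(1)]] by blast
  moreover have "loc t c l \<in> VC t c'" "loc t c m \<in> VC t c'" using V(3,4) eq by (metis insert_iff singletonD)+
  ultimately have "twin t c c'" using shared_two[OF t c V(1) _ V(2)] by blast
  then obtain i j b where ij: "c = (False, i, j, b)" "c' = (False, i, j, \<not> b)" by (auto simp: twin_def)
  have flag: "\<not> snd (loc t (s, i, j, False) k)" for s i j k by (simp add: loc_def kp_def)
  have bk: "snd (loc t (False, i, j, True) p) \<or> snd (loc t (False, i, j, True) q)"
    if "(False, i, j, True) \<in> cells t" "(p, q) \<in> LC t (False, i, j, True)" for p q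
    using EC_back[OF that] by (auto simp: loc_def kp_def)
  have sn: "{snd (loc t c l), snd (loc t c m)} = {snd (loc t c' l'), snd (loc t c' m')}"
    using arg_cong[OF eq, of "image snd"] by simp
  show False
  proof (cases b)
    case True
    then show False using bk[of l m] c(1) lm(1) ij sn flag by (auto simp: doubleton_eq_iff)
  next
    case False
    then show False using bk[of l' m'] c(2) lm(2) ij sn flag by (auto simp: doubleton_eq_iff)
  qed
qed

text \<open>Nine edges per gadget; a corner has 6 + 2 in place of 18, so the three corners lose
  30.\<close>

lemma card_GE:
  assumes t: "1 \<le> t"
  shows "card (GE t) + 30 = 9 * card (cells t)"
proof -
  have "LC t c \<subseteq> LE" for c using LC_LE by (rule subrelI)
  moreover have "finite LE" by (simp add: LE_def)
  ultimately have "finite (LC t c)" for c by (rule finite_subset)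
  then have "finite (EC t c)" for c unfolding EC_def by (rule finite_imageI)
  then have "card (GE t) = (\<Sum>c\<in>cells t. card (EC t c))"
    unfolding GE_def using EC_disjoint[OF t] finite_cells by (intro card_UN_disjoint) auto
  also have "\<dots> = (\<Sum>c\<in>cells t. card (LC t c))" using EC_card by simp
  finally have e: "card (GE t) = (\<Sum>c\<in>cells t. card (LC t c))" .
  have "(\<Sum>c\<in>cells t. card (LC t c)) + 6 * 9 = 9 * card (cells t) + 3 * 6 + 3 * 2"
  proof (rule sum_cells[OF t])
    fix c assume c: "c \<in> cells t - Co t"
    obtain s i j b where cc: "c = (s, i, j, b)" by (metis surj_pair)
    have "LC t c = LE" using c corner_Co[OF t, of s i j b] by (simp add: cc LC_def)
    then show "card (LC t c) = 9" by (simp add: LE_def)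
  next
    fix i j assume cr: "corner t False i j"
    have ins: "{(l, m) \<in> insert (p, q) A. P l m} =
      (if P p q then insert (p, q) {(l, m) \<in> A. P l m} else {(l, m) \<in> A. P l m})" for p q :: nat and A P
      by auto
    have "card (LC t (False, i, j, False)) = 6" using cr by (simp add: LC_def)
    \<comment> \<open>Exactly two outer vertices of a corner lie on the boundary, which removes one
      of the three edges in the back.\<close>
    moreover have "bdl t 0 i j \<and> bdl t 1 i j \<and> \<not> bdl t 2 i j \<or> bdl t 0 i j \<and> \<not> bdl t 1 i j \<and> bdl t 2 i j \<or>
      \<not> bdl t 0 i j \<and> bdl t 1 i j \<and> bdl t 2 i j"
      using cr t unfolding bdl_def corner_def by presburger
    then have "card {(l, m) \<in> {(0, 1), (0, 2), (1, 2)}. \<not> (bdl t l i j \<and> bdl t m i j)} = 2"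
      by (elim disjE conjE) (simp_all only: ins, simp_all)
    then have "card (LC t (False, i, j, True)) = 2" using cr by (simp only: LC_def prod.case if_True)
    ultimately show "card (LC t (False, i, j, False)) = 6 \<and> card (LC t (False, i, j, True)) = 2" by simp
  qed
  then show ?thesis using e by simp
qed

text \<open>Through a boundary vertex one passes to the other copy, through any other outer vertex
  to the lattice neighbour, which is valid because the vertex is off the boundary.\<close>

lemma partner:
  assumes "c \<in> cells t" "k < 3"
  obtains c' where "c' \<in> cells t" "loc t c' k = loc t c k" "col c' \<noteq> col c"
proof -
  obtain s i j b where cc: "c = (s, i, j, b)" by (metis surj_pair)
  have v: "valid t s i j" using assms(1) by (simp add: cells_def cc)
  have k: "k = 0 \<or> k = 1 \<or> k = 2" using assms(2) by auto
  show ?thesis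
  proof (cases "\<not> s \<and> bdl t k i j")
    case True
    show ?thesis
    proof (rule that[of "(False, i, j, \<not> b)"])
      show "(False, i, j, \<not> b) \<in> cells t" using v True by (simp add: cells_def)
      show "loc t (False, i, j, \<not> b) k = loc t c k" using True loc_corner[OF assms(2)] cc by simp
      show "col (False, i, j, \<not> b) \<noteq> col c" using True cc by (simp add: col_def)
    qed
  next
    case False
    let ?d = "if s then 1 else - 1 :: int"
    let ?i = "i + (if k = 1 then ?d else 0)" and ?j = "j + (if k = 2 then ?d else 0)"
    show ?thesis
    proof (rule that[of "(\<not> s, ?i, ?j, b)"])
      show "(\<not> s, ?i, ?j, b) \<in> cells t"
        using k v False by (elim disjE; cases s; simp add: cells_def valid_def bdl_def; linarith?)
      show "loc t (\<not> s, ?i, ?j, b) k = loc t c k"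
        using k by (elim disjE; cases s; simp add: loc_def cc lv_def)
      show "col (\<not> s, ?i, ?j, b) \<noteq> col c" by (auto simp: col_def cc)
    qed
  qed
qed

text \<open>Every outer vertex occurs in gadgets of both colours, so each colour class sees all of
  them, and there are at most 3/2 per gadget. Inner vertices are two per gadget, but 1 + 0 in place
  of 4 at each corner; the deficit 9 is doubled to 18.\<close>

lemma card_GV:
  assumes t: "1 \<le> t"
  shows "2 * card (GV t) + 18 \<le> 7 * card (cells t)"
proof -
  define Sh where "Sh = (\<lambda>(c, k). loc t c k) ` (cells t \<times> {0, 1, 2})"
  define In where "In = (\<Union>c\<in>cells t. loc t c ` (LV t c \<inter> {3, 4}))"
  have sub: "GV t \<subseteq> Sh \<union> In"
  proof
    fix x assume "x \<in> GV t"
    then obtain c l where c: "c \<in> cells t" "l \<in> LV t c" "x = loc t c l" by (auto simp: GV_def VC_def)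
    have "l \<in> {0, 1, 2} \<or> l \<in> {3, 4}" using LV_less5[OF c(2)] by auto
    then show "x \<in> Sh \<union> In"
    proof
      assume "l \<in> {0, 1, 2}"
      then show ?thesis using c unfolding Sh_def by (intro UnI1 image_eqI[of _ _ "(c, l)"]) auto
    next
      assume "l \<in> {3, 4}"
      then show ?thesis using c unfolding In_def by blast
    qed
  qed
  have half: "card Sh \<le> 3 * card {c \<in> cells t. col c = f}" for f
  proof -
    have fin: "finite ({c \<in> cells t. col c = f} \<times> {0, 1, 2::nat})" using finite_cells by simp
    have "Sh \<subseteq> (\<lambda>(c, k). loc t c k) ` ({c \<in> cells t. col c = f} \<times> {0, 1, 2})"
    proof
      fix x assume "x \<in> Sh"
      then obtain p where p: "p \<in> cells t \<times> {0, 1, 2}" "x = (\<lambda>(c, k). loc t c k) p" unfolding Sh_def by blast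
      obtain c k where ck: "p = (c, k)" by (rule prod.exhaust)
      have c: "c \<in> cells t" "k \<in> {0, 1, 2}" "x = loc t c k" using p unfolding ck by simp_all
      then have "k < 3" by auto
      from partner[OF c(1) this] obtain c' where c': "c' \<in> cells t" "loc t c' k = loc t c k" "col c' \<noteq> col c" .
      show "x \<in> (\<lambda>(c, k). loc t c k) ` ({c \<in> cells t. col c = f} \<times> {0, 1, 2})"
      proof (cases "col c = f")
        case True
        then show ?thesis using c by (intro image_eqI[of _ _ "(c, k)"]) auto
      next
        case False
        then show ?thesis using c c' by (intro image_eqI[of _ _ "(c', k)"]) auto
      qed
    qed
    then have "card Sh \<le> card ({c \<in> cells t. col c = f} \<times> {0, 1, 2::nat})" using fin by (rule surj_card_le[rotated])
    then show ?thesis by (simp add: card_cartesian_product)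
  qed
  have "{c \<in> cells t. col c = True} \<union> {c \<in> cells t. col c = False} = cells t" by auto
  moreover have "card ({c \<in> cells t. col c = True} \<union> {c \<in> cells t. col c = False}) =
      card {c \<in> cells t. col c = True} + card {c \<in> cells t. col c = False}"
    using finite_cells by (intro card_Un_disjoint) auto
  ultimately have "2 * card Sh \<le> 3 * card (cells t)" using half[of True] half[of False] by simp
  moreover have "card In \<le> (\<Sum>c\<in>cells t. card (LV t c \<inter> {3, 4}))"
    unfolding In_def
    by (rule order_trans[OF card_UN_le[OF finite_cells] sum_mono]) (rule card_image_le, simp)
  moreover have "(\<Sum>c\<in>cells t. card (LV t c \<inter> {3, 4})) + 6 * 2 = 2 * card (cells t) + 3 * 1 + 3 * 0"
  proof (rule sum_cells[OF t])
    fix c assume c: "c \<in> cells t - Co t"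
    obtain s i j b where cc: "c = (s, i, j, b)" by (metis surj_pair)
    have "LV t c = {0, 1, 2, 3, 4}" using c corner_Co[OF t, of s i j b] by (simp add: cc LV_def)
    then show "card (LV t c \<inter> {3, 4}) = 2" by simp
  next
    fix i j assume "corner t False i j"
    then show "card (LV t (False, i, j, False) \<inter> {3, 4}) = 1 \<and> card (LV t (False, i, j, True) \<inter> {3, 4}) = 0"
      by (simp add: LV_def)
  qed
  moreover have "card (GV t) \<le> card Sh + card In"
  proof -
    have "finite (Sh \<union> In)" unfolding Sh_def In_def using finite_cells by auto
    then have "card (GV t) \<le> card (Sh \<union> In)" using sub by (rule card_mono)
    then show ?thesis using card_Un_le[of Sh In] by simp
  qed
  ultimately show ?thesis by simp
qed

text \<open>Inner vertices in the bottom row of the front show that the number of vertices is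
  unbounded in \<open>t\<close>.\<close>

lemma GV_large:
  assumes t: "1 \<le> t"
  shows "nat t \<le> card (GV t)"
proof -
  have "(\<lambda>i. ((5, i, - t), False)) ` {0..<t} \<subseteq> GV t"
  proof clarify
    fix i assume i: "i \<in> {0..<t}"
    have "(False, i, - t, False) \<in> cells t" using i by (simp add: cells_def valid_def)
    moreover have "3 \<in> LV t (False, i, - t, False)" by (simp add: LV_def)
    moreover have "((5, i, - t), False) = loc t (False, i, - t, False) 3" by (simp add: loc_def kp_def lv_def)
    ultimately show "((5, i, - t), False) \<in> GV t" unfolding GV_def VC_def by blast
  qed
  moreover have "finite (GV t)" using simple_G[of t] by (simp add: simple_graph_def)
  ultimately have "card ((\<lambda>i. ((5::nat, i, - t), False)) ` {0..<t}) \<le> card (GV t)" by (metis card_mono)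
  moreover have "card ((\<lambda>i. ((5::nat, i, - t), False)) ` {0..<t}) = card {0..<t}"
    by (rule card_image) (auto simp: inj_on_def)
  ultimately show ?thesis by simp
qed

lemma ex_planar_lower:
  assumes t: "1 \<le> t"
  shows "18 / 7 * real (card (GV t)) - 48 / 7 \<le> real (ex_planar (card (GV t)) Theta_6_2)"
proof -
  have "card (GE t) \<in> planar_free_sizes (card (GV t)) Theta_6_2"
    using planar_free_sizes_relabel[OF simple_G planar_G[OF t] free_G[OF t]] by simp
  then have "card (GE t) \<le> ex_planar (card (GV t)) Theta_6_2"
    unfolding ex_planar_def by (rule Max_ge[OF finite_planar_free_sizes])
  moreover have "18 * card (GV t) \<le> 7 * card (GE t) + 48" using card_GE[OF t] card_GV[OF t] by simp
  then have "18 * real (card (GV t)) \<le> 7 * real (card (GE t)) + 48" by linarith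
  ultimately show ?thesis by (simp add: field_simps)
qed

lemma infinitely_many_lower:
  "infinite {n. real (ex_planar n Theta_6_2) \<ge> 18 / 7 * real n - 48 / 7}"
  unfolding infinite_nat_iff_unbounded_le
proof
  fix m :: nat
  let ?t = "int m + 1"
  have "m \<le> card (GV ?t)" using GV_large[of ?t] by simp
  then show "\<exists>n\<ge>m. n \<in> {n. real (ex_planar n Theta_6_2) \<ge> 18 / 7 * real n - 48 / 7}"
    using ex_planar_lower[of ?t] by (intro exI[of _ "card (GV ?t)"]) simp
qed

theorem theorem4:
  "(\<forall>n\<ge>6. real (ex_planar n Theta_6_2) \<le> 18 / 7 * (real n - 2)) \<and>
   infinite {n. real (ex_planar n Theta_6_2) \<ge> 18 / 7 * real n - 48 / 7}"
  using ex_planar_upper infinitely_many_lower by blast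

end
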